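(* Let $M$ be a closed orientable 3-manifold. For every transversally orientable contact structure $\xi$ on $M$ there is a Riemannian metric on $M$ such that the Gaussian curvature of $\xi$ satisfies $K_G(\xi) = -1$ on $M$.
   Context: A (plane) distribution on a 3-manifold $M$ is a rank-two smooth subbundle $\xi$ of $TM$. It is a contact structure if for any linearly independent (local) sections $S, T$ of $\xi$ and any point $p$ the Lie bracket $[S,T]$ at $p$ does not belong to $\xi_p$. It is transversally orientable (transversally oriented) if there is a globally defined 1-form $\alpha$ with $\xi = \ker \alpha$; equivalently, if there is a globally defined vector field transverse to $\xi$. Let $\langle\cdot,\cdot\rangle$ be a Riemannian metric on $M$ with Levi-Civita connection $\nabla$, and let $n$ be a local unit vector field orthogonal to $\xi$. The second fundamental form of $\xi$ is the symmetric bilinear form $B(S,T) = \frac12\langle \nabla_S T + \nabla_T S, n\rangle$ for sections $S,T$ of $\xi$. The extrinsic curvature of $\xi$ is $$K_e(\xi) = \frac{B(S,S)B(T,T) - B(S,T)^2}{\langle S,S\rangle\langle T,T\rangle - \langle S,T\rangle^2}$$ for linearly independent local sections $S,T$ of $\xi$ (this does not depend on the choice of $S,T,n$). The sectional curvature $K(\xi)$ of $\xi$ is the function assigning to $p\in M$ the sectional curvature of the plane $\xi_p\subset T_pM$. The Gaussian curvature of $\xi$ is $K_G(\xi) = K(\xi) + K_e(\xi)$. *)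

theory Defs
  imports "HOL-Analysis.Analysis" "HOL-Library.Function_Algebras"
begin

text \<open>Pointwise real vector space structure on functions. It serves both for tangent vectors
  (derivations, hence functionals) and for vector fields.\<close>

instantiation "fun" :: (type, real_vector) real_vector
begin

definition scaleR_fun :: "real \<Rightarrow> ('a \<Rightarrow> 'b) \<Rightarrow> 'a \<Rightarrow> 'b"
  where "scaleR_fun c f = (\<lambda>x. c *\<^sub>R f x)"

instance
  by standard (simp_all add: scaleR_fun_def fun_eq_iff scaleR_add_right scaleR_add_left)

end

lemma scaleR_fun_apply [simp]: "(c *\<^sub>R f) x = c *\<^sub>R f x"
  by (simp add: scaleR_fun_def)

definition lin_indep2 :: "'v::real_vector \<Rightarrow> 'v \<Rightarrow> bool"
  where "lin_indep2 u v \<longleftrightarrow> u \<noteq> v \<and> independent {u, v}"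


section \<open>Smooth 3-manifolds\<close>

primrec Ck_on :: "nat \<Rightarrow> 'e::euclidean_space set \<Rightarrow> ('e \<Rightarrow> 'f::real_normed_vector) \<Rightarrow> bool"
  where
    "Ck_on 0 S f \<longleftrightarrow> continuous_on S f"
  | "Ck_on (Suc k) S f \<longleftrightarrow>
       (\<forall>x\<in>S. f differentiable (at x)) \<and> (\<forall>v. Ck_on k S (\<lambda>x. frechet_derivative f (at x) v))"

text \<open>Only used for open sets.\<close>
definition smooth_on :: "'e::euclidean_space set \<Rightarrow> ('e \<Rightarrow> 'f::real_normed_vector) \<Rightarrow> bool"
  where "smooth_on S f \<longleftrightarrow> (\<forall>k. Ck_on k S f)"

text \<open>A chart consists of its domain and its coordinate map; the values of the coordinate map
  outside the domain are irrelevant.\<close>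
type_synonym 'a chart = "'a set \<times> ('a \<Rightarrow> real^3)"

definition is_chart :: "'a::topological_space chart \<Rightarrow> bool"
  where "is_chart c \<longleftrightarrow> (case c of (U, \<phi>) \<Rightarrow>
    open U \<and> open (\<phi> ` U) \<and> homeomorphism U (\<phi> ` U) \<phi> (inv_into U \<phi>))"

text \<open>The manifold is the whole type, whose topology is required to be Hausdorff by the class
  constraint. Second countability is not demanded separately: it follows from compactness, which
  is the only case considered here. There is no boundary, as charts have open image in \<open>real^3\<close>.\<close>
definition smooth_atlas :: "'a::t2_space chart set \<Rightarrow> bool"
  where "smooth_atlas A \<longleftrightarrow>
    (\<forall>c\<in>A. is_chart c) \<and>
    (\<Union>c\<in>A. fst c) = UNIV \<and>
    (\<forall>(U, \<phi>)\<in>A. \<forall>(V, \<psi>)\<in>A. smooth_on (\<phi> ` (U \<inter> V)) (\<psi> \<circ> inv_into U \<phi>))"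

text \<open>An oriented atlas \<open>B\<close> belongs to the same smooth structure as \<open>A\<close> iff \<open>A \<union> B\<close> is again a
  smooth atlas.\<close>
definition orientable :: "'a::t2_space chart set \<Rightarrow> bool"
  where "orientable A \<longleftrightarrow>
    (\<exists>B. smooth_atlas B \<and> smooth_atlas (A \<union> B) \<and>
      (\<forall>(U, \<phi>)\<in>B. \<forall>(V, \<psi>)\<in>B. \<forall>x\<in>\<phi> ` (U \<inter> V).
         0 < det (matrix (frechet_derivative (\<psi> \<circ> inv_into U \<phi>) (at x)))))"

text \<open>Intended for open \<open>W\<close>.\<close>
definition smooth_fun_on :: "'a::t2_space chart set \<Rightarrow> 'a set \<Rightarrow> ('a \<Rightarrow> real) \<Rightarrow> bool"
  where "smooth_fun_on A W f \<longleftrightarrow>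
    (\<forall>(U, \<phi>)\<in>A. smooth_on (\<phi> ` (U \<inter> W)) (f \<circ> inv_into U \<phi>))"

definition smooth_near :: "'a::t2_space chart set \<Rightarrow> 'a \<Rightarrow> ('a \<Rightarrow> real) \<Rightarrow> bool"
  where "smooth_near A p f \<longleftrightarrow> (\<exists>W. open W \<and> p \<in> W \<and> smooth_fun_on A W f)"


section \<open>Tangent vectors and vector fields\<close>

type_synonym 'a tvec = "('a \<Rightarrow> real) \<Rightarrow> real"
type_synonym 'a vfield = "'a \<Rightarrow> 'a tvec"

text \<open>Tangent vectors at \<open>p\<close> are the derivations on functions that are smooth near \<open>p\<close>. Such a
  derivation automatically depends only on the germ: if \<open>h = 0\<close> on a neighbourhood \<open>U\<close> of \<open>p\<close>,
  let \<open>k\<close> be 0 on \<open>U\<close> and 1 elsewhere and apply the product rule to \<open>h = h * k\<close>. The value on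
  functions that are not smooth near \<open>p\<close> is normalised to 0, so that equality of tangent vectors
  is equality in HOL.\<close>
definition tangent_space :: "'a::t2_space chart set \<Rightarrow> 'a \<Rightarrow> 'a tvec set"
  where "tangent_space A p = {v.
    (\<forall>f. \<not> smooth_near A p f \<longrightarrow> v f = 0) \<and>
    (\<forall>f h a b. smooth_near A p f \<longrightarrow> smooth_near A p h \<longrightarrow>
       v (\<lambda>q. a * f q + b * h q) = a * v f + b * v h) \<and>
    (\<forall>f h. smooth_near A p f \<longrightarrow> smooth_near A p h \<longrightarrow>
       v (\<lambda>q. f q * h q) = f p * v h + h p * v f)}"

text \<open>Smooth vector fields on an open set \<open>U\<close>; values outside \<open>U\<close> are irrelevant.\<close>
definition vector_field_on :: "'a::t2_space chart set \<Rightarrow> 'a set \<Rightarrow> 'a vfield \<Rightarrow> bool"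
  where "vector_field_on A U X \<longleftrightarrow>
    (\<forall>p\<in>U. X p \<in> tangent_space A p) \<and>
    (\<forall>W f. open W \<longrightarrow> W \<subseteq> U \<longrightarrow> smooth_fun_on A W f \<longrightarrow> smooth_fun_on A W (\<lambda>q. X q f))"

definition lie_bracket :: "'a::t2_space chart set \<Rightarrow> 'a vfield \<Rightarrow> 'a vfield \<Rightarrow> 'a vfield"
  where "lie_bracket A X Y = (\<lambda>p f.
    if smooth_near A p f then X p (\<lambda>q. Y q f) - Y p (\<lambda>q. X q f) else 0)"


section \<open>Plane distributions and contact structures\<close>

text \<open>Rank-two smooth subbundles of the tangent bundle, by local frames.\<close>
definition distribution :: "'a::t2_space chart set \<Rightarrow> ('a \<Rightarrow> 'a tvec set) \<Rightarrow> bool"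
  where "distribution A \<xi> \<longleftrightarrow>
    (\<forall>p. \<exists>U S T. open U \<and> p \<in> U \<and> vector_field_on A U S \<and> vector_field_on A U T \<and>
       (\<forall>q\<in>U. lin_indep2 (S q) (T q) \<and> \<xi> q = span {S q, T q}))"

definition section_on ::
    "'a::t2_space chart set \<Rightarrow> ('a \<Rightarrow> 'a tvec set) \<Rightarrow> 'a set \<Rightarrow> 'a vfield \<Rightarrow> bool"
  where "section_on A \<xi> U S \<longleftrightarrow> vector_field_on A U S \<and> (\<forall>q\<in>U. S q \<in> \<xi> q)"

definition contact_structure :: "'a::t2_space chart set \<Rightarrow> ('a \<Rightarrow> 'a tvec set) \<Rightarrow> bool"
  where "contact_structure A \<xi> \<longleftrightarrow>
    distribution A \<xi> \<and>
    (\<forall>U S T. open U \<longrightarrow> section_on A \<xi> U S \<longrightarrow> section_on A \<xi> U T \<longrightarrow>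
       (\<forall>q\<in>U. lin_indep2 (S q) (T q)) \<longrightarrow>
       (\<forall>p\<in>U. lie_bracket A S T p \<notin> \<xi> p))"

definition one_form :: "'a::t2_space chart set \<Rightarrow> ('a \<Rightarrow> 'a tvec \<Rightarrow> real) \<Rightarrow> bool"
  where "one_form A \<alpha> \<longleftrightarrow>
    (\<forall>p. \<forall>u\<in>tangent_space A p. \<forall>v\<in>tangent_space A p. \<forall>a b.
       \<alpha> p (a *\<^sub>R u + b *\<^sub>R v) = a * \<alpha> p u + b * \<alpha> p v) \<and>
    (\<forall>U X. open U \<longrightarrow> vector_field_on A U X \<longrightarrow> smooth_fun_on A U (\<lambda>q. \<alpha> q (X q)))"

definition transversally_orientable ::
    "'a::t2_space chart set \<Rightarrow> ('a \<Rightarrow> 'a tvec set) \<Rightarrow> bool"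
  where "transversally_orientable A \<xi> \<longleftrightarrow>
    (\<exists>\<alpha>. one_form A \<alpha> \<and> (\<forall>p. \<xi> p = {v \<in> tangent_space A p. \<alpha> p v = 0}))"


section \<open>Riemannian metrics, Levi-Civita connection and curvature\<close>

type_synonym 'a metric = "'a \<Rightarrow> 'a tvec \<Rightarrow> 'a tvec \<Rightarrow> real"

definition riemannian_metric :: "'a::t2_space chart set \<Rightarrow> 'a metric \<Rightarrow> bool"
  where "riemannian_metric A g \<longleftrightarrow>
    (\<forall>p. \<forall>u\<in>tangent_space A p. \<forall>v\<in>tangent_space A p. \<forall>w\<in>tangent_space A p. \<forall>a b.
       g p (a *\<^sub>R u + b *\<^sub>R v) w = a * g p u w + b * g p v w) \<and>
    (\<forall>p. \<forall>u\<in>tangent_space A p. \<forall>v\<in>tangent_space A p. g p u v = g p v u) \<and>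
    (\<forall>p. \<forall>v\<in>tangent_space A p. v \<noteq> 0 \<longrightarrow> 0 < g p v v) \<and>
    (\<forall>U X Y. open U \<longrightarrow> vector_field_on A U X \<longrightarrow> vector_field_on A U Y \<longrightarrow>
       smooth_fun_on A U (\<lambda>q. g q (X q) (Y q)))"

text \<open>\<open>D X Y\<close> is the covariant derivative of \<open>Y\<close> along \<open>X\<close>. The clauses are: affine connection on
  local vector fields over every open set, absence of torsion, and compatibility with \<open>g\<close>.\<close>
definition is_levi_civita ::
    "'a::t2_space chart set \<Rightarrow> 'a metric \<Rightarrow> ('a vfield \<Rightarrow> 'a vfield \<Rightarrow> 'a vfield) \<Rightarrow> bool"
  where "is_levi_civita A g D \<longleftrightarrow>
    (\<forall>U X Y Z f. open U \<longrightarrow> vector_field_on A U X \<longrightarrow> vector_field_on A U Y \<longrightarrow>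
       vector_field_on A U Z \<longrightarrow> smooth_fun_on A U f \<longrightarrow>
       vector_field_on A U (D X Y) \<and>
       (\<forall>p\<in>U.
          D (X + Y) Z p = D X Z p + D Y Z p \<and>
          D (\<lambda>q. f q *\<^sub>R X q) Y p = f p *\<^sub>R D X Y p \<and>
          D X (Y + Z) p = D X Y p + D X Z p \<and>
          D X (\<lambda>q. f q *\<^sub>R Y q) p = X p f *\<^sub>R Y p + f p *\<^sub>R D X Y p \<and>
          D X Y p - D Y X p = lie_bracket A X Y p \<and>
          X p (\<lambda>q. g q (Y q) (Z q)) = g p (D X Y p) (Z p) + g p (Y p) (D X Z p)))"

text \<open>By the fundamental theorem of Riemannian geometry such a connection exists, and its values on
  local vector fields are unique. The choice therefore only affects arguments that are not smooth
  vector fields.\<close>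
definition levi_civita ::
    "'a::t2_space chart set \<Rightarrow> 'a metric \<Rightarrow> 'a vfield \<Rightarrow> 'a vfield \<Rightarrow> 'a vfield"
  where "levi_civita A g = (SOME D. is_levi_civita A g D)"

definition curvature_tensor ::
    "'a::t2_space chart set \<Rightarrow> 'a metric \<Rightarrow> 'a vfield \<Rightarrow> 'a vfield \<Rightarrow> 'a vfield \<Rightarrow> 'a vfield"
  where "curvature_tensor A g X Y Z =
    levi_civita A g X (levi_civita A g Y Z) - levi_civita A g Y (levi_civita A g X Z)
      - levi_civita A g (lie_bracket A X Y) Z"

text \<open>The sectional curvature of the plane \<open>P\<close> at \<open>p\<close>, computed from any local vector fields whose
  values at \<open>p\<close> form a basis of \<open>P\<close>; the result does not depend on them.\<close>
definition sectional_curvature ::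
    "'a::t2_space chart set \<Rightarrow> 'a metric \<Rightarrow> 'a \<Rightarrow> 'a tvec set \<Rightarrow> real"
  where "sectional_curvature A g p P = (THE k. \<exists>U X Y.
    open U \<and> p \<in> U \<and> vector_field_on A U X \<and> vector_field_on A U Y \<and>
    lin_indep2 (X p) (Y p) \<and> P = span {X p, Y p} \<and>
    k = g p (curvature_tensor A g X Y Y p) (X p) /
        (g p (X p) (X p) * g p (Y p) (Y p) - (g p (X p) (Y p))\<^sup>2))"

definition unit_normal_on ::
    "'a::t2_space chart set \<Rightarrow> 'a metric \<Rightarrow> ('a \<Rightarrow> 'a tvec set) \<Rightarrow> 'a set \<Rightarrow> 'a vfield \<Rightarrow> bool"
  where "unit_normal_on A g \<xi> U n \<longleftrightarrow>
    vector_field_on A U n \<and>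
    (\<forall>q\<in>U. g q (n q) (n q) = 1 \<and> (\<forall>v\<in>\<xi> q. g q v (n q) = 0))"

definition second_fundamental_form ::
    "'a::t2_space chart set \<Rightarrow> 'a metric \<Rightarrow> 'a vfield \<Rightarrow> 'a vfield \<Rightarrow> 'a vfield \<Rightarrow> 'a \<Rightarrow> real"
  where "second_fundamental_form A g n S T p =
    1 / 2 * g p (levi_civita A g S T p + levi_civita A g T S p) (n p)"

definition extrinsic_curvature ::
    "'a::t2_space chart set \<Rightarrow> 'a metric \<Rightarrow> ('a \<Rightarrow> 'a tvec set) \<Rightarrow> 'a \<Rightarrow> real"
  where "extrinsic_curvature A g \<xi> p = (THE k. \<exists>U S T n.
    open U \<and> p \<in> U \<and> section_on A \<xi> U S \<and> section_on A \<xi> U T \<and>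
    (\<forall>q\<in>U. lin_indep2 (S q) (T q)) \<and> unit_normal_on A g \<xi> U n \<and>
    k = (second_fundamental_form A g n S S p * second_fundamental_form A g n T T p
          - (second_fundamental_form A g n S T p)\<^sup>2) /
        (g p (S p) (S p) * g p (T p) (T p) - (g p (S p) (T p))\<^sup>2))"

definition gaussian_curvature ::
    "'a::t2_space chart set \<Rightarrow> 'a metric \<Rightarrow> ('a \<Rightarrow> 'a tvec set) \<Rightarrow> 'a \<Rightarrow> real"
  where "gaussian_curvature A g \<xi> p =
    sectional_curvature A g p (\<xi> p) + extrinsic_curvature A g \<xi> p"

end

theory Submission
  imports Defs
begin

text \<open>Write \<open>\<xi> = ker \<alpha>\<close>. If \<open>S, T\<close> is a local frame of \<open>\<xi>\<close>, the contact condition makes \<open>[S, T]\<close>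
  transverse to \<open>\<xi>\<close>, so \<open>S, T, [S, T]\<close> frames the tangent bundle and all local computations can be
  done without coordinate vector fields. In an orthonormal frame \<open>E1, E2, E3\<close> with \<open>E1, E2\<close> in
  \<open>\<xi>\<close> and \<open>[E1, E2] = a E1 + b E2 + c E3\<close>, the extrinsic part of the Gauss equation combines with the
  extrinsic curvature to
  \<open>K\<^sub>G = E1 b - E2 a - a\<^sup>2 - b\<^sup>2 + (c / 2) (\<langle>[E3, E1], E2\<rangle> - \<langle>[E3, E2], E1\<rangle>) - (3 / 4) c\<^sup>2\<close>.
  Replacing a metric \<open>g\<close> by \<open>s\<^sup>2 g + f \<alpha> \<otimes> \<alpha>\<close>, with \<open>s > 0\<close> constant and \<open>f \<ge> 0\<close> a function,
  keeps the normal direction and only rescales the frame, and the formula shows that the Gaussian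
  curvature becomes \<open>K / s\<^sup>2 - f \<Delta> / s\<^sup>4\<close>. Here \<open>K\<close> is the Gaussian curvature for \<open>g\<close>, and
  \<open>\<Delta> = (3 / 4) c\<^sup>2 \<alpha>(E3)\<^sup>2 > 0\<close> is globally defined, being the difference of the curvatures for
  \<open>g\<close> and \<open>g + \<alpha> \<otimes> \<alpha>\<close>. By compactness some \<open>s\<close> satisfies \<open>K + s\<^sup>2 \<ge> 0\<close>, and then
  \<open>f = s\<^sup>2 (K + s\<^sup>2) / \<Delta>\<close> gives curvature \<open>- 1\<close>.\<close>

section \<open>Calculus of \<open>C\<^sup>k\<close> maps\<close>

text \<open>The equation for \<open>f\<close> is algebraic and not differential. The derivative of
  the length of the normal field occurs only in brackets with \<open>E3\<close>, and there as a
  multiple of \<open>E3\<close>, while the curvature formula uses only the components of these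
  brackets along the plane. The length itself cancels in the product of c with the bracket
  difference, so \<open>f\<close> survives in the c^2 term alone, and affinely. The sign of that
  term shapes the rest: \<open>f\<close> must be nonnegative to keep the metric definite, hence it
  can only lower the curvature. Reaching -1 after stretching means lowering K to -s^2, and a large
  \<open>s\<close> puts this target below K everywhere. Tangent vectors are derivations, and the
  dimension of the space of derivations is never computed. That three fields span comes from
  \<alpha>: its kernel is spanned by two of them, and it does not vanish on their bracket. The
  initial metric is likewise not transported from charts; it is \<alpha> \<otimes> \<alpha> plus the
  squared differentials of finitely many global functions that separate the vectors of
  \<xi>.\<close>

lemma Ck_on_subset: "Ck_on k S f \<Longrightarrow> T \<subseteq> S \<Longrightarrow> Ck_on k T f"
  by (induction k arbitrary: f) (auto intro: continuous_on_subset)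

lemma Ck_on_cong:
  assumes "open S" and "\<And>x. x \<in> S \<Longrightarrow> f x = g x" and "Ck_on k S f"
  shows "Ck_on k S g"
  using assms(2,3)
proof (induction k arbitrary: f g)
  case 0
  then show ?case by (simp cong: continuous_on_cong)
next
  case (Suc k)
  have D: "(g has_derivative frechet_derivative f (at x)) (at x)" if "x \<in> S" for x
    using Suc.prems that assms(1)
    by (auto intro!: has_derivative_transform_within_open[of f _ x UNIV S g]
        simp: frechet_derivative_works[symmetric])
  have eq: "frechet_derivative f (at x) = frechet_derivative g (at x)" if "x \<in> S" for x
    using D[OF that] by (rule frechet_derivative_at)
  have "Ck_on k S (\<lambda>x. frechet_derivative g (at x) v)" for v
    by (rule Suc.IH[of "\<lambda>x. frechet_derivative f (at x) v"]) (use eq Suc.prems in auto)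
  then show ?case
    using D by (auto simp: differentiable_def)
qed

lemma Ck_on_SucI:
  assumes "open S" and D: "\<And>x. x \<in> S \<Longrightarrow> (f has_derivative f' x) (at x)"
    and C: "\<And>v. Ck_on k S (\<lambda>x. f' x v)"
  shows "Ck_on (Suc k) S f"
proof -
  have "Ck_on k S (\<lambda>x. frechet_derivative f (at x) v)" for v
    by (rule Ck_on_cong[OF assms(1) _ C[of v]]) (simp add: frechet_derivative_at[OF D, symmetric])
  then show ?thesis
    using D by (auto simp: differentiable_def)
qed

lemma Ck_on_has_derivative:
  "Ck_on (Suc k) S f \<Longrightarrow> x \<in> S \<Longrightarrow> (f has_derivative frechet_derivative f (at x)) (at x)"
  by (simp add: frechet_derivative_works[symmetric])

lemma Ck_on_SucD: "Ck_on (Suc k) S f \<Longrightarrow> Ck_on k S f"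
proof (induction k arbitrary: f)
  case 0
  then show ?case
    by (simp add: differentiable_imp_continuous_within continuous_on_eq_continuous_within
        differentiable_at_withinI)
next
  case (Suc k)
  then show ?case
    by (metis Ck_on.simps(2))
qed

lemma at_within_Int_open_eq: "x \<in> T \<Longrightarrow> open T \<Longrightarrow> at x within S \<inter> T = at x within S"
  by (rule at_within_nhd[of x T]) auto

text \<open>Only order 0 is a question of topology: differentiability in \<open>Ck_on\<close> is
  taken at the point and not within \<open>S\<close>, so it is inherited from any piece around the
  point.\<close>

lemma Ck_on_local:
  assumes "\<And>x. x \<in> S \<Longrightarrow> \<exists>T. open T \<and> x \<in> T \<and> Ck_on k (S \<inter> T) f"
  shows "Ck_on k S f"
  using assms
proof (induction k arbitrary: f)
  case 0
  have "continuous (at x within S) f" if x: "x \<in> S" for x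
  proof -
    from 0[OF x] obtain T where "open T" "x \<in> T" "continuous_on (S \<inter> T) f" by auto
    then show ?thesis
      using x by (metis IntI at_within_Int_open_eq continuous_on_eq_continuous_within)
  qed
  then show ?case by (simp add: continuous_on_eq_continuous_within)
next
  case (Suc k)
  have "f differentiable at x" if x: "x \<in> S" for x
  proof -
    from Suc.prems[OF x] obtain T where "x \<in> T" "Ck_on (Suc k) (S \<inter> T) f" by blast
    then show ?thesis using x by simp
  qed
  moreover have "Ck_on k S (\<lambda>x. frechet_derivative f (at x) v)" for v
  proof (rule Suc.IH)
    fix x assume "x \<in> S"
    from Suc.prems[OF this]
    show "\<exists>T. open T \<and> x \<in> T \<and> Ck_on k (S \<inter> T) (\<lambda>x. frechet_derivative f (at x) v)"
      by (metis Ck_on.simps(2))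
  qed
  ultimately show ?case by simp
qed

lemma Ck_on_const: "Ck_on k S (\<lambda>x. c)"
proof (induction k arbitrary: c)
  case (Suc k)
  show ?case by (simp add: Suc)
qed simp

lemma Ck_on_ident: "open S \<Longrightarrow> Ck_on k S (\<lambda>x. x)"
proof (cases k)
  case (Suc j)
  assume "open S"
  then have "Ck_on (Suc j) S (\<lambda>x. x)"
    by (rule Ck_on_SucI) (rule has_derivative_ident, rule Ck_on_const)
  then show ?thesis by (simp only: Suc)
qed simp

lemma Ck_on_add:
  assumes "open S" and "Ck_on k S f" and "Ck_on k S g"
  shows "Ck_on k S (\<lambda>x. f x + g x)"
  using assms(2,3)
proof (induction k arbitrary: f g)
  case 0
  then show ?case by (auto intro: continuous_on_add)
next
  case (Suc k)
  show ?case
  proof (rule Ck_on_SucI[OF assms(1)])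
    show "((\<lambda>x. f x + g x) has_derivative
        (\<lambda>v. frechet_derivative f (at x) v + frechet_derivative g (at x) v)) (at x)"
      if "x \<in> S" for x
      by (rule has_derivative_add[OF Ck_on_has_derivative[OF Suc.prems(1) that] Ck_on_has_derivative[OF Suc.prems(2) that]])
    show "Ck_on k S (\<lambda>x. frechet_derivative f (at x) v + frechet_derivative g (at x) v)" for v
      using Suc by auto
  qed
qed

lemma (in bounded_bilinear) Ck_on:
  assumes "open S" and "Ck_on k S f" and "Ck_on k S g"
  shows "Ck_on k S (\<lambda>x. prod (f x) (g x))"
  using assms(2,3)
proof (induction k arbitrary: f g)
  case 0
  then show ?case by (auto intro: continuous_on)
next
  case (Suc k)
  show ?case
  proof (rule Ck_on_SucI[OF assms(1)])
    show "((\<lambda>x. prod (f x) (g x)) has_derivative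
        (\<lambda>v. prod (f x) (frechet_derivative g (at x) v) + prod (frechet_derivative f (at x) v) (g x)))
        (at x)"
      if "x \<in> S" for x
      by (rule FDERIV[OF Ck_on_has_derivative[OF Suc.prems(1) that] Ck_on_has_derivative[OF Suc.prems(2) that]])
    show "Ck_on k S (\<lambda>x. prod (f x) (frechet_derivative g (at x) v)
        + prod (frechet_derivative f (at x) v) (g x))" for v
      by (intro Ck_on_add[OF assms(1)] Suc.IH) (use Suc.prems Ck_on_SucD in auto)
  qed
qed

lemmas Ck_on_mult = bounded_bilinear.Ck_on[OF bounded_bilinear_mult]
lemmas Ck_on_scaleR = bounded_bilinear.Ck_on[OF bounded_bilinear_scaleR]
lemmas Ck_on_inner = bounded_bilinear.Ck_on[OF bounded_bilinear_inner]

lemma Ck_on_sum: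
  "open S \<Longrightarrow> (\<And>i. i \<in> I \<Longrightarrow> Ck_on k S (f i)) \<Longrightarrow> Ck_on k S (\<lambda>x. \<Sum>i\<in>I. f i x)"
  by (induction I rule: infinite_finite_induct) (auto intro: Ck_on_const Ck_on_add)

lemma Ck_on_compose:
  fixes f :: "'e::euclidean_space \<Rightarrow> 'f::euclidean_space" and g :: "'f \<Rightarrow> 'g::real_normed_vector"
  assumes "open S" and "open T" and "f ` S \<subseteq> T" and "Ck_on k S f" and "Ck_on k T g"
  shows "Ck_on k S (g \<circ> f)"
  using assms(4,5)
proof (induction k arbitrary: g)
  case 0
  then show ?case
    using assms(3) continuous_on_compose[of S f g] continuous_on_subset[of T g "f ` S"] by simp
next
  case (Suc k)
  let ?f' = "\<lambda>x. frechet_derivative f (at x)" and ?g' = "\<lambda>y. frechet_derivative g (at y)"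
  show ?case
  proof (rule Ck_on_SucI[OF assms(1)])
    \<comment> \<open>\<open>Ck_on\<close> speaks of derivatives in fixed directions, while the
      chain rule evaluates the derivative of \<open>g\<close> in the moving direction
      \<open>?f' x v\<close>. Expanding this direction in \<open>Basis\<close> leaves a sum of
      products whose factors only involve fixed directions.\<close>
    show "((g \<circ> f) has_derivative (\<lambda>v. \<Sum>b\<in>Basis. (?f' x v \<bullet> b) *\<^sub>R ?g' (f x) b)) (at x)"
      if x: "x \<in> S" for x
    proof -
      have f: "(f has_derivative ?f' x) (at x)"
        by (rule Ck_on_has_derivative[OF Suc.prems(1) x])
      have g: "(g has_derivative ?g' (f x)) (at (f x))"
        by (rule Ck_on_has_derivative[OF Suc.prems(2)]) (use x assms(3) in auto)
      have lin: "linear (?g' (f x))"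
        using g has_derivative_linear by blast
      have rep: "?g' (f x) w = (\<Sum>b\<in>Basis. (w \<bullet> b) *\<^sub>R ?g' (f x) b)" for w
      proof -
        have "?g' (f x) w = ?g' (f x) (\<Sum>b\<in>Basis. (w \<bullet> b) *\<^sub>R b)"
          by (simp add: euclidean_representation)
        then show ?thesis
          using lin by (simp add: linear_sum linear_cmul)
      qed
      have "?g' (f x) \<circ> ?f' x = (\<lambda>v. \<Sum>b\<in>Basis. (?f' x v \<bullet> b) *\<^sub>R ?g' (f x) b)"
        by (rule ext, unfold o_apply, rule rep)
      then show ?thesis
        using diff_chain_at[OF f g] by (simp only:)
    qed
    show "Ck_on k S (\<lambda>x. \<Sum>b\<in>Basis. (?f' x v \<bullet> b) *\<^sub>R ?g' (f x) b)" for v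
    proof (intro Ck_on_sum Ck_on_scaleR Ck_on_inner Ck_on_const assms(1))
      show "Ck_on k S (\<lambda>x. ?f' x v)"
        using Suc.prems(1) by simp
      show "Ck_on k S (\<lambda>x. ?g' (f x) b)" for b
        using Suc.IH[of "\<lambda>y. ?g' y b"] Suc.prems Ck_on_SucD by (auto simp: o_def)
    qed
  qed
qed

section \<open>Smoothness of the inverse, the square root and the flat exponential\<close>

lemma smooth_on_inverse: "smooth_on (- {0}) (inverse :: real \<Rightarrow> real)"
  unfolding smooth_on_def
proof
  fix k
  show "Ck_on k (- {0}) (inverse :: real \<Rightarrow> real)"
  proof (induction k)
    case 0
    show ?case by (auto intro: continuous_on_inverse continuous_on_id)
  next
    case (Suc k)
    show ?case
    proof (rule Ck_on_SucI)
      \<comment> \<open>The derivative is a polynomial in \<open>inverse\<close> itself, so the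
        induction hypothesis for the same function suffices. The derivative of \<open>sqrt\<close>
        is likewise expressed through \<open>sqrt\<close>.\<close>
      show "(inverse has_derivative (\<lambda>v. (- 1) * (inverse x * v * inverse x))) (at x)"
        if "x \<in> - {0}" for x :: real
        using has_derivative_inverse'[of x UNIV] that by simp
    qed (intro Ck_on_mult Ck_on_const Suc open_Compl closed_singleton)+
  qed
qed

lemma smooth_on_sqrt: "smooth_on {0<..} sqrt"
  unfolding smooth_on_def
proof
  fix k
  show "Ck_on k {0<..} sqrt"
  proof (induction k)
    case 0
    show ?case by (auto intro: continuous_on_real_sqrt continuous_on_id)
  next
    case (Suc k)
    show ?case
    proof (rule Ck_on_SucI)
      show "(sqrt has_derivative (\<lambda>v. (inverse \<circ> sqrt) x / 2 * v)) (at x)"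
        if "x \<in> {0<..}" for x :: real
        using DERIV_real_sqrt[of x] that
        by (simp add: has_field_derivative_def o_def del: times_divide_eq_left)
      have "Ck_on k {0<..} (inverse \<circ> sqrt)"
        by (rule Ck_on_compose[where T = "- {0}"])
          (use Suc smooth_on_inverse in \<open>auto simp: smooth_on_def\<close>)
      then show "Ck_on k {0<..} (\<lambda>x. (inverse \<circ> sqrt) x / 2 * v)" for v
        by (simp only: divide_inverse) (intro Ck_on_mult Ck_on_const open_greaterThan)
    qed simp
  qed
qed

text \<open>\<open>flat 0\<close> is the classical function exp(-1/x), extended by 0, which vanishes
  to infinite order at 0. The factors 1/x^m make the linear span of the family closed under
  differentiation, as an induction on the order requires.\<close>

definition flat :: "nat \<Rightarrow> real \<Rightarrow> real"
  where "flat m x = (if x \<le> 0 then 0 else inverse x ^ m * exp (- inverse x))"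

lemma flat_tendsto_0: "(flat m \<longlongrightarrow> 0) (at 0)"
proof (rule filterlim_split_at)
  show "(flat m \<longlongrightarrow> 0) (at_left 0)"
    by (rule tendsto_eventually) (auto simp: eventually_at_filter flat_def)
  have "((\<lambda>y::real. y ^ m / exp y) \<longlongrightarrow> 0) at_top"
    by (rule tendsto_power_div_exp_0)
  from filterlim_compose[OF this filterlim_inverse_at_top_right]
  have "((\<lambda>x::real. inverse x ^ m / exp (inverse x)) \<longlongrightarrow> 0) (at_right 0)" .
  then show "(flat m \<longlongrightarrow> 0) (at_right 0)"
    by (rule Lim_transform_eventually)
      (auto simp: eventually_at_filter flat_def exp_minus divide_inverse)
qed

lemma flat_DERIV: "(flat m has_field_derivative (flat (m + 2) x - m * flat (m + 1) x)) (at x)"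
proof (cases x "0 :: real" rule: linorder_cases)
  case less
  have "((\<lambda>x. 0) has_field_derivative 0) (at x)"
    by simp
  then have "(flat m has_field_derivative 0) (at x)"
    by (rule has_field_derivative_transform_within_open[where S = "{..<0}"])
      (use less in \<open>auto simp: flat_def\<close>)
  then show ?thesis
    using less by (simp add: flat_def)
next
  case equal
  \<comment> \<open>At 0 the difference quotient of a member of the family is the next member, and
    all members tend to 0.\<close>
  have "(flat m (0 + h) - flat m 0) / h = flat (m + 1) h" for h
    by (simp add: flat_def divide_inverse mult_ac)
  then show ?thesis
    unfolding DERIV_def using flat_tendsto_0[of "m + 1"] equal by (simp add: flat_def[of _ 0])
next
  case greater
  have D: "(inverse has_field_derivative - (inverse x ^ 2)) (at x)"
    using DERIV_inverse[of x UNIV] greater by (simp add: power2_eq_square)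
  have "((\<lambda>x. inverse x ^ m * exp (- inverse x)) has_field_derivative
      inverse x ^ (m + 2) * exp (- inverse x) - m * (inverse x ^ (m + 1) * exp (- inverse x))) (at x)"
    by (rule DERIV_cong[OF DERIV_mult[OF DERIV_power[OF D] DERIV_fun_exp[OF DERIV_minus[OF D]]]])
      (cases m; simp add: algebra_simps power2_eq_square)
  then have "(flat m has_field_derivative
      inverse x ^ (m + 2) * exp (- inverse x) - m * (inverse x ^ (m + 1) * exp (- inverse x))) (at x)"
    by (rule has_field_derivative_transform_within_open[where S = "{0<..}"])
      (use greater in \<open>auto simp: flat_def\<close>)
  then show ?thesis
    using greater by (simp add: flat_def)
qed

lemma smooth_on_flat: "smooth_on UNIV (flat m)"
  unfolding smooth_on_def
proof
  fix k
  show "Ck_on k UNIV (flat m)"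
  proof (induction k arbitrary: m)
    case 0
    then show ?case
      using DERIV_continuous_on[OF has_field_derivative_at_within[OF flat_DERIV]] by simp
  next
    case (Suc k)
    show ?case
    proof (rule Ck_on_SucI)
      show "(flat m has_derivative (\<lambda>v. (flat (m + 2) x + (- real m) * flat (m + 1) x) * v)) (at x)"
        for x
        using flat_DERIV[of m x] by (simp add: has_field_derivative_def)
      show "Ck_on k UNIV (\<lambda>x. (flat (m + 2) x + (- real m) * flat (m + 1) x) * v)" for v
        by (intro Ck_on_mult Ck_on_add Ck_on_const open_UNIV Suc)
    qed simp
  qed
qed

section \<open>Smooth functions on a manifold\<close>

locale smooth_manifold =
  fixes A :: "'a::t2_space chart set"
  assumes atlas: "smooth_atlas A"
begin

abbreviation smooth_fun :: "'a set \<Rightarrow> ('a \<Rightarrow> real) \<Rightarrow> bool"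
  where "smooth_fun \<equiv> smooth_fun_on A"

lemma chart_homeomorphism:
  "(U, \<phi>) \<in> A \<Longrightarrow> homeomorphism U (\<phi> ` U) \<phi> (inv_into U \<phi>)"
  using atlas by (fastforce simp: smooth_atlas_def is_chart_def)

lemma chart_open: "(U, \<phi>) \<in> A \<Longrightarrow> open U"
  using atlas by (fastforce simp: smooth_atlas_def is_chart_def)

lemma chart_inverse [simp]: "(U, \<phi>) \<in> A \<Longrightarrow> q \<in> U \<Longrightarrow> inv_into U \<phi> (\<phi> q) = q"
  using chart_homeomorphism homeomorphism_apply1 by blast

lemma chart_inj_on: "(U, \<phi>) \<in> A \<Longrightarrow> inj_on \<phi> U"
  by (metis chart_inverse inj_on_inverseI)

lemma chart_open_image:
  assumes "(U, \<phi>) \<in> A" and "open W"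
  shows "open (\<phi> ` (U \<inter> W))"
proof -
  have "openin (top_of_set (\<phi> ` U)) (\<phi> ` (U \<inter> W))"
    by (rule homeomorphism_imp_open_map[OF chart_homeomorphism[OF assms(1)]])
      (use assms(2) in auto)
  moreover have "open (\<phi> ` U)"
    using atlas assms(1) by (fastforce simp: smooth_atlas_def is_chart_def)
  ultimately show ?thesis
    using openin_open_trans by blast
qed

lemma chart_exists: obtains U \<phi> where "(U, \<phi>) \<in> A" and "p \<in> U"
proof -
  have "p \<in> (\<Union>c\<in>A. fst c)"
    using atlas by (auto simp: smooth_atlas_def)
  then show ?thesis using that by auto
qed

lemma smooth_funI:
  "(\<And>U \<phi> k. (U, \<phi>) \<in> A \<Longrightarrow> Ck_on k (\<phi> ` (U \<inter> W)) (f \<circ> inv_into U \<phi>)) \<Longrightarrow> smooth_fun W f"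
  by (auto simp: smooth_fun_on_def smooth_on_def)

lemma smooth_funD:
  "smooth_fun W f \<Longrightarrow> (U, \<phi>) \<in> A \<Longrightarrow> Ck_on k (\<phi> ` (U \<inter> W)) (f \<circ> inv_into U \<phi>)"
  by (auto simp: smooth_fun_on_def smooth_on_def)

lemma smooth_fun_subset: "smooth_fun W f \<Longrightarrow> W' \<subseteq> W \<Longrightarrow> smooth_fun W' f"
  by (intro smooth_funI, rule Ck_on_subset[OF smooth_funD]) auto

lemma smooth_fun_cong:
  assumes "open W" and "\<And>q. q \<in> W \<Longrightarrow> f q = h q" and "smooth_fun W f"
  shows "smooth_fun W h"
proof (rule smooth_funI)
  fix U \<phi> k assume c: "(U, \<phi>) \<in> A"
  show "Ck_on k (\<phi> ` (U \<inter> W)) (h \<circ> inv_into U \<phi>)"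
    by (rule Ck_on_cong[OF chart_open_image[OF c assms(1)] _ smooth_funD[OF assms(3) c]])
      (use c assms(2) in auto)
qed

lemma smooth_fun_local:
  assumes "\<And>p. p \<in> W \<Longrightarrow> \<exists>W'. open W' \<and> p \<in> W' \<and> smooth_fun (W \<inter> W') f"
  shows "smooth_fun W f"
proof (rule smooth_funI, rule Ck_on_local)
  fix U \<phi> k x assume c: "(U, \<phi>) \<in> A" and "x \<in> \<phi> ` (U \<inter> W)"
  then obtain q where q: "q \<in> U" "q \<in> W" "x = \<phi> q" by auto
  obtain W' where W': "open W'" "q \<in> W'" "smooth_fun (W \<inter> W') f"
    using assms[OF q(2)] by auto
  have "\<phi> ` (U \<inter> W) \<inter> \<phi> ` (U \<inter> W') = \<phi> ` (U \<inter> (W \<inter> W'))"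
    using chart_inj_on[OF c] by (auto simp: inj_on_def)
  then show "\<exists>T. open T \<and> x \<in> T \<and> Ck_on k (\<phi> ` (U \<inter> W) \<inter> T) (f \<circ> inv_into U \<phi>)"
    using smooth_funD[OF W'(3) c, of k] chart_open_image[OF c W'(1)] q W'(2)
    by (intro exI[of _ "\<phi> ` (U \<inter> W')"]) auto
qed

lemma smooth_fun_const: "smooth_fun W (\<lambda>q. c)"
  by (rule smooth_funI) (simp add: o_def Ck_on_const)

lemma smooth_fun_add:
  "open W \<Longrightarrow> smooth_fun W f \<Longrightarrow> smooth_fun W h \<Longrightarrow> smooth_fun W (\<lambda>q. f q + h q)"
  by (rule smooth_funI, unfold o_def, rule Ck_on_add[OF chart_open_image])
    (auto dest: smooth_funD simp: o_def)

lemma smooth_fun_mult: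
  "open W \<Longrightarrow> smooth_fun W f \<Longrightarrow> smooth_fun W h \<Longrightarrow> smooth_fun W (\<lambda>q. f q * h q)"
  by (rule smooth_funI, unfold o_def, rule Ck_on_mult[OF chart_open_image])
    (auto dest: smooth_funD simp: o_def)

lemma smooth_fun_diff:
  assumes "open W" and "smooth_fun W f" and "smooth_fun W h"
  shows "smooth_fun W (\<lambda>q. f q - h q)"
  using smooth_fun_add[OF assms(1,2) smooth_fun_mult[OF assms(1) smooth_fun_const[of W "- 1"] assms(3)]]
  by simp

lemma smooth_fun_compose:
  assumes "open W" and "open T" and "f ` W \<subseteq> T" and "smooth_fun W f" and "smooth_on T h"
  shows "smooth_fun W (\<lambda>q. h (f q))"
proof (rule smooth_funI)
  fix U \<phi> k assume c: "(U, \<phi>) \<in> A"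
  have "Ck_on k (\<phi> ` (U \<inter> W)) (h \<circ> (f \<circ> inv_into U \<phi>))"
    by (rule Ck_on_compose[OF chart_open_image[OF c assms(1)] assms(2) _ smooth_funD[OF assms(4) c]])
      (use c assms(3,5) in \<open>auto simp: smooth_on_def\<close>)
  then show "Ck_on k (\<phi> ` (U \<inter> W)) ((\<lambda>q. h (f q)) \<circ> inv_into U \<phi>)"
    by (simp add: o_def)
qed

lemma smooth_fun_divide:
  assumes "open W" and "smooth_fun W f" and "smooth_fun W h" and "\<And>q. q \<in> W \<Longrightarrow> h q \<noteq> 0"
  shows "smooth_fun W (\<lambda>q. f q / h q)"
  unfolding divide_inverse
  by (intro smooth_fun_mult assms smooth_fun_compose[OF assms(1) _ _ assms(3) smooth_on_inverse])
    (use assms(4) in auto)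

lemma smooth_fun_sqrt:
  assumes "open W" and "smooth_fun W f" and "\<And>q. q \<in> W \<Longrightarrow> 0 < f q"
  shows "smooth_fun W (\<lambda>q. sqrt (f q))"
  by (rule smooth_fun_compose[OF assms(1) _ _ assms(2) smooth_on_sqrt]) (use assms(3) in auto)

text \<open>Smoothness of the transition maps carries a function of the coordinates of one chart
  over to all other charts. It is needed to make bump functions smooth.\<close>

lemma smooth_fun_chart:
  assumes c: "(U, \<phi>) \<in> A" and "smooth_on (\<phi> ` U) h"
  shows "smooth_fun U (\<lambda>q. h (\<phi> q))"
proof (rule smooth_funI)
  fix V \<psi> k assume d: "(V, \<psi>) \<in> A"
  have U: "open U" using chart_open[OF c] .
  have tr: "smooth_on (\<psi> ` (V \<inter> U)) (\<phi> \<circ> inv_into V \<psi>)"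
    using atlas c d by (fastforce simp: smooth_atlas_def)
  have "Ck_on k (\<psi> ` (V \<inter> U)) (h \<circ> (\<phi> \<circ> inv_into V \<psi>))"
    by (rule Ck_on_compose[OF chart_open_image[OF d U], of "\<phi> ` U"])
      (use tr assms(2) d chart_open_image[OF c open_UNIV] in \<open>auto simp: smooth_on_def\<close>)
  then show "Ck_on k (\<psi> ` (V \<inter> U)) ((\<lambda>q. h (\<phi> q)) \<circ> inv_into V \<psi>)"
    by (simp add: o_def)
qed

lemma smooth_fun_continuous_on:
  assumes W: "open W" and f: "smooth_fun W f"
  shows "continuous_on W f"
proof -
  have "isCont f p" if p: "p \<in> W" for p
  proof -
    obtain U \<phi> where c: "(U, \<phi>) \<in> A" "p \<in> U" by (rule chart_exists)
    have "continuous_on (U \<inter> W) ((f \<circ> inv_into U \<phi>) \<circ> \<phi>)"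
      using smooth_funD[OF f c(1), of 0]
        continuous_on_subset[OF homeomorphism_cont1[OF chart_homeomorphism[OF c(1)]], of "U \<inter> W"]
      by (intro continuous_on_compose[of _ \<phi>]) auto
    then have "continuous_on (U \<inter> W) f"
      by (rule continuous_on_eq) (use c in auto)
    then show ?thesis
      using open_Int[OF chart_open[OF c(1)] W] c(2) p by (simp add: continuous_on_eq_continuous_at)
  qed
  then show ?thesis by (simp add: continuous_at_imp_continuous_on)
qed

lemma smooth_fun_open_nonzero:
  assumes "open W" and "smooth_fun W f"
  shows "open {q \<in> W. f q \<noteq> 0}"
proof -
  have "open (W \<inter> f -` (- {0}))"
    by (rule continuous_open_preimage[OF smooth_fun_continuous_on[OF assms] assms(1)]) auto
  moreover have "W \<inter> f -` (- {0}) = {q \<in> W. f q \<noteq> 0}" by auto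
  ultimately show ?thesis by simp
qed

lemma smooth_fun_sum:
  assumes "open W" and "\<And>i. i \<in> I \<Longrightarrow> smooth_fun W (f i)"
  shows "smooth_fun W (\<lambda>q. \<Sum>i\<in>I. f i q)"
  using assms(2)
  by (induction I rule: infinite_finite_induct)
    (auto intro: smooth_fun_const smooth_fun_add[OF assms(1)])

text \<open>In a chart, \<open>flat 0\<close> is applied to r^2 - |x - \<phi>(p)|^2. The set
  \<open>K\<close> is the preimage of a closed ball; it is compact, hence closed because the space
  is Hausdorff, and this makes the extension by 0 smooth across the boundary of the chart.\<close>

lemma bump_function:
  assumes "open W" and "p \<in> W"
  obtains \<rho> K where "smooth_fun UNIV \<rho>" and "0 < \<rho> p" and "closed K" and "K \<subseteq> W"
    and "\<And>q. q \<notin> K \<Longrightarrow> \<rho> q = 0"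
proof -
  obtain U \<phi> where c: "(U, \<phi>) \<in> A" and p: "p \<in> U" by (rule chart_exists)
  have hom: "homeomorphism U (\<phi> ` U) \<phi> (inv_into U \<phi>)"
    by (rule chart_homeomorphism[OF c])
  have "\<phi> p \<in> \<phi> ` (U \<inter> W)" using p assms(2) by auto
  then obtain r where r: "0 < r" "cball (\<phi> p) r \<subseteq> \<phi> ` (U \<inter> W)"
    using chart_open_image[OF c assms(1)] by (metis open_contains_cball)
  define K where "K = inv_into U \<phi> ` cball (\<phi> p) r"
  define h where "h = (\<lambda>x. flat 0 (r\<^sup>2 - (x - \<phi> p) \<bullet> (x - \<phi> p)))"
  define \<rho> where "\<rho> = (\<lambda>q. if q \<in> U then h (\<phi> q) else 0)"
  have K_sub: "K \<subseteq> U \<inter> W"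
    using r(2) c by (force simp: K_def)
  have "continuous_on (cball (\<phi> p) r) (inv_into U \<phi>)"
    using hom r(2) by (auto simp: homeomorphism_def intro: continuous_on_subset)
  then have "closed K"
    unfolding K_def by (intro compact_imp_closed compact_continuous_image) auto
  have zero: "\<rho> q = 0" if "q \<notin> K" for q
  proof (cases "q \<in> U")
    case True
    have "\<phi> q \<notin> cball (\<phi> p) r"
      using that True c by (metis K_def chart_inverse image_eqI)
    then have "r \<le> norm (\<phi> q - \<phi> p)"
      by (simp add: dist_norm norm_minus_commute)
    then have "r\<^sup>2 \<le> (\<phi> q - \<phi> p) \<bullet> (\<phi> q - \<phi> p)"
      using r(1) by (simp add: power2_norm_eq_inner[symmetric] power_mono)
    then show ?thesis by (simp add: \<rho>_def h_def flat_def)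
  qed (simp add: \<rho>_def)
  have "Ck_on k UNIV h" for k
  proof -
    have lin: "Ck_on k UNIV (\<lambda>x. x + (- \<phi> p))"
      by (intro Ck_on_add Ck_on_ident Ck_on_const) auto
    have "Ck_on k UNIV (\<lambda>x. r\<^sup>2 + (- 1) * ((x + (- \<phi> p)) \<bullet> (x + (- \<phi> p))))"
      by (intro Ck_on_add[OF open_UNIV] Ck_on_mult[OF open_UNIV] Ck_on_inner[OF open_UNIV] lin
          Ck_on_const)
    from Ck_on_compose[OF open_UNIV open_UNIV _ this, of "flat 0"] smooth_on_flat
    show ?thesis by (simp add: h_def o_def smooth_on_def)
  qed
  then have "smooth_on (\<phi> ` U) h"
    using Ck_on_subset[OF _ subset_UNIV] by (auto simp: smooth_on_def)
  then have U: "smooth_fun U \<rho>"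
    using smooth_fun_cong[OF chart_open[OF c] _ smooth_fun_chart[OF c], of h \<rho>]
    by (simp add: \<rho>_def)
  have "smooth_fun (- K) \<rho>"
    by (rule smooth_fun_cong[OF _ _ smooth_fun_const[of _ 0]]) (use \<open>closed K\<close> zero in auto)
  then have "smooth_fun UNIV \<rho>"
    using U chart_open[OF c] \<open>closed K\<close> K_sub
    by (intro smooth_fun_local) (metis ComplI Int_UNIV_left IntE open_Compl subsetD)
  moreover have "0 < \<rho> p"
    using p r(1) by (simp add: \<rho>_def h_def flat_def)
  ultimately show ?thesis
    using that \<open>closed K\<close> K_sub zero by blast
qed

text \<open>The open sets \<open>W\<close> and \<open>- K\<close> cover the space, and on the second
  one the product is 0 whatever values \<open>f\<close> takes there.\<close>

lemma smooth_fun_extend_zero: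
  assumes "open W" and "smooth_fun UNIV \<rho>" and "closed K" and "K \<subseteq> W"
    and "\<And>q. q \<notin> K \<Longrightarrow> \<rho> q = 0" and "smooth_fun W f"
  shows "smooth_fun UNIV (\<lambda>q. \<rho> q * f q)"
proof (rule smooth_fun_local)
  fix p :: 'a
  have "smooth_fun W (\<lambda>q. \<rho> q * f q)"
    by (intro smooth_fun_mult assms(1,6) smooth_fun_subset[OF assms(2)]) auto
  moreover have "smooth_fun (- K) (\<lambda>q. \<rho> q * f q)"
    by (rule smooth_fun_cong[OF _ _ smooth_fun_const[of _ 0]]) (use assms(3,5) in auto)
  ultimately show "\<exists>W'. open W' \<and> p \<in> W' \<and> smooth_fun (UNIV \<inter> W') (\<lambda>q. \<rho> q * f q)"
    using assms(1,3,4) by (metis ComplI Int_UNIV_left open_Compl subsetD)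
qed

end

section \<open>Tangent vectors, vector fields and the Lie bracket\<close>

context smooth_manifold
begin

abbreviation tangent :: "'a \<Rightarrow> 'a tvec set"
  where "tangent \<equiv> tangent_space A"

abbreviation vfield :: "'a set \<Rightarrow> 'a vfield \<Rightarrow> bool"
  where "vfield \<equiv> vector_field_on A"

abbreviation bracket :: "'a vfield \<Rightarrow> 'a vfield \<Rightarrow> 'a vfield"
  where "bracket \<equiv> lie_bracket A"

lemma smooth_nearI: "open W \<Longrightarrow> p \<in> W \<Longrightarrow> smooth_fun W f \<Longrightarrow> smooth_near A p f"
  by (auto simp: smooth_near_def)

lemma smooth_near2:
  assumes "smooth_near A p f" and "smooth_near A p h"
  obtains W where "open W" and "p \<in> W" and "smooth_fun W f" and "smooth_fun W h"
proof -
  from assms obtain W W' where "open W" "p \<in> W" "smooth_fun W f" "open W'" "p \<in> W'" "smooth_fun W' h"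
    by (auto simp: smooth_near_def)
  then show ?thesis
    using that[of "W \<inter> W'"] by (meson IntI Int_lower1 Int_lower2 open_Int smooth_fun_subset)
qed

lemma smooth_near_add:
  "smooth_near A p f \<Longrightarrow> smooth_near A p h \<Longrightarrow> smooth_near A p (\<lambda>q. f q + h q)"
  by (rule smooth_near2, assumption+) (auto intro: smooth_nearI smooth_fun_add)

lemma smooth_near_mult:
  "smooth_near A p f \<Longrightarrow> smooth_near A p h \<Longrightarrow> smooth_near A p (\<lambda>q. f q * h q)"
  by (rule smooth_near2, assumption+) (auto intro: smooth_nearI smooth_fun_mult)

lemma smooth_near_const: "smooth_near A p (\<lambda>q. c)"
  by (rule smooth_nearI[of UNIV]) (auto intro: smooth_fun_const)

lemma tangent_not_smooth: "v \<in> tangent p \<Longrightarrow> \<not> smooth_near A p f \<Longrightarrow> v f = 0"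
  by (simp add: tangent_space_def)

lemma tangent_lincomb:
  "v \<in> tangent p \<Longrightarrow> smooth_near A p f \<Longrightarrow> smooth_near A p h \<Longrightarrow>
    v (\<lambda>q. a * f q + b * h q) = a * v f + b * v h"
  by (simp add: tangent_space_def)

lemma tangent_mult:
  "v \<in> tangent p \<Longrightarrow> smooth_near A p f \<Longrightarrow> smooth_near A p h \<Longrightarrow>
    v (\<lambda>q. f q * h q) = f p * v h + h p * v f"
  by (simp add: tangent_space_def)

lemma tangent_add_fun:
  "v \<in> tangent p \<Longrightarrow> smooth_near A p f \<Longrightarrow> smooth_near A p h \<Longrightarrow>
    v (\<lambda>q. f q + h q) = v f + v h"
  using tangent_lincomb[of v p f h 1 1] by simp

lemma tangent_const: "v \<in> tangent p \<Longrightarrow> v (\<lambda>q. c) = 0"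
  using tangent_mult[OF _ smooth_near_const smooth_near_const, of v p 1 1]
    tangent_lincomb[OF _ smooth_near_const smooth_near_const, of v p c 1 0 1] by simp

text \<open>Smoothness of \<open>f\<close> is not assumed: if \<open>f\<close> is not smooth near
  \<open>p\<close>, neither is a nonzero multiple of it, and both values are 0 by the normalisation
  of tangent vectors.\<close>

lemma tangent_cmult: "v \<in> tangent p \<Longrightarrow> v (\<lambda>q. c * f q) = c * v f"
proof (cases "smooth_near A p f")
  case True
  then show "v \<in> tangent p \<Longrightarrow> v (\<lambda>q. c * f q) = c * v f"
    using tangent_lincomb[of v p f f c 0] by simp
next
  case False
  assume v: "v \<in> tangent p"
  show ?thesis
  proof (cases "c = 0")
    case True
    then show ?thesis using tangent_const[OF v] by simp
  next
    case c: False
    have "\<not> smooth_near A p (\<lambda>q. c * f q)"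
    proof
      assume "smooth_near A p (\<lambda>q. c * f q)"
      from smooth_near_mult[OF smooth_near_const[of p "inverse c"] this] c False
      show False by (simp add: field_simps)
    qed
    then show ?thesis using False v by (simp add: tangent_not_smooth)
  qed
qed

text \<open>Near \<open>p\<close> the two functions are both smooth or both not. In the second case
  the normalisation gives 0 twice; in the first, the difference \<open>u\<close> equals
  \<open>u * k\<close> with \<open>u\<close> and \<open>k\<close> both vanishing at
  \<open>p\<close>, so the product rule gives 0.\<close>

lemma tangent_cong:
  assumes v: "v \<in> tangent p" and "open W" and "p \<in> W" and eq: "\<And>q. q \<in> W \<Longrightarrow> f q = h q"
  shows "v f = v h"
proof -
  have iff: "smooth_near A p f \<longleftrightarrow> smooth_near A p h"
  proof -
    have "smooth_near A p h" if "smooth_near A p f" "\<And>q. q \<in> W \<Longrightarrow> f q = h q" for f h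
    proof -
      from that(1) obtain W' where "open W'" "p \<in> W'" "smooth_fun W' f"
        by (auto simp: smooth_near_def)
      then have "smooth_fun (W \<inter> W') h"
        using assms(2) that(2)
        by (intro smooth_fun_cong[OF _ _ smooth_fun_subset[of W' f "W \<inter> W'"]]) auto
      then show ?thesis
        using \<open>open W'\<close> \<open>p \<in> W'\<close> assms(2,3) by (intro smooth_nearI[of "W \<inter> W'"]) auto
    qed
    from this[of f h] this[of h f] eq show ?thesis by auto
  qed
  show ?thesis
  proof (cases "smooth_near A p f")
    case f: True
    then have h: "smooth_near A p h" using iff by simp
    define u where "u = (\<lambda>q. 1 * f q + (- 1) * h q)"
    define k :: "'a \<Rightarrow> real" where "k = (\<lambda>q. if q \<in> W then 0 else 1)"
    have u: "smooth_near A p u"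
      unfolding u_def by (intro smooth_near_add smooth_near_mult smooth_near_const f h)
    have k: "smooth_near A p k"
      by (rule smooth_nearI[of W], fact, fact, rule smooth_fun_cong[OF _ _ smooth_fun_const[of _ 0]])
        (use assms(2) in \<open>auto simp: k_def\<close>)
    have "u = (\<lambda>q. u q * k q)"
      using eq by (auto simp: u_def k_def fun_eq_iff)
    then have "v u = u p * v k + k p * v u"
      using tangent_mult[OF v u k] by simp
    also have "\<dots> = 0" using assms(3) eq by (simp add: u_def k_def)
    finally show ?thesis
      using tangent_lincomb[OF v f h, of 1 "- 1"] by (simp add: u_def)
  next
    case False
    then show ?thesis using iff v by (simp add: tangent_not_smooth)
  qed
qed

lemma subspace_tangent: "subspace (tangent p)"
  unfolding subspace_def
proof (intro conjI ballI allI)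
  show "0 \<in> tangent p" by (simp add: tangent_space_def)
  show "u + v \<in> tangent p" if "u \<in> tangent p" "v \<in> tangent p" for u v
    using that unfolding tangent_space_def by (simp add: distrib_left)
  show "c *\<^sub>R v \<in> tangent p" if "v \<in> tangent p" for c v
    using that unfolding tangent_space_def by (simp add: algebra_simps)
qed

lemmas tangent_zero [simp] = subspace_0[OF subspace_tangent]
  and tangent_add [simp] = subspace_add[OF subspace_tangent]
  and tangent_scaleR [simp] = subspace_mul[OF subspace_tangent]
  and tangent_diff [simp] = subspace_diff[OF subspace_tangent]
  and tangent_minus [simp] = subspace_neg[OF subspace_tangent]

lemma vfield_tangent: "vfield U X \<Longrightarrow> p \<in> U \<Longrightarrow> X p \<in> tangent p"
  by (simp add: vector_field_on_def)

lemma vfield_smooth: "vfield U X \<Longrightarrow> open W \<Longrightarrow> W \<subseteq> U \<Longrightarrow> smooth_fun W f \<Longrightarrow> smooth_fun W (\<lambda>q. X q f)"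
  by (simp add: vector_field_on_def)

lemma vfield_smooth_near:
  assumes "open U" and "p \<in> U" and "vfield U X" and "smooth_near A p f"
  shows "smooth_near A p (\<lambda>q. X q f)"
proof -
  from assms(4) obtain W where "open W" "p \<in> W" "smooth_fun W f"
    by (auto simp: smooth_near_def)
  then show ?thesis
    using assms(1-3)
    by (intro smooth_nearI[of "U \<inter> W"] vfield_smooth[OF assms(3)]) (auto intro: smooth_fun_subset)
qed

lemma vfield_subset: "vfield U X \<Longrightarrow> W \<subseteq> U \<Longrightarrow> vfield W X"
  by (auto simp: vector_field_on_def)

lemma vfield_Int1: "vfield U X \<Longrightarrow> vfield (U \<inter> W) X"
  by (erule vfield_subset) simp

lemma vfield_Int2: "vfield W X \<Longrightarrow> vfield (U \<inter> W) X"
  by (erule vfield_subset) simp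

lemma vfieldI:
  assumes "\<And>p. p \<in> U \<Longrightarrow> X p \<in> tangent p"
    and "\<And>W f. open W \<Longrightarrow> W \<subseteq> U \<Longrightarrow> smooth_fun W f \<Longrightarrow> smooth_fun W (\<lambda>q. X q f)"
  shows "vfield U X"
  using assms by (simp add: vector_field_on_def)

lemma vfield_cong:
  assumes "\<And>q. q \<in> U \<Longrightarrow> X q = Y q" and "vfield U X"
  shows "vfield U Y"
proof (rule vfieldI)
  show "Y p \<in> tangent p" if "p \<in> U" for p
    using that assms by (metis vfield_tangent)
  show "smooth_fun W (\<lambda>q. Y q f)" if "open W" "W \<subseteq> U" "smooth_fun W f" for W f
    by (rule smooth_fun_cong[OF that(1) _ vfield_smooth[OF assms(2) that]]) (use assms that in auto)
qed

lemma vfield_local: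
  assumes "\<And>p. p \<in> U \<Longrightarrow> \<exists>W. open W \<and> p \<in> W \<and> vfield (U \<inter> W) X"
  shows "vfield U X"
proof (rule vfieldI)
  show "X p \<in> tangent p" if "p \<in> U" for p
    using assms[OF that] that by (auto intro: vfield_tangent)
  fix V f assume V: "open V" "V \<subseteq> U" "smooth_fun V f"
  show "smooth_fun V (\<lambda>q. X q f)"
  proof (rule smooth_fun_local)
    fix p assume "p \<in> V"
    then obtain W where W: "open W" "p \<in> W" "vfield (U \<inter> W) X"
      using assms V by blast
    have "smooth_fun (V \<inter> W) (\<lambda>q. X q f)"
      using V W by (intro vfield_smooth[OF W(3)]) (auto intro: smooth_fun_subset)
    then show "\<exists>W. open W \<and> p \<in> W \<and> smooth_fun (V \<inter> W) (\<lambda>q. X q f)"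
      using W by blast
  qed
qed

lemma vfield_add: "vfield U X \<Longrightarrow> vfield U Y \<Longrightarrow> vfield U (\<lambda>q. X q + Y q)"
  by (rule vfieldI) (auto intro: tangent_add vfield_tangent vfield_smooth smooth_fun_add)

lemma vfield_scaleR: "smooth_fun U f \<Longrightarrow> vfield U X \<Longrightarrow> vfield U (\<lambda>q. f q *\<^sub>R X q)"
  by (rule vfieldI)
    (auto intro: tangent_scaleR vfield_tangent vfield_smooth smooth_fun_mult smooth_fun_subset)

lemma vfield_diff: "vfield U X \<Longrightarrow> vfield U Y \<Longrightarrow> vfield U (\<lambda>q. X q - Y q)"
  by (rule vfieldI) (auto intro: tangent_diff vfield_tangent vfield_smooth smooth_fun_diff)

section \<open>The Lie bracket\<close>

lemma bracket_apply:
  "smooth_near A p f \<Longrightarrow> bracket X Y p f = X p (\<lambda>q. Y q f) - Y p (\<lambda>q. X q f)"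
  by (simp add: lie_bracket_def)

lemma bracket_eqI:
  assumes "u \<in> tangent p"
    and "\<And>f. smooth_near A p f \<Longrightarrow> X p (\<lambda>q. Y q f) - Y p (\<lambda>q. X q f) = u f"
  shows "bracket X Y p = u"
  by (rule ext) (use assms tangent_not_smooth in \<open>auto simp: lie_bracket_def\<close>)

lemma bracket_antisym: "bracket X Y p = - bracket Y X p"
  by (auto simp: lie_bracket_def fun_eq_iff)

lemma bracket_self: "bracket X X p = 0"
  by (auto simp: lie_bracket_def fun_eq_iff)

text \<open>Linearity and the product rule for \<open>X\<close> hold only at points where the
  functions are smooth. Under an outer derivation they may be used nevertheless, because such points
  fill a neighbourhood of \<open>p\<close> and \<open>v\<close> is local.\<close>

lemma vfield_lincomb_near:
  assumes "open U" and "p \<in> U" and "vfield U X" and "smooth_near A p f" and "smooth_near A p h"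
    and "v \<in> tangent p"
  shows "v (\<lambda>q. X q (\<lambda>q. a * f q + b * h q)) = v (\<lambda>q. a * X q f + b * X q h)"
    and "v (\<lambda>q. X q (\<lambda>q. f q * h q)) = v (\<lambda>q. f q * X q h + h q * X q f)"
proof -
  from smooth_near2[OF assms(4,5)] obtain W where
    W: "open W" "p \<in> W" "smooth_fun W f" "smooth_fun W h" .
  have *: "X q \<in> tangent q \<and> smooth_near A q f \<and> smooth_near A q h" if "q \<in> U \<inter> W" for q
    using that W smooth_nearI assms(1) vfield_tangent[OF assms(3)] by blast
  show "v (\<lambda>q. X q (\<lambda>q. a * f q + b * h q)) = v (\<lambda>q. a * X q f + b * X q h)"
    by (rule tangent_cong[OF assms(6), of "U \<inter> W"])
      (use assms(1,2) W * in \<open>auto intro!: tangent_lincomb\<close>)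
  show "v (\<lambda>q. X q (\<lambda>q. f q * h q)) = v (\<lambda>q. f q * X q h + h q * X q f)"
    by (rule tangent_cong[OF assms(6), of "U \<inter> W"])
      (use assms(1,2) W * in \<open>auto intro!: tangent_mult\<close>)
qed

text \<open>In the product rule the mixed terms \<open>X f * Y h + X h * Y f\<close> are symmetric
  in \<open>X\<close> and \<open>Y\<close> and cancel.\<close>

lemma bracket_tangent:
  assumes U: "open U" "p \<in> U" and X: "vfield U X" and Y: "vfield U Y"
  shows "bracket X Y p \<in> tangent p"
proof -
  note T = vfield_tangent[OF X U(2)] vfield_tangent[OF Y U(2)]
  note N = vfield_smooth_near[OF U X] vfield_smooth_near[OF U Y]
  have 1: "bracket X Y p (\<lambda>q. a * f q + b * h q) = a * bracket X Y p f + b * bracket X Y p h"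
    if f: "smooth_near A p f" and h: "smooth_near A p h" for f h a b
  proof -
    have "smooth_near A p (\<lambda>q. a * f q + b * h q)"
      by (intro smooth_near_add smooth_near_mult smooth_near_const that)
    then show ?thesis
      using that N
      by (simp add: bracket_apply vfield_lincomb_near(1)[OF U X f h T(2)]
          vfield_lincomb_near(1)[OF U Y f h T(1)] tangent_lincomb[OF T(1)] tangent_lincomb[OF T(2)]
          algebra_simps)
  qed
  have 2: "bracket X Y p (\<lambda>q. f q * h q) = f p * bracket X Y p h + h p * bracket X Y p f"
    if f: "smooth_near A p f" and h: "smooth_near A p h" for f h
  proof -
    have "smooth_near A p (\<lambda>q. f q * h q)"
      by (intro smooth_near_mult that)
    then show ?thesis
      using that N
      by (simp add: bracket_apply vfield_lincomb_near(2)[OF U X f h T(2)]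
          vfield_lincomb_near(2)[OF U Y f h T(1)] tangent_add_fun[OF T(1)] tangent_add_fun[OF T(2)]
          tangent_mult[OF T(1)] tangent_mult[OF T(2)] smooth_near_mult algebra_simps)
  qed
  show ?thesis
    unfolding tangent_space_def using 1 2 by (simp add: lie_bracket_def[of A X Y])
qed

lemma vfield_bracket:
  assumes U: "open U" and X: "vfield U X" and Y: "vfield U Y"
  shows "vfield U (bracket X Y)"
proof (rule vfieldI)
  show "bracket X Y p \<in> tangent p" if "p \<in> U" for p
    using bracket_tangent assms that by blast
  fix W f assume W: "open W" "W \<subseteq> U" "smooth_fun W f"
  have "smooth_fun W (\<lambda>q. X q (\<lambda>q. Y q f) - Y q (\<lambda>q. X q f))"
    by (intro smooth_fun_diff vfield_smooth[OF X] vfield_smooth[OF Y] W)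
  then show "smooth_fun W (\<lambda>q. bracket X Y q f)"
    by (rule smooth_fun_cong[OF W(1), rotated]) (use W smooth_nearI bracket_apply in metis)
qed

lemma bracket_cong:
  assumes U: "open U" "p \<in> U" and X: "vfield U X" and Y: "vfield U Y"
    and "\<And>q. q \<in> U \<Longrightarrow> X q = X' q" and "\<And>q. q \<in> U \<Longrightarrow> Y q = Y' q"
  shows "bracket X Y p = bracket X' Y' p"
proof (rule bracket_eqI)
  have "vfield U X'" "vfield U Y'"
    using vfield_cong[OF _ X, of X'] vfield_cong[OF _ Y, of Y'] assms(5,6) by auto
  then show "bracket X' Y' p \<in> tangent p"
    by (rule bracket_tangent[OF U])
  fix f assume f: "smooth_near A p f"
  have "X p (\<lambda>q. Y q f) = X p (\<lambda>q. Y' q f)" "Y p (\<lambda>q. X q f) = Y p (\<lambda>q. X' q f)"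
    using assms(5,6)
    by (auto intro!: tangent_cong[OF vfield_tangent[OF X U(2)] U] tangent_cong[OF vfield_tangent[OF Y U(2)] U])
  then show "X p (\<lambda>q. Y q f) - Y p (\<lambda>q. X q f) = bracket X' Y' p f"
    using assms(5,6) U(2) f by (simp add: bracket_apply)
qed

lemma bracket_add_left:
  assumes U: "open U" "p \<in> U" and X: "vfield U X" and X': "vfield U X'" and Y: "vfield U Y"
  shows "bracket (\<lambda>q. X q + X' q) Y p = bracket X Y p + bracket X' Y p"
proof (rule bracket_eqI)
  show "bracket X Y p + bracket X' Y p \<in> tangent p"
    using bracket_tangent[OF U] X X' Y by simp
qed (simp add: bracket_apply tangent_add_fun[OF vfield_tangent[OF Y U(2)]]
    vfield_smooth_near[OF U X] vfield_smooth_near[OF U X'])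

lemma bracket_scaleR_left:
  assumes U: "open U" "p \<in> U" and X: "vfield U X" and Y: "vfield U Y" and f: "smooth_fun U f"
  shows "bracket (\<lambda>q. f q *\<^sub>R X q) Y p = f p *\<^sub>R bracket X Y p - Y p f *\<^sub>R X p"
proof (rule bracket_eqI)
  show "f p *\<^sub>R bracket X Y p - Y p f *\<^sub>R X p \<in> tangent p"
    using bracket_tangent[OF U X Y] vfield_tangent[OF X U(2)] by simp
qed (simp add: bracket_apply tangent_mult[OF vfield_tangent[OF Y U(2)]] smooth_nearI[OF U f]
    vfield_smooth_near[OF U X] algebra_simps)

lemma bracket_add_right:
  assumes U: "open U" "p \<in> U" and "vfield U X" and "vfield U Y" and "vfield U Y'"
  shows "bracket X (\<lambda>q. Y q + Y' q) p = bracket X Y p + bracket X Y' p"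
  unfolding bracket_antisym[of X] by (simp add: bracket_add_left[OF U assms(4,5,3)])

lemma bracket_scaleR_right:
  assumes U: "open U" "p \<in> U" and "vfield U X" and "vfield U Y" and "smooth_fun U f"
  shows "bracket X (\<lambda>q. f q *\<^sub>R Y q) p = f p *\<^sub>R bracket X Y p + X p f *\<^sub>R Y p"
  unfolding bracket_antisym[of X] by (simp add: bracket_scaleR_left[OF U assms(4,3,5)])

end

section \<open>The Levi-Civita connection\<close>

locale riemannian = smooth_manifold +
  fixes g :: "'a metric"
  assumes metric: "riemannian_metric A g"
begin

abbreviation ip :: "'a vfield \<Rightarrow> 'a vfield \<Rightarrow> 'a \<Rightarrow> real"
  where "ip X Y q \<equiv> g q (X q) (Y q)"

lemma g_lincomb:
  "u \<in> tangent p \<Longrightarrow> v \<in> tangent p \<Longrightarrow> w \<in> tangent p \<Longrightarrow>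
    g p (a *\<^sub>R u + b *\<^sub>R v) w = a * g p u w + b * g p v w"
  using conjunct1[OF metric[unfolded riemannian_metric_def]] by blast

lemma g_sym: "u \<in> tangent p \<Longrightarrow> v \<in> tangent p \<Longrightarrow> g p u v = g p v u"
  using conjunct1[OF conjunct2[OF metric[unfolded riemannian_metric_def]]] by blast

lemma g_pos: "v \<in> tangent p \<Longrightarrow> v \<noteq> 0 \<Longrightarrow> 0 < g p v v"
  using conjunct1[OF conjunct2[OF conjunct2[OF metric[unfolded riemannian_metric_def]]]] by blast

lemma ip_smooth: "open U \<Longrightarrow> vfield U X \<Longrightarrow> vfield U Y \<Longrightarrow> smooth_fun U (ip X Y)"
  using conjunct2[OF conjunct2[OF conjunct2[OF metric[unfolded riemannian_metric_def]]]] by blast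

lemma g_add_left:
  "u \<in> tangent p \<Longrightarrow> v \<in> tangent p \<Longrightarrow> w \<in> tangent p \<Longrightarrow> g p (u + v) w = g p u w + g p v w"
  using g_lincomb[of u p v w 1 1] by simp

lemma g_scaleR_left: "u \<in> tangent p \<Longrightarrow> w \<in> tangent p \<Longrightarrow> g p (a *\<^sub>R u) w = a * g p u w"
  using g_lincomb[of u p u w a 0] by simp

lemma g_diff_left:
  "u \<in> tangent p \<Longrightarrow> v \<in> tangent p \<Longrightarrow> w \<in> tangent p \<Longrightarrow> g p (u - v) w = g p u w - g p v w"
  using g_lincomb[of u p v w 1 "- 1"] by simp

lemma g_minus_left: "u \<in> tangent p \<Longrightarrow> w \<in> tangent p \<Longrightarrow> g p (- u) w = - g p u w"
  using g_scaleR_left[of u p w "- 1"] by simp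

lemma g_zero_left: "w \<in> tangent p \<Longrightarrow> g p 0 w = 0"
  using g_scaleR_left[of 0 p w 0] by simp

lemma g_add_right:
  "u \<in> tangent p \<Longrightarrow> v \<in> tangent p \<Longrightarrow> w \<in> tangent p \<Longrightarrow> g p w (u + v) = g p w u + g p w v"
  by (simp add: g_sym[of w] g_add_left)

lemma g_scaleR_right: "u \<in> tangent p \<Longrightarrow> w \<in> tangent p \<Longrightarrow> g p w (a *\<^sub>R u) = a * g p w u"
  by (simp add: g_sym[of w] g_scaleR_left)

lemma g_diff_right:
  "u \<in> tangent p \<Longrightarrow> v \<in> tangent p \<Longrightarrow> w \<in> tangent p \<Longrightarrow> g p w (u - v) = g p w u - g p w v"
  by (simp add: g_sym[of w] g_diff_left)

lemma g_minus_right: "u \<in> tangent p \<Longrightarrow> w \<in> tangent p \<Longrightarrow> g p w (- u) = - g p w u"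
  by (simp add: g_sym[of w] g_minus_left)

lemma g_zero_right: "w \<in> tangent p \<Longrightarrow> g p w 0 = 0"
  by (simp add: g_sym[of w] g_zero_left)

lemmas g_bilinear = g_add_left g_scaleR_left g_diff_left g_minus_left g_zero_left
  g_add_right g_scaleR_right g_diff_right g_minus_right g_zero_right

text \<open>The right-hand side of the Koszul formula, that is, the candidate for twice the inner
  product of the covariant derivative of \<open>Y\<close> along \<open>X\<close> with
  \<open>Z\<close>.\<close>

definition koszul :: "'a vfield \<Rightarrow> 'a vfield \<Rightarrow> 'a vfield \<Rightarrow> 'a \<Rightarrow> real"
  where "koszul X Y Z p = X p (ip Y Z) + Y p (ip Z X) - Z p (ip X Y)
    + g p (bracket X Y p) (Z p) - g p (bracket X Z p) (Y p) - g p (bracket Y Z p) (X p)"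

context
  fixes U :: "'a set" and p :: 'a
  assumes U: "open U" "p \<in> U"
begin

lemma d_ip_sym:
  assumes "v \<in> tangent p" and "vfield U X" and "vfield U Y"
  shows "v (ip X Y) = v (ip Y X)"
  by (rule tangent_cong[OF assms(1) U]) (use assms(2,3) vfield_tangent g_sym in blast)

lemma d_ip_add_left:
  assumes v: "v \<in> tangent p" and X: "vfield U X" and X': "vfield U X'" and Y: "vfield U Y"
  shows "v (\<lambda>q. g q (X q + X' q) (Y q)) = v (ip X Y) + v (ip X' Y)"
proof -
  have "v (\<lambda>q. g q (X q + X' q) (Y q)) = v (\<lambda>q. ip X Y q + ip X' Y q)"
    by (rule tangent_cong[OF v U]) (use assms vfield_tangent g_add_left in blast)
  then show ?thesis
    using assms by (simp add: tangent_add_fun[OF v] smooth_nearI[OF U] ip_smooth U)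
qed

lemma d_ip_add_right:
  assumes "v \<in> tangent p" and "vfield U X" and "vfield U X'" and "vfield U Y"
  shows "v (\<lambda>q. g q (Y q) (X q + X' q)) = v (ip Y X) + v (ip Y X')"
  using d_ip_add_left[OF assms] d_ip_sym[OF assms(1,4) vfield_add[OF assms(2,3)]]
    d_ip_sym[OF assms(1,4,2)] d_ip_sym[OF assms(1,4,3)] by simp

lemma d_ip_scaleR_left:
  assumes v: "v \<in> tangent p" and X: "vfield U X" and Y: "vfield U Y" and f: "smooth_fun U f"
  shows "v (\<lambda>q. g q (f q *\<^sub>R X q) (Y q)) = f p * v (ip X Y) + ip X Y p * v f"
proof -
  have "v (\<lambda>q. g q (f q *\<^sub>R X q) (Y q)) = v (\<lambda>q. f q * ip X Y q)"
    by (rule tangent_cong[OF v U]) (use assms vfield_tangent g_scaleR_left in blast)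
  then show ?thesis
    using assms by (simp add: tangent_mult[OF v] smooth_nearI[OF U] ip_smooth U)
qed

lemma d_ip_scaleR_right:
  assumes "v \<in> tangent p" and "vfield U X" and "vfield U Y" and "smooth_fun U f"
  shows "v (\<lambda>q. g q (Y q) (f q *\<^sub>R X q)) = f p * v (ip Y X) + ip Y X p * v f"
  using d_ip_scaleR_left[OF assms] d_ip_sym[OF assms(1,3) vfield_scaleR[OF assms(4,2)]]
    d_ip_sym[OF assms(1,3,2)] vfield_tangent[OF assms(2) U(2)] vfield_tangent[OF assms(3) U(2)]
    g_sym by simp

lemmas d_ip = d_ip_add_left d_ip_add_right d_ip_scaleR_left d_ip_scaleR_right
lemmas bracket_linear = bracket_add_left[OF U] bracket_add_right[OF U]
  bracket_scaleR_left[OF U] bracket_scaleR_right[OF U]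

context
  fixes X Y Z :: "'a vfield"
  assumes X: "vfield U X" and Y: "vfield U Y" and Z: "vfield U Z"
begin

private lemmas here = vfield_tangent[OF X U(2)] vfield_tangent[OF Y U(2)] vfield_tangent[OF Z U(2)]
  bracket_tangent[OF U X Y] bracket_tangent[OF U X Z] bracket_tangent[OF U Y Z]
  bracket_tangent[OF U Y X] bracket_tangent[OF U Z X] bracket_tangent[OF U Z Y]

lemma koszul_torsion: "koszul X Y Z p - koszul Y X Z p = 2 * g p (bracket X Y p) (Z p)"
  by (simp add: here X Y Z koszul_def bracket_antisym[of Y X] g_bilinear d_ip_sym[of _ X Y] d_ip_sym[of _ Z X]
      d_ip_sym[of _ Z Y])

lemma koszul_metric: "koszul X Y Z p + koszul X Z Y p = 2 * X p (ip Y Z)"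
  by (simp add: here X Y Z koszul_def bracket_antisym[of Z Y] g_bilinear d_ip_sym[of _ X Y] d_ip_sym[of _ Z X]
      d_ip_sym[of _ Z Y])

lemma koszul_cong:
  assumes "\<And>q. q \<in> U \<Longrightarrow> X q = X' q" and "\<And>q. q \<in> U \<Longrightarrow> Y q = Y' q" and "\<And>q. q \<in> U \<Longrightarrow> Z q = Z' q"
  shows "koszul X Y Z p = koszul X' Y' Z' p"
proof -
  have "bracket X Y p = bracket X' Y' p" "bracket X Z p = bracket X' Z' p"
    "bracket Y Z p = bracket Y' Z' p"
    by (rule bracket_cong[OF U]; simp add: assms X Y Z)+
  moreover
  have "X p (ip Y Z) = X p (ip Y' Z')" "Y p (ip Z X) = Y p (ip Z' X')" "Z p (ip X Y) = Z p (ip X' Y')"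
    by (rule tangent_cong[OF _ U], simp add: here, simp add: assms)+
  ultimately show ?thesis
    by (simp add: here X Y Z koszul_def assms U)
qed

text \<open>Derivatives of \<open>f\<close> arise from differentiating inner products and from the
  brackets. In the slots of \<open>X\<close> and \<open>Z\<close> they cancel; in the slot of
  \<open>Y\<close> the two terms with \<open>X f\<close> add up, which is the Leibniz rule of a
  connection.\<close>

lemma koszul_scaleR:
  assumes f: "smooth_fun U f"
  shows "koszul (\<lambda>q. f q *\<^sub>R X q) Y Z p = f p * koszul X Y Z p"
    and "koszul X (\<lambda>q. f q *\<^sub>R Y q) Z p = f p * koszul X Y Z p + 2 * X p f * ip Y Z p"
    and "koszul X Y (\<lambda>q. f q *\<^sub>R Z q) p = f p * koszul X Y Z p"
proof -
  note s = here X Y Z koszul_def d_ip bracket_linear f g_bilinear algebra_simps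
    g_sym[of "Z p" p "X p"] g_sym[of "Y p" p "X p"] g_sym[of "Z p" p "Y p"]
  show "koszul (\<lambda>q. f q *\<^sub>R X q) Y Z p = f p * koszul X Y Z p"
    and "koszul X (\<lambda>q. f q *\<^sub>R Y q) Z p = f p * koszul X Y Z p + 2 * X p f * ip Y Z p"
    and "koszul X Y (\<lambda>q. f q *\<^sub>R Z q) p = f p * koszul X Y Z p"
    by (simp_all add: s)
qed

end

lemma koszul_add:
  assumes X: "vfield U X" and Y: "vfield U Y" and Z: "vfield U Z" and V: "vfield U V"
  shows "koszul (\<lambda>q. X q + V q) Y Z p = koszul X Y Z p + koszul V Y Z p"
    and "koszul X (\<lambda>q. Y q + V q) Z p = koszul X Y Z p + koszul X V Z p"
    and "koszul X Y (\<lambda>q. Z q + V q) p = koszul X Y Z p + koszul X Y V p"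
proof -
  note T = vfield_tangent[OF X U(2)] vfield_tangent[OF Y U(2)] vfield_tangent[OF Z U(2)]
    vfield_tangent[OF V U(2)] bracket_tangent[OF U]
  note s = koszul_def d_ip bracket_linear assms g_bilinear T
  show "koszul (\<lambda>q. X q + V q) Y Z p = koszul X Y Z p + koszul V Y Z p"
    and "koszul X (\<lambda>q. Y q + V q) Z p = koszul X Y Z p + koszul X V Z p"
    and "koszul X Y (\<lambda>q. Z q + V q) p = koszul X Y Z p + koszul X Y V p"
    by (simp_all add: s)
qed

end

text \<open>The expansion clause is what makes the three fields a basis; it takes the place of a
  statement about the dimension of the tangent space.\<close>

definition frame_on :: "'a set \<Rightarrow> 'a vfield \<Rightarrow> 'a vfield \<Rightarrow> 'a vfield \<Rightarrow> bool"
  where "frame_on W E1 E2 E3 \<longleftrightarrow> open W \<and> vfield W E1 \<and> vfield W E2 \<and> vfield W E3 \<and>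
    (\<forall>q\<in>W. ip E1 E1 q = 1 \<and> ip E2 E2 q = 1 \<and> ip E3 E3 q = 1 \<and>
      ip E1 E2 q = 0 \<and> ip E1 E3 q = 0 \<and> ip E2 E3 q = 0 \<and>
      (\<forall>v\<in>tangent q. v = g q v (E1 q) *\<^sub>R E1 q + g q v (E2 q) *\<^sub>R E2 q + g q v (E3 q) *\<^sub>R E3 q))"

lemma frame_onD:
  assumes "frame_on W E1 E2 E3"
  shows "open W" and "vfield W E1" and "vfield W E2" and "vfield W E3"
    and "q \<in> W \<Longrightarrow> v \<in> tangent q \<Longrightarrow>
      v = g q v (E1 q) *\<^sub>R E1 q + g q v (E2 q) *\<^sub>R E2 q + g q v (E3 q) *\<^sub>R E3 q"
  using assms by (auto simp: frame_on_def)

end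

text \<open>Spanning of the tangent spaces is known only through frames, so their existence around
  each point is an assumption here. It is discharged below for the stretched metrics of a contact
  structure.\<close>

locale framed = riemannian +
  assumes frames: "\<And>p. \<exists>W E1 E2 E3. p \<in> W \<and> frame_on W E1 E2 E3"
begin

lemma frame_exists:
  obtains W E1 E2 E3 where "p \<in> W" and "frame_on W E1 E2 E3"
  using frames[of p] by (elim exE conjE)

text \<open>Nondegeneracy, tested on the members of a frame. The test fields must be allowed on
  smaller sets \<open>W\<close>, since a frame around \<open>p\<close> need not be defined on all of
  \<open>U\<close>.\<close>

lemma tangent_eqI:
  assumes u: "u \<in> tangent p" and v: "v \<in> tangent p" and U: "open U" "p \<in> U"
    and eq: "\<And>W Z. open W \<Longrightarrow> W \<subseteq> U \<Longrightarrow> p \<in> W \<Longrightarrow> vfield W Z \<Longrightarrow> g p u (Z p) = g p v (Z p)"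
  shows "u = v"
proof -
  obtain W E1 E2 E3 where p: "p \<in> W" and F: "frame_on W E1 E2 E3"
    by (rule frame_exists)
  have "g p u (E p) = g p v (E p)" if "vfield W E" for E
    by (rule eq[of "U \<inter> W" E]) (use that frame_onD(1)[OF F] U p in \<open>simp_all add: open_Int vfield_Int2\<close>)
  then show ?thesis
    using frame_onD(2-4)[OF F] frame_onD(5)[OF F p u] frame_onD(5)[OF F p v] by metis
qed

text \<open>An arbitrary value unless \<open>X\<close> and \<open>Y\<close> are smooth near \<open>p\<close>.\<close>
definition connection :: "'a vfield \<Rightarrow> 'a vfield \<Rightarrow> 'a vfield"
  where "connection X Y p = (SOME w. w \<in> tangent p \<and> (\<forall>U Z. open U \<longrightarrow> p \<in> U \<longrightarrow>
    vfield U X \<longrightarrow> vfield U Y \<longrightarrow> vfield U Z \<longrightarrow> 2 * g p w (Z p) = koszul X Y Z p))"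

text \<open>Tensoriality in the last slot: the value depends on \<open>Z\<close> only through
  \<open>Z p\<close>, so finding a vector that represents the functional reduces to the three frame
  fields.\<close>

lemma koszul_frame:
  assumes F: "frame_on W E1 E2 E3" and p: "p \<in> W" and U: "open U" "p \<in> U"
    and X: "vfield U X" and Y: "vfield U Y" and Z: "vfield U Z"
  shows "koszul X Y Z p = ip Z E1 p * koszul X Y E1 p + ip Z E2 p * koszul X Y E2 p
    + ip Z E3 p * koszul X Y E3 p"
proof -
  let ?V = "U \<inter> W"
  note f = frame_onD[OF F]
  have V: "open ?V" "p \<in> ?V" using U f(1) p by auto
  have vf: "vfield ?V X" "vfield ?V Y" "vfield ?V Z" "vfield ?V E1" "vfield ?V E2" "vfield ?V E3"
    using X Y Z f by (auto intro: vfield_Int1 vfield_Int2)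
  have s: "smooth_fun ?V (ip Z E1)" "smooth_fun ?V (ip Z E2)" "smooth_fun ?V (ip Z E3)"
    using vf V by (auto intro: ip_smooth)
  have "koszul X Y Z p = koszul X Y (\<lambda>q. ip Z E1 q *\<^sub>R E1 q + ip Z E2 q *\<^sub>R E2 q + ip Z E3 q *\<^sub>R E3 q) p"
    by (rule koszul_cong[OF V vf(1-3)]) (use vfield_tangent[OF vf(3)] f(5) in auto)
  then show ?thesis
    by (simp add: koszul_add[OF V] koszul_scaleR[OF V] vf s vfield_add vfield_scaleR)
qed

text \<open>The displayed combination solves the Koszul equation against every local field, so the
  choice in \<open>connection\<close> has a witness. Conversely any solution has these frame
  components, so the choice is forced, and the formula shows smoothness.\<close>

lemma connection_frame:
  assumes F: "frame_on W E1 E2 E3" and p: "p \<in> W" and U: "open U" "p \<in> U"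
    and X: "vfield U X" and Y: "vfield U Y"
  shows "connection X Y p = (koszul X Y E1 p / 2) *\<^sub>R E1 p + (koszul X Y E2 p / 2) *\<^sub>R E2 p
    + (koszul X Y E3 p / 2) *\<^sub>R E3 p" (is "_ = ?w")
    and "connection X Y p \<in> tangent p"
    and "vfield U Z \<Longrightarrow> 2 * g p (connection X Y p) (Z p) = koszul X Y Z p"
proof -
  note f = frame_onD[OF F]
  note T = vfield_tangent[OF f(2) p] vfield_tangent[OF f(3) p] vfield_tangent[OF f(4) p]
  have w: "?w \<in> tangent p" using T by simp
  have "2 * g p ?w (Z p) = koszul X Y Z p"
    if "open V" "p \<in> V" "vfield V X" "vfield V Y" "vfield V Z" for V Z
    using T vfield_tangent[OF that(5,2)]
    by (simp add: koszul_frame[OF F p that] g_bilinear g_sym[of "Z p"] algebra_simps)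
  with w have *: "connection X Y p \<in> tangent p \<and> (\<forall>U Z. open U \<longrightarrow> p \<in> U \<longrightarrow>
    vfield U X \<longrightarrow> vfield U Y \<longrightarrow> vfield U Z \<longrightarrow> 2 * g p (connection X Y p) (Z p) = koszul X Y Z p)"
    unfolding connection_def by (intro someI[of _ ?w]) blast
  then show c: "connection X Y p \<in> tangent p" by simp
  show "vfield U Z \<Longrightarrow> 2 * g p (connection X Y p) (Z p) = koszul X Y Z p"
    using * U X Y by blast
  let ?V = "U \<inter> W"
  have half: "g p (connection X Y p) (E p) = koszul X Y E p / 2" if "vfield W E" for E
  proof -
    have "vfield ?V X" "vfield ?V Y" "vfield ?V E" "open ?V" "p \<in> ?V"
      using X Y U f(1) p that by (auto intro: vfield_Int1 vfield_Int2)
    with * have "2 * g p (connection X Y p) (E p) = koszul X Y E p" by blast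
    then show ?thesis by simp
  qed
  show "connection X Y p = ?w"
    using f(5)[OF p c] unfolding half[OF f(2)] half[OF f(3)] half[OF f(4)] .
qed

lemma koszul_smooth:
  assumes U: "open U" and X: "vfield U X" and Y: "vfield U Y" and Z: "vfield U Z"
  shows "smooth_fun U (koszul X Y Z)"
  unfolding koszul_def
  by (intro smooth_fun_add smooth_fun_diff U ip_smooth vfield_bracket X Y Z
      vfield_smooth[OF X] vfield_smooth[OF Y] vfield_smooth[OF Z] order.refl)

lemma vfield_connection:
  assumes U: "open U" and X: "vfield U X" and Y: "vfield U Y"
  shows "vfield U (connection X Y)"
proof (rule vfield_local)
  fix p assume p: "p \<in> U"
  obtain W E1 E2 E3 where pW: "p \<in> W" and F: "frame_on W E1 E2 E3"
    by (rule frame_exists)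
  let ?V = "U \<inter> W"
  have V: "open ?V" "vfield ?V X" "vfield ?V Y" "vfield ?V E1" "vfield ?V E2" "vfield ?V E3"
    using U X Y frame_onD[OF F] by (auto intro: vfield_Int1 vfield_Int2)
  have s: "smooth_fun ?V (\<lambda>q. koszul X Y E q / 2)" if "vfield ?V E" for E
    using V that by (intro smooth_fun_divide koszul_smooth smooth_fun_const) auto
  have "vfield ?V (\<lambda>q. (koszul X Y E1 q / 2) *\<^sub>R E1 q + (koszul X Y E2 q / 2) *\<^sub>R E2 q
    + (koszul X Y E3 q / 2) *\<^sub>R E3 q)"
    by (intro vfield_add vfield_scaleR s V)
  then have "vfield ?V (connection X Y)"
    by (rule vfield_cong[rotated]) (use connection_frame(1)[OF F _ U _ X Y] in auto)
  then show "\<exists>W. open W \<and> p \<in> W \<and> vfield (U \<inter> W) (connection X Y)"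
    using pW frame_onD(1)[OF F] by blast
qed

lemma vfield_plus_eq: "(X :: 'a vfield) + Y = (\<lambda>q. X q + Y q)"
  by (simp add: fun_eq_iff)

text \<open>Apart from smoothness and metric compatibility, each axiom is an equation of tangent
  vectors. Pairing it with test fields turns it into an identity for \<open>koszul\<close>.\<close>

lemma is_levi_civita_connection: "is_levi_civita A g connection"
  unfolding is_levi_civita_def
proof (intro allI impI conjI ballI)
  fix U X Y Z f
  assume U: "open U" and X: "vfield U X" and Y: "vfield U Y" and Z: "vfield U Z"
    and f: "smooth_fun U f"
  show "vfield U (connection X Y)"
    by (rule vfield_connection[OF U X Y])
  fix p assume p: "p \<in> U"
  have c: "connection X Y p \<in> tangent p" if "vfield U X" "vfield U Y" for X Y
    using vfield_connection[OF U that] p by (rule vfield_tangent)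
  have T: "X p \<in> tangent p" if "vfield U X" for X using that p by (rule vfield_tangent)
  have k: "g p (connection X Y p) (Z p) = koszul X Y Z p / 2"
    if "open W" "W \<subseteq> U" "p \<in> W" "vfield U X" "vfield U Y" "vfield W Z" for W X Y Z
  proof -
    obtain W' E1 E2 E3 where "p \<in> W'" and F: "frame_on W' E1 E2 E3"
      by (rule frame_exists)
    then show ?thesis
      using connection_frame(3)[OF F _ that(1,3) _ _ that(6)] that vfield_subset
      by (metis nonzero_mult_div_cancel_left zero_neq_numeral)
  qed
  note k1 = k[OF U order.refl p]
  note eqI = tangent_eqI[OF _ _ U p]
  note S = vfield_add vfield_scaleR f X Y Z
  show "connection (X + Y) Z p = connection X Z p + connection Y Z p"
    unfolding vfield_plus_eq
  proof (rule eqI)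
    fix W V assume W: "open W" "W \<subseteq> U" "p \<in> W" "vfield W V"
    have r: "vfield W X" "vfield W Y" "vfield W Z"
      using W X Y Z by (auto intro: vfield_subset[OF _ W(2)])
    show "g p (connection (\<lambda>q. X q + Y q) Z p) (V p) = g p (connection X Z p + connection Y Z p) (V p)"
      using W by (simp add: g_bilinear c S vfield_tangent[OF W(4)] k[OF W(1-3)]
          koszul_add[OF W(1,3)] r add_divide_distrib)
  qed (simp_all add: c S)
  show "connection X (Y + Z) p = connection X Y p + connection X Z p"
    unfolding vfield_plus_eq
  proof (rule eqI)
    fix W V assume W: "open W" "W \<subseteq> U" "p \<in> W" "vfield W V"
    have r: "vfield W X" "vfield W Y" "vfield W Z"
      using W X Y Z by (auto intro: vfield_subset[OF _ W(2)])
    show "g p (connection X (\<lambda>q. Y q + Z q) p) (V p) = g p (connection X Y p + connection X Z p) (V p)"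
      using W by (simp add: g_bilinear c S vfield_tangent[OF W(4)] k[OF W(1-3)]
          koszul_add[OF W(1,3)] r add_divide_distrib)
  qed (simp_all add: c S)
  show "connection (\<lambda>q. f q *\<^sub>R X q) Y p = f p *\<^sub>R connection X Y p"
  proof (rule eqI)
    fix W V assume W: "open W" "W \<subseteq> U" "p \<in> W" "vfield W V"
    have r: "vfield W X" "vfield W Y" "smooth_fun W f"
      using W X Y f by (auto intro: vfield_subset[OF _ W(2)] smooth_fun_subset[OF _ W(2)])
    show "g p (connection (\<lambda>q. f q *\<^sub>R X q) Y p) (V p) = g p (f p *\<^sub>R connection X Y p) (V p)"
      using W by (simp add: g_bilinear c S vfield_tangent[OF W(4)] k[OF W(1-3)]
          koszul_scaleR[OF W(1,3)] r)
  qed (simp_all add: c S)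
  show "connection X (\<lambda>q. f q *\<^sub>R Y q) p = X p f *\<^sub>R Y p + f p *\<^sub>R connection X Y p"
  proof (rule eqI)
    fix W V assume W: "open W" "W \<subseteq> U" "p \<in> W" "vfield W V"
    have r: "vfield W X" "vfield W Y" "smooth_fun W f"
      using W X Y f by (auto intro: vfield_subset[OF _ W(2)] smooth_fun_subset[OF _ W(2)])
    show "g p (connection X (\<lambda>q. f q *\<^sub>R Y q) p) (V p) = g p (X p f *\<^sub>R Y p + f p *\<^sub>R connection X Y p) (V p)"
      using W by (simp add: g_bilinear c S T vfield_tangent[OF W(4)] k[OF W(1-3)]
          koszul_scaleR[OF W(1,3)] r add_divide_distrib)
  qed (simp_all add: c S T)
  show "connection X Y p - connection Y X p = bracket X Y p"
  proof (rule eqI)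
    fix W V assume W: "open W" "W \<subseteq> U" "p \<in> W" "vfield W V"
    have r: "vfield W X" "vfield W Y"
      using W X Y by (auto intro: vfield_subset[OF _ W(2)])
    show "g p (connection X Y p - connection Y X p) (V p) = g p (bracket X Y p) (V p)"
      using W koszul_torsion[OF W(1,3) r W(4)] by (simp add: g_bilinear c S vfield_tangent[OF W(4)] k[OF W(1-3)])
  qed (simp_all add: c S bracket_tangent[OF U p])
  show "X p (ip Y Z) = g p (connection X Y p) (Z p) + g p (Y p) (connection X Z p)"
    using koszul_metric[OF U p X Y Z] by (simp add: g_sym[OF T c] k1 S)
qed

section \<open>Calculus with the Levi-Civita connection\<close>

abbreviation nabla :: "'a vfield \<Rightarrow> 'a vfield \<Rightarrow> 'a vfield"
  where "nabla \<equiv> levi_civita A g"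

lemma is_levi_civita_nabla: "is_levi_civita A g nabla"
  unfolding levi_civita_def by (rule someI[of "is_levi_civita A g", OF is_levi_civita_connection])

lemma vfield_nabla: "open U \<Longrightarrow> vfield U X \<Longrightarrow> vfield U Y \<Longrightarrow> vfield U (nabla X Y)"
  using is_levi_civita_nabla smooth_fun_const[of U 0] unfolding is_levi_civita_def by blast

context
  fixes U :: "'a set" and p :: 'a
  assumes U: "open U" "p \<in> U"
begin

lemma nabla_tangent: "vfield U X \<Longrightarrow> vfield U Y \<Longrightarrow> nabla X Y p \<in> tangent p"
  using vfield_nabla[OF U(1)] U(2) by (blast intro: vfield_tangent)

lemma nabla_add_left:
  "vfield U X \<Longrightarrow> vfield U Y \<Longrightarrow> vfield U Z \<Longrightarrow>
    nabla (\<lambda>q. X q + Y q) Z p = nabla X Z p + nabla Y Z p"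
  using is_levi_civita_nabla smooth_fun_const[of U 0] U
  unfolding is_levi_civita_def vfield_plus_eq by blast

lemma nabla_add_right:
  "vfield U X \<Longrightarrow> vfield U Y \<Longrightarrow> vfield U Z \<Longrightarrow>
    nabla X (\<lambda>q. Y q + Z q) p = nabla X Y p + nabla X Z p"
  using is_levi_civita_nabla smooth_fun_const[of U 0] U
  unfolding is_levi_civita_def vfield_plus_eq by blast

lemma nabla_scaleR_left:
  "vfield U X \<Longrightarrow> vfield U Y \<Longrightarrow> smooth_fun U f \<Longrightarrow>
    nabla (\<lambda>q. f q *\<^sub>R X q) Y p = f p *\<^sub>R nabla X Y p"
  using is_levi_civita_nabla U unfolding is_levi_civita_def by blast

lemma nabla_scaleR_right:
  "vfield U X \<Longrightarrow> vfield U Y \<Longrightarrow> smooth_fun U f \<Longrightarrow>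
    nabla X (\<lambda>q. f q *\<^sub>R Y q) p = X p f *\<^sub>R Y p + f p *\<^sub>R nabla X Y p"
  using is_levi_civita_nabla U unfolding is_levi_civita_def by blast

lemma nabla_torsion:
  "vfield U X \<Longrightarrow> vfield U Y \<Longrightarrow> bracket X Y p = nabla X Y p - nabla Y X p"
  using is_levi_civita_nabla smooth_fun_const[of U 0] U unfolding is_levi_civita_def by metis

lemma nabla_metric:
  "vfield U X \<Longrightarrow> vfield U Y \<Longrightarrow> vfield U Z \<Longrightarrow>
    X p (ip Y Z) = g p (nabla X Y p) (Z p) + g p (Y p) (nabla X Z p)"
  using is_levi_civita_nabla smooth_fun_const[of U 0] U unfolding is_levi_civita_def by blast

text \<open>Metric compatibility replaces the derivatives and vanishing torsion the brackets;
  everything else then cancels. Hence the axioms alone determine the chosen connection on local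
  fields.\<close>

lemma koszul_formula:
  assumes "vfield U X" and "vfield U Y" and "vfield U Z"
  shows "2 * g p (nabla X Y p) (Z p) = koszul X Y Z p"
proof -
  note T = assms[THEN vfield_tangent, OF U(2)]
  show ?thesis
    using assms by (simp add: koszul_def nabla_torsion nabla_metric g_bilinear nabla_tangent T
        g_sym[OF T(1) nabla_tangent] g_sym[OF T(2) nabla_tangent] g_sym[OF T(3) nabla_tangent])
qed

end

text \<open>Locality is not formal, since \<open>nabla\<close> takes fields on the whole space as
  arguments. It follows because the Koszul expression is local in each of its arguments.\<close>

lemma nabla_cong:
  assumes U: "open U" "p \<in> U" and X: "vfield U X" and Y: "vfield U Y"
    and "\<And>q. q \<in> U \<Longrightarrow> X q = X' q" and "\<And>q. q \<in> U \<Longrightarrow> Y q = Y' q"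
  shows "nabla X Y p = nabla X' Y' p"
proof -
  have X': "vfield U X'" and Y': "vfield U Y'"
    using vfield_cong[OF _ X, of X'] vfield_cong[OF _ Y, of Y'] assms(5,6) by auto
  show ?thesis
  proof (rule tangent_eqI[OF _ _ U])
    fix W Z assume W: "open W" "W \<subseteq> U" "p \<in> W" "vfield W Z"
    note r = X[THEN vfield_subset, OF W(2)] Y[THEN vfield_subset, OF W(2)]
      X'[THEN vfield_subset, OF W(2)] Y'[THEN vfield_subset, OF W(2)]
    have "koszul X Y Z p = koszul X' Y' Z p"
      by (rule koszul_cong[OF W(1,3) r(1,2) W(4)]) (use assms(5,6) W(2) in auto)
    then show "g p (nabla X Y p) (Z p) = g p (nabla X' Y' p) (Z p)"
      using koszul_formula[OF W(1,3) r(1,2) W(4)] koszul_formula[OF W(1,3) r(3,4) W(4)] by simp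
  qed (auto intro: nabla_tangent[OF U] X Y X' Y')
qed

end

section \<open>Curvature in an orthonormal frame\<close>

lemma span_pair: "span {u, v :: 'v::real_vector} = {a *\<^sub>R u + b *\<^sub>R v |a b. True}"
  by (auto simp: span_insert span_singleton algebra_simps)

lemma lin_indep2_iff:
  "lin_indep2 u (v :: 'v::real_vector) \<longleftrightarrow> (\<forall>a b. a *\<^sub>R u + b *\<^sub>R v = 0 \<longrightarrow> a = 0 \<and> b = 0)"
proof
  assume l: "lin_indep2 u v"
  show "\<forall>a b. a *\<^sub>R u + b *\<^sub>R v = 0 \<longrightarrow> a = 0 \<and> b = 0"
  proof (intro allI impI)
    fix a b assume 0: "a *\<^sub>R u + b *\<^sub>R v = 0"
    have "(\<Sum>w\<in>{u, v}. (if w = u then a else b) *\<^sub>R w) = 0"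
      using l 0 by (auto simp: lin_indep2_def)
    then have "(if w = u then a else b) = 0" if "w \<in> {u, v}" for w
      using l that independentD[of "{u, v}" "{u, v}" "\<lambda>w. if w = u then a else b" w]
      by (simp add: lin_indep2_def)
    from this[of u] this[of v] l show "a = 0 \<and> b = 0" by (auto simp: lin_indep2_def)
  qed
next
  assume r: "\<forall>a b. a *\<^sub>R u + b *\<^sub>R v = 0 \<longrightarrow> a = 0 \<and> b = 0"
  have "u \<noteq> v" using r[rule_format, of 1 "- 1"] by auto
  moreover have "v \<noteq> 0" using r[rule_format, of 0 1] by auto
  moreover have "u \<notin> span {v}"
  proof
    assume "u \<in> span {v}"
    then obtain k where "u = k *\<^sub>R v" by (auto simp: span_singleton)
    then show False using r[rule_format, of 1 "- k"] by simp
  qed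
  ultimately show "lin_indep2 u v"
    by (simp add: lin_indep2_def independent_insert)
qed

context framed
begin

abbreviation curv :: "'a vfield \<Rightarrow> 'a vfield \<Rightarrow> 'a vfield \<Rightarrow> 'a vfield"
  where "curv \<equiv> curvature_tensor A g"

lemma curv_apply:
  "curv X Y Z p = nabla X (nabla Y Z) p - nabla Y (nabla X Z) p - nabla (bracket X Y) Z p"
  by (simp add: curvature_tensor_def)

context
  fixes U :: "'a set" and p :: 'a
  assumes U: "open U" "p \<in> U"
begin

lemma curv_tangent:
  "vfield U X \<Longrightarrow> vfield U Y \<Longrightarrow> vfield U Z \<Longrightarrow> curv X Y Z p \<in> tangent p"
  unfolding curv_apply
  by (intro tangent_diff nabla_tangent[OF U] vfield_nabla[OF U(1)] vfield_bracket[OF U(1)])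

lemma curv_cong:
  assumes X: "vfield U X" and Y: "vfield U Y" and Z: "vfield U Z"
    and XX: "\<And>q. q \<in> U \<Longrightarrow> X q = X' q" and YY: "\<And>q. q \<in> U \<Longrightarrow> Y q = Y' q"
    and ZZ: "\<And>q. q \<in> U \<Longrightarrow> Z q = Z' q"
  shows "curv X Y Z p = curv X' Y' Z' p"
proof -
  have 1: "nabla Y Z q = nabla Y' Z' q" "nabla X Z q = nabla X' Z' q" "bracket X Y q = bracket X' Y' q"
    if "q \<in> U" for q
    using nabla_cong[OF U(1) that Y Z YY ZZ] nabla_cong[OF U(1) that X Z XX ZZ]
      bracket_cong[OF U(1) that X Y XX YY] by simp_all
  show ?thesis
    unfolding curv_apply
    using nabla_cong[OF U X vfield_nabla[OF U(1) Y Z] XX 1(1)]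
      nabla_cong[OF U Y vfield_nabla[OF U(1) X Z] YY 1(2)]
      nabla_cong[OF U vfield_bracket[OF U(1) X Y] Z 1(3) ZZ] by simp
qed

lemma curv_antisym:
  assumes X: "vfield U X" and Y: "vfield U Y" and Z: "vfield U Z"
  shows "curv X Y Z p = - curv Y X Z p"
proof -
  have "nabla (bracket X Y) Z p = nabla (\<lambda>q. (- 1) *\<^sub>R bracket Y X q) Z p"
    by (rule nabla_cong[OF U vfield_bracket[OF U(1) X Y] Z])
      (use bracket_antisym[of X Y] in simp_all)
  then show ?thesis
    using nabla_scaleR_left[OF U vfield_bracket[OF U(1) Y X] Z smooth_fun_const, of "- 1"]
    by (simp add: curv_apply)
qed

lemma curv_self:
  assumes X: "vfield U X" and Z: "vfield U Z"
  shows "curv X X Z p = 0"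
proof -
  have "2 *\<^sub>R curv X X Z p = 0"
    using curv_antisym[OF X X Z] by (metis eq_neg_iff_add_eq_0 scaleR_2)
  then show ?thesis by simp
qed

lemma curv_add_left:
  assumes X: "vfield U X" and X': "vfield U X'" and Y: "vfield U Y" and Z: "vfield U Z"
  shows "curv (\<lambda>q. X q + X' q) Y Z p = curv X Y Z p + curv X' Y Z p"
proof -
  note XX = vfield_add[OF X X']
  note n = vfield_nabla[OF U(1)] and b = vfield_bracket[OF U(1)]
  have "nabla Y (nabla (\<lambda>q. X q + X' q) Z) p = nabla Y (\<lambda>q. nabla X Z q + nabla X' Z q) p"
    by (rule nabla_cong[OF U Y n[OF XX Z] refl nabla_add_left[OF U(1) _ X X' Z]])
  moreover have "nabla (bracket (\<lambda>q. X q + X' q) Y) Z p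
      = nabla (\<lambda>q. bracket X Y q + bracket X' Y q) Z p"
    by (rule nabla_cong[OF U b[OF XX Y] Z bracket_add_left[OF U(1) _ X X' Y] refl])
  ultimately show ?thesis
    unfolding curv_apply
    by (simp add: nabla_add_left[OF U X X' n[OF Y Z]] nabla_add_right[OF U Y n[OF X Z] n[OF X' Z]]
        nabla_add_left[OF U b[OF X Y] b[OF X' Y] Z])
qed

text \<open>The term \<open>Y p f *\<^sub>R nabla X Z p\<close> from differentiating
  \<open>f *\<^sub>R nabla X Z\<close> cancels the one from the derivative part of the
  bracket.\<close>

lemma curv_scaleR_left:
  assumes X: "vfield U X" and Y: "vfield U Y" and Z: "vfield U Z" and f: "smooth_fun U f"
  shows "curv (\<lambda>q. f q *\<^sub>R X q) Y Z p = f p *\<^sub>R curv X Y Z p"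
proof -
  note fX = vfield_scaleR[OF f X]
  note n = vfield_nabla[OF U(1)] and b = vfield_bracket[OF U(1)]
  have Yf: "smooth_fun U (\<lambda>q. 0 - Y q f)"
    by (intro smooth_fun_diff U smooth_fun_const vfield_smooth[OF Y U(1) order.refl f])
  have "nabla Y (nabla (\<lambda>q. f q *\<^sub>R X q) Z) p = nabla Y (\<lambda>q. f q *\<^sub>R nabla X Z q) p"
    by (rule nabla_cong[OF U Y n[OF fX Z] refl nabla_scaleR_left[OF U(1) _ X Z f]])
  moreover have "nabla (bracket (\<lambda>q. f q *\<^sub>R X q) Y) Z p
      = nabla (\<lambda>q. f q *\<^sub>R bracket X Y q + (0 - Y q f) *\<^sub>R X q) Z p"
    by (rule nabla_cong[OF U b[OF fX Y] Z _ refl]) (simp add: bracket_scaleR_left[OF U(1) _ X Y f])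
  moreover have "\<dots> = f p *\<^sub>R nabla (bracket X Y) Z p + (0 - Y p f) *\<^sub>R nabla X Z p"
    by (simp only: nabla_add_left[OF U vfield_scaleR[OF f b[OF X Y]] vfield_scaleR[OF Yf X] Z]
        nabla_scaleR_left[OF U b[OF X Y] Z f] nabla_scaleR_left[OF U X Z Yf])
  ultimately show ?thesis
    unfolding curv_apply
    by (simp add: nabla_scaleR_left[OF U X n[OF Y Z] f] nabla_scaleR_right[OF U Y n[OF X Z] f]
        algebra_simps)
qed

lemma curv_add_right:
  assumes X: "vfield U X" and Y: "vfield U Y" and Z: "vfield U Z" and Z': "vfield U Z'"
  shows "curv X Y (\<lambda>q. Z q + Z' q) p = curv X Y Z p + curv X Y Z' p"
proof -
  note ZZ = vfield_add[OF Z Z']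
  note n = vfield_nabla[OF U(1)] and b = vfield_bracket[OF U(1)]
  have "nabla X (nabla Y (\<lambda>q. Z q + Z' q)) p = nabla X (\<lambda>q. nabla Y Z q + nabla Y Z' q) p"
    by (rule nabla_cong[OF U X n[OF Y ZZ] refl nabla_add_right[OF U(1) _ Y Z Z']])
  moreover have "nabla Y (nabla X (\<lambda>q. Z q + Z' q)) p = nabla Y (\<lambda>q. nabla X Z q + nabla X Z' q) p"
    by (rule nabla_cong[OF U Y n[OF X ZZ] refl nabla_add_right[OF U(1) _ X Z Z']])
  ultimately show ?thesis
    unfolding curv_apply
    by (simp add: nabla_add_right[OF U X n[OF Y Z] n[OF Y Z']]
        nabla_add_right[OF U Y n[OF X Z] n[OF X Z']] nabla_add_right[OF U b[OF X Y] Z Z'])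
qed

text \<open>The first-order terms are symmetric in \<open>X\<close> and \<open>Y\<close>, and the
  second derivatives of \<open>f\<close> leave \<open>X (Y f) - Y (X f)\<close>, which the bracket
  term removes.\<close>

lemma curv_scaleR_right:
  assumes X: "vfield U X" and Y: "vfield U Y" and Z: "vfield U Z" and f: "smooth_fun U f"
  shows "curv X Y (\<lambda>q. f q *\<^sub>R Z q) p = f p *\<^sub>R curv X Y Z p"
proof -
  note fZ = vfield_scaleR[OF f Z]
  note n = vfield_nabla[OF U(1)] and b = vfield_bracket[OF U(1)]
  have nn: "nabla X (nabla Y (\<lambda>q. f q *\<^sub>R Z q)) p = X p (\<lambda>q. Y q f) *\<^sub>R Z p + Y p f *\<^sub>R nabla X Z p
      + (X p f *\<^sub>R nabla Y Z p + f p *\<^sub>R nabla X (nabla Y Z) p)"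
    if X: "vfield U X" and Y: "vfield U Y" for X Y
  proof -
    have Yf: "smooth_fun U (\<lambda>q. Y q f)"
      by (rule vfield_smooth[OF Y U(1) order.refl f])
    have "nabla X (nabla Y (\<lambda>q. f q *\<^sub>R Z q)) p = nabla X (\<lambda>q. Y q f *\<^sub>R Z q + f q *\<^sub>R nabla Y Z q) p"
      by (rule nabla_cong[OF U X n[OF Y fZ] refl nabla_scaleR_right[OF U(1) _ Y Z f]])
    then show ?thesis
      by (simp add: nabla_add_right[OF U X vfield_scaleR[OF Yf Z] vfield_scaleR[OF f n[OF Y Z]]]
          nabla_scaleR_right[OF U X Z Yf] nabla_scaleR_right[OF U X n[OF Y Z] f])
  qed
  show ?thesis
    unfolding curv_apply nn[OF X Y] nn[OF Y X] nabla_scaleR_right[OF U b[OF X Y] Z f]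
      bracket_apply[OF smooth_nearI[OF U f]]
    by (simp add: algebra_simps)
qed

text \<open>The function \<open>ip Z V\<close> is differentiated twice by metric compatibility; its
  commutator is the derivative along the bracket, and the mixed terms cancel.\<close>

lemma curv_skew:
  assumes X: "vfield U X" and Y: "vfield U Y" and Z: "vfield U Z" and V: "vfield U V"
  shows "g p (curv X Y Z p) (V p) = - g p (curv X Y V p) (Z p)"
proof -
  note n = vfield_nabla[OF U(1)] and b = vfield_bracket[OF U(1)]
  have T: "X p \<in> tangent p" if "vfield U X" for X
    using that U(2) by (rule vfield_tangent)
  have nn: "X p (\<lambda>q. Y q (ip Z V)) = g p (nabla X (nabla Y Z) p) (V p) + g p (nabla Y Z p) (nabla X V p)
      + (g p (nabla X Z p) (nabla Y V p) + g p (Z p) (nabla X (nabla Y V) p))"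
    if X: "vfield U X" and Y: "vfield U Y" for X Y
  proof -
    have "X p (\<lambda>q. Y q (ip Z V)) = X p (\<lambda>q. ip (nabla Y Z) V q + ip Z (nabla Y V) q)"
      by (rule tangent_cong[OF T[OF X] U nabla_metric[OF U(1) _ Y Z V]])
    then show ?thesis
      by (simp add: tangent_add_fun[OF T[OF X] smooth_nearI[OF U ip_smooth] smooth_nearI[OF U ip_smooth]]
          U n Y Z V nabla_metric[OF U X])
  qed
  have "bracket X Y p (ip Z V) = X p (\<lambda>q. Y q (ip Z V)) - Y p (\<lambda>q. X q (ip Z V))"
    by (rule bracket_apply[OF smooth_nearI[OF U ip_smooth[OF U(1) Z V]]])
  then show ?thesis
    unfolding nn[OF X Y] nn[OF Y X] nabla_metric[OF U b[OF X Y] Z V] curv_apply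
    using X Y Z V n b g_sym[of "Z p" p]
    by (simp add: g_bilinear T nabla_tangent[OF U])
qed

end

lemma curv_frame_left:
  assumes U: "open U" "p \<in> U" and X: "vfield U X" and Y: "vfield U Y" and Z: "vfield U Z"
    and F: "frame_on W E1 E2 E3" and p: "p \<in> W"
  shows "curv X Y Z p = ip X E1 p *\<^sub>R curv E1 Y Z p + ip X E2 p *\<^sub>R curv E2 Y Z p
    + ip X E3 p *\<^sub>R curv E3 Y Z p"
proof -
  let ?V = "U \<inter> W"
  note f = frame_onD[OF F]
  have V: "open ?V" "p \<in> ?V" using U f(1) p by auto
  note vf = X[THEN vfield_Int1] Y[THEN vfield_Int1] Z[THEN vfield_Int1] f(2-4)[THEN vfield_Int2]
  have s: "smooth_fun ?V (ip X E1)" "smooth_fun ?V (ip X E2)" "smooth_fun ?V (ip X E3)"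
    using vf V by (auto intro: ip_smooth)
  have "curv X Y Z p = curv (\<lambda>q. ip X E1 q *\<^sub>R E1 q + ip X E2 q *\<^sub>R E2 q + ip X E3 q *\<^sub>R E3 q) Y Z p"
    by (rule curv_cong[OF V vf(1-3)]) (use vfield_tangent[OF vf(1)] f(5) in auto)
  then show ?thesis
    by (simp add: curv_add_left[OF V] curv_scaleR_left[OF V] vf s vfield_add vfield_scaleR)
qed

lemma curv_frame_right:
  assumes U: "open U" "p \<in> U" and X: "vfield U X" and Y: "vfield U Y" and Z: "vfield U Z"
    and F: "frame_on W E1 E2 E3" and p: "p \<in> W"
  shows "curv X Y Z p = ip Z E1 p *\<^sub>R curv X Y E1 p + ip Z E2 p *\<^sub>R curv X Y E2 p
    + ip Z E3 p *\<^sub>R curv X Y E3 p"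
proof -
  let ?V = "U \<inter> W"
  note f = frame_onD[OF F]
  have V: "open ?V" "p \<in> ?V" using U f(1) p by auto
  note vf = X[THEN vfield_Int1] Y[THEN vfield_Int1] Z[THEN vfield_Int1] f(2-4)[THEN vfield_Int2]
  have s: "smooth_fun ?V (ip Z E1)" "smooth_fun ?V (ip Z E2)" "smooth_fun ?V (ip Z E3)"
    using vf V by (auto intro: ip_smooth)
  have "curv X Y Z p = curv X Y (\<lambda>q. ip Z E1 q *\<^sub>R E1 q + ip Z E2 q *\<^sub>R E2 q + ip Z E3 q *\<^sub>R E3 q) p"
    by (rule curv_cong[OF V vf(1-3)]) (use vfield_tangent[OF vf(3)] f(5) in auto)
  then show ?thesis
    by (simp add: curv_add_right[OF V] curv_scaleR_right[OF V] vf s vfield_add vfield_scaleR)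
qed

lemma nabla_frame_left:
  assumes U: "open U" "p \<in> U" and X: "vfield U X" and Y: "vfield U Y"
    and F: "frame_on W E1 E2 E3" and p: "p \<in> W"
  shows "nabla X Y p = ip X E1 p *\<^sub>R nabla E1 Y p + ip X E2 p *\<^sub>R nabla E2 Y p
    + ip X E3 p *\<^sub>R nabla E3 Y p"
proof -
  let ?V = "U \<inter> W"
  note f = frame_onD[OF F]
  have V: "open ?V" "p \<in> ?V" using U f(1) p by auto
  note vf = X[THEN vfield_Int1] Y[THEN vfield_Int1] f(2-4)[THEN vfield_Int2]
  have s: "smooth_fun ?V (ip X E1)" "smooth_fun ?V (ip X E2)" "smooth_fun ?V (ip X E3)"
    using vf V by (auto intro: ip_smooth)
  have "nabla X Y p = nabla (\<lambda>q. ip X E1 q *\<^sub>R E1 q + ip X E2 q *\<^sub>R E2 q + ip X E3 q *\<^sub>R E3 q) Y p"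
    by (rule nabla_cong[OF V vf(1,2)]) (use vfield_tangent[OF vf(1)] f(5) in auto)
  then show ?thesis
    by (simp add: nabla_add_left[OF V] nabla_scaleR_left[OF V] vf s vfield_add vfield_scaleR)
qed

end

section \<open>Linear algebra in an orthonormal frame\<close>

context riemannian
begin

lemma frame_on_ip:
  assumes "frame_on W E1 E2 E3" and "q \<in> W"
  shows "ip E1 E1 q = 1" "ip E2 E2 q = 1" "ip E3 E3 q = 1" "ip E1 E2 q = 0" "ip E2 E1 q = 0"
    "ip E1 E3 q = 0" "ip E3 E1 q = 0" "ip E2 E3 q = 0" "ip E3 E2 q = 0"
proof -
  have "E1 q \<in> tangent q" "E2 q \<in> tangent q" "E3 q \<in> tangent q"
    using assms vfield_tangent by (auto simp: frame_on_def)
  then show "ip E1 E1 q = 1" "ip E2 E2 q = 1" "ip E3 E3 q = 1" "ip E1 E2 q = 0" "ip E2 E1 q = 0"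
    "ip E1 E3 q = 0" "ip E3 E1 q = 0" "ip E2 E3 q = 0" "ip E3 E2 q = 0"
    using assms g_sym[of "E2 q" q "E1 q"] g_sym[of "E3 q" q "E1 q"] g_sym[of "E3 q" q "E2 q"]
    by (auto simp: frame_on_def)
qed

lemma g_frame:
  assumes F: "frame_on W E1 E2 E3" and q: "q \<in> W" and u: "u \<in> tangent q" and v: "v \<in> tangent q"
  shows "g q u v = g q u (E1 q) * g q v (E1 q) + g q u (E2 q) * g q v (E2 q)
    + g q u (E3 q) * g q v (E3 q)"
proof -
  note f = frame_onD[OF F]
  note T = vfield_tangent[OF f(2) q] vfield_tangent[OF f(3) q] vfield_tangent[OF f(4) q]
  have "g q u v = g q (g q u (E1 q) *\<^sub>R E1 q + g q u (E2 q) *\<^sub>R E2 q + g q u (E3 q) *\<^sub>R E3 q) v"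
    using f(5)[OF q u] by simp
  also have "\<dots> = g q u (E1 q) * g q v (E1 q) + g q u (E2 q) * g q v (E2 q)
    + g q u (E3 q) * g q v (E3 q)"
    using T u v g_sym[OF v] by (simp add: g_bilinear)
  finally show ?thesis .
qed

lemma frame_span:
  assumes F: "frame_on W E1 E2 E3" and q: "q \<in> W"
  shows "v \<in> span {E1 q, E2 q} \<longleftrightarrow> v \<in> tangent q \<and> g q v (E3 q) = 0"
    and "lin_indep2 (E1 q) (E2 q)"
proof -
  note f = frame_onD[OF F]
  note T = vfield_tangent[OF f(2) q] vfield_tangent[OF f(3) q] vfield_tangent[OF f(4) q]
  show "v \<in> span {E1 q, E2 q} \<longleftrightarrow> v \<in> tangent q \<and> g q v (E3 q) = 0"
  proof
    assume "v \<in> span {E1 q, E2 q}"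
    then show "v \<in> tangent q \<and> g q v (E3 q) = 0"
      using T by (auto simp: span_pair g_bilinear frame_on_ip[OF F q])
  next
    assume v: "v \<in> tangent q \<and> g q v (E3 q) = 0"
    then have "v = g q v (E1 q) *\<^sub>R E1 q + g q v (E2 q) *\<^sub>R E2 q"
      using f(5)[OF q, of v] by simp
    then show "v \<in> span {E1 q, E2 q}" by (auto simp: span_pair)
  qed
  have "a = 0 \<and> b = 0" if "a *\<^sub>R E1 q + b *\<^sub>R E2 q = 0" for a b
  proof -
    have "g q (a *\<^sub>R E1 q + b *\<^sub>R E2 q) (E1 q) = 0" "g q (a *\<^sub>R E1 q + b *\<^sub>R E2 q) (E2 q) = 0"
      unfolding that using T by (simp_all add: g_bilinear)
    then show ?thesis
      using T by (simp add: g_bilinear frame_on_ip[OF F q])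
  qed
  then show "lin_indep2 (E1 q) (E2 q)"
    by (simp add: lin_indep2_iff)
qed

text \<open>Lagrange's identity in the plane: the Gram determinant is the square of the determinant
  of the components. The latter is the change of basis from the frame and thus nonzero for
  independent vectors.\<close>

lemma frame_gram:
  assumes F: "frame_on W E1 E2 E3" and q: "q \<in> W"
    and u: "u \<in> span {E1 q, E2 q}" and v: "v \<in> span {E1 q, E2 q}"
  shows "g q u u * g q v v - (g q u v)\<^sup>2
      = (g q u (E1 q) * g q v (E2 q) - g q u (E2 q) * g q v (E1 q))\<^sup>2"
    and "lin_indep2 u v \<Longrightarrow> g q u (E1 q) * g q v (E2 q) - g q u (E2 q) * g q v (E1 q) \<noteq> 0"
proof -
  have u': "u \<in> tangent q" "g q u (E3 q) = 0" and v': "v \<in> tangent q" "g q v (E3 q) = 0"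
    using u v frame_span(1)[OF F q] by auto
  show "g q u u * g q v v - (g q u v)\<^sup>2
      = (g q u (E1 q) * g q v (E2 q) - g q u (E2 q) * g q v (E1 q))\<^sup>2"
    by (simp add: g_frame[OF F q u'(1) u'(1)] g_frame[OF F q v'(1) v'(1)] g_frame[OF F q u'(1) v'(1)]
        u' v' power2_eq_square algebra_simps)
  assume l: "lin_indep2 u v"
  let ?u1 = "g q u (E1 q)" and ?u2 = "g q u (E2 q)" and ?v1 = "g q v (E1 q)" and ?v2 = "g q v (E2 q)"
  show "?u1 * ?v2 - ?u2 * ?v1 \<noteq> 0"
  proof
    assume d: "?u1 * ?v2 - ?u2 * ?v1 = 0"
    have eu: "u = ?u1 *\<^sub>R E1 q + ?u2 *\<^sub>R E2 q" and ev: "v = ?v1 *\<^sub>R E1 q + ?v2 *\<^sub>R E2 q"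
      using frame_onD(5)[OF F q u'(1)] frame_onD(5)[OF F q v'(1)] u' v' by simp_all
    have "a *\<^sub>R u + b *\<^sub>R v = (a * ?u1 + b * ?v1) *\<^sub>R E1 q + (a * ?u2 + b * ?v2) *\<^sub>R E2 q" for a b
    proof -
      have "a *\<^sub>R u + b *\<^sub>R v = a *\<^sub>R (?u1 *\<^sub>R E1 q + ?u2 *\<^sub>R E2 q) + b *\<^sub>R (?v1 *\<^sub>R E1 q + ?v2 *\<^sub>R E2 q)"
        using eu ev by simp
      then show ?thesis by (simp add: algebra_simps)
    qed
    note lc = this
    \<comment> \<open>When the determinant vanishes, the rows of the adjugate matrix give two linear
      relations; independence then makes both components of \<open>u\<close> zero.\<close>
    have "?v2 *\<^sub>R u + (- ?u2) *\<^sub>R v = 0" "?v1 *\<^sub>R u + (- ?u1) *\<^sub>R v = 0"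
      unfolding lc using d by (simp_all add: algebra_simps)
    then have "- ?u1 = 0" "- ?u2 = 0"
      using l unfolding lin_indep2_iff by blast+
    then have "?u1 = 0" "?u2 = 0"
      by simp_all
    then have "1 *\<^sub>R u + 0 *\<^sub>R v = 0"
      unfolding lc by simp
    then show False using l by (metis lin_indep2_iff zero_neq_one)
  qed
qed

end

context framed
begin

text \<open>The definite description needs every admissible pair to give the same value. With
  \<open>?d\<close> the determinant of the components, the numerator scales by the square of
  \<open>?d\<close>, exactly as the Gram determinant does.\<close>

lemma sectional_curvature_frame:
  assumes F: "frame_on W E1 E2 E3" and p: "p \<in> W"
  shows "sectional_curvature A g p (span {E1 p, E2 p}) = g p (curv E1 E2 E2 p) (E1 p)"
proof -
  note f = frame_onD[OF F]
  note T = vfield_tangent[OF f(2) p] vfield_tangent[OF f(3) p] vfield_tangent[OF f(4) p]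
  note W = f(1) p
  let ?k = "g p (curv E1 E2 E2 p) (E1 p)"
  show ?thesis
    unfolding sectional_curvature_def
  proof (rule the_equality)
    show "\<exists>U X Y. open U \<and> p \<in> U \<and> vfield U X \<and> vfield U Y \<and> lin_indep2 (X p) (Y p) \<and>
      span {E1 p, E2 p} = span {X p, Y p} \<and>
      ?k = g p (curv X Y Y p) (X p) / (ip X X p * ip Y Y p - (ip X Y p)\<^sup>2)"
      using W f(2,3) frame_span(2)[OF F p]
      by (intro exI[of _ W] exI[of _ E1] exI[of _ E2]) (simp add: frame_on_ip[OF F p])
  next
    fix k assume "\<exists>U X Y. open U \<and> p \<in> U \<and> vfield U X \<and> vfield U Y \<and> lin_indep2 (X p) (Y p) \<and>
      span {E1 p, E2 p} = span {X p, Y p} \<and>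
      k = g p (curv X Y Y p) (X p) / (ip X X p * ip Y Y p - (ip X Y p)\<^sup>2)"
    then obtain U X Y where U: "open U" "p \<in> U" and X: "vfield U X" and Y: "vfield U Y"
      and l: "lin_indep2 (X p) (Y p)" and sp: "span {E1 p, E2 p} = span {X p, Y p}"
      and k: "k = g p (curv X Y Y p) (X p) / (ip X X p * ip Y Y p - (ip X Y p)\<^sup>2)"
      by (elim exE conjE)
    have Xs: "X p \<in> span {E1 p, E2 p}" and Ys: "Y p \<in> span {E1 p, E2 p}"
      unfolding sp by (auto intro: span_base)
    have X3: "ip X E3 p = 0" and Y3: "ip Y E3 p = 0"
      using Xs Ys frame_span(1)[OF F p] by auto
    let ?V = "U \<inter> W"
    have V: "open ?V" "p \<in> ?V" using U f(1) p by auto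
    note vf = X[THEN vfield_Int1] Y[THEN vfield_Int1] f(2-4)[THEN vfield_Int2]
    note ct = curv_tangent[OF V] curv_tangent[OF W]
    let ?d = "ip X E1 p * ip Y E2 p - ip X E2 p * ip Y E1 p"
    \<comment> \<open>Antisymmetry moves the first \<open>Y\<close> into the slot that
      \<open>curv_frame_left\<close> expands.\<close>
    have 2: "curv E Y Y p = - (ip Y E1 p *\<^sub>R curv E1 E Y p + ip Y E2 p *\<^sub>R curv E2 E Y p)"
      if E: "vfield ?V E" for E
      by (simp only: curv_antisym[OF V E vf(2) vf(2)] curv_frame_left[OF V vf(2) E vf(2) F p] Y3
          scaleR_zero_left add_0_right)
    have "curv X Y Y p = ip X E1 p *\<^sub>R curv E1 Y Y p + ip X E2 p *\<^sub>R curv E2 Y Y p"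
      by (simp only: curv_frame_left[OF V vf(1,2,2) F p] X3 scaleR_zero_left add_0_right)
    also have "\<dots> = ?d *\<^sub>R curv E1 E2 Y p"
      by (simp add: 2 vf curv_self[OF V vf(3) vf(2)] curv_self[OF V vf(4) vf(2)]
          curv_antisym[OF V vf(4,3,2)] algebra_simps)
    also have "curv E1 E2 Y p = ip Y E1 p *\<^sub>R curv E1 E2 E1 p + ip Y E2 p *\<^sub>R curv E1 E2 E2 p"
      by (simp only: curv_frame_right[OF V vf(3,4,2) F p] Y3 scaleR_zero_left add_0_right)
    finally have R: "curv X Y Y p = ?d *\<^sub>R
      (ip Y E1 p *\<^sub>R curv E1 E2 E1 p + ip Y E2 p *\<^sub>R curv E1 E2 E2 p)" .
    have Xp: "X p = ip X E1 p *\<^sub>R E1 p + ip X E2 p *\<^sub>R E2 p"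
      using f(5)[OF p vfield_tangent[OF X U(2)]] X3 by simp
    have 0: "g p (curv E1 E2 E1 p) (E1 p) = 0" "g p (curv E1 E2 E2 p) (E2 p) = 0"
      "g p (curv E1 E2 E1 p) (E2 p) = - ?k"
      using curv_skew[OF W f(2,3,2,2)] curv_skew[OF W f(2,3,3,3)] curv_skew[OF W f(2,3,2,3)] by simp_all
    have "g p (curv X Y Y p) (X p) = g p (?d *\<^sub>R
      (ip Y E1 p *\<^sub>R curv E1 E2 E1 p + ip Y E2 p *\<^sub>R curv E1 E2 E2 p))
      (ip X E1 p *\<^sub>R E1 p + ip X E2 p *\<^sub>R E2 p)"
      using R Xp by simp
    also have "\<dots> = ?d\<^sup>2 * ?k"
      using T ct(2)[OF f(2,3,2)] ct(2)[OF f(2,3,3)]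
      by (simp add: g_bilinear 0 power2_eq_square algebra_simps)
    finally show "k = ?k"
      using frame_gram(2)[OF F p Xs Ys l] unfolding k frame_gram(1)[OF F p Xs Ys] by simp
  qed
qed

end

section \<open>Extrinsic and Gaussian curvature in an adapted frame\<close>

context framed
begin

context
  fixes W :: "'a set" and E1 E2 E3 :: "'a vfield" and \<xi> :: "'a \<Rightarrow> 'a tvec set"
  assumes F: "frame_on W E1 E2 E3" and plane: "\<forall>q\<in>W. \<xi> q = span {E1 q, E2 q}"
begin

private lemmas \<xi> = plane[rule_format]

text \<open>The product \<open>ip Y E3\<close> vanishes near \<open>p\<close> and not only at
  \<open>p\<close>, so differentiation can be moved onto \<open>E3\<close>. The result is tensorial
  in \<open>X\<close> and \<open>Y\<close> and determined by the four values on the frame.\<close>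

lemma nabla_normal:
  assumes p: "p \<in> W" and U: "open U" "p \<in> U" and X: "section_on A \<xi> U X" and Y: "section_on A \<xi> U Y"
  shows "g p (nabla X Y p) (E3 p) =
      ip X E1 p * ip Y E1 p * ip (nabla E1 E1) E3 p + ip X E1 p * ip Y E2 p * ip (nabla E1 E2) E3 p
    + ip X E2 p * ip Y E1 p * ip (nabla E2 E1) E3 p + ip X E2 p * ip Y E2 p * ip (nabla E2 E2) E3 p"
proof -
  let ?V = "U \<inter> W"
  note f = frame_onD[OF F]
  have V: "open ?V" "p \<in> ?V" using U f(1) p by auto
  have XU: "vfield U X" and YU: "vfield U Y"
    and X3: "ip X E3 q = 0" and Y3: "ip Y E3 q = 0" if "q \<in> ?V" for q
    using X Y that \<xi>[of q] frame_span(1)[OF F, of q] by (auto simp: section_on_def)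
  note vf = XU[OF V(2), THEN vfield_Int1] YU[OF V(2), THEN vfield_Int1] f(2-4)[THEN vfield_Int2]
  note T = vf[THEN vfield_tangent, OF V(2)]
  note N = nabla_tangent[OF V]
  have tr: "g p (nabla Z Z' p) (E3 p) = - g p (Z' p) (nabla Z E3 p)"
    if Z: "vfield ?V Z" and Z': "vfield ?V Z'" and "\<And>q. q \<in> ?V \<Longrightarrow> ip Z' E3 q = 0" for Z Z'
  proof -
    have ZT: "Z p \<in> tangent p" using Z V(2) by (rule vfield_tangent)
    have "Z p (ip Z' E3) = Z p (\<lambda>q. 0)"
      by (rule tangent_cong[OF ZT V]) (rule that(3))
    then show ?thesis
      using nabla_metric[OF V Z Z' vf(5)] tangent_const[OF ZT, of 0] by simp
  qed
  have E: "g p (E1 p) (nabla Z E3 p) = - g p (nabla Z E1 p) (E3 p)"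
    "g p (E2 p) (nabla Z E3 p) = - g p (nabla Z E2 p) (E3 p)" if "vfield ?V Z" for Z
    using tr[OF that vf(3)] tr[OF that vf(4)] frame_on_ip[OF F] by simp_all
  have "g p (nabla X Y p) (E3 p) = - g p (Y p) (nabla X E3 p)"
    by (rule tr[OF vf(1,2) Y3])
  also have "nabla X E3 p = ip X E1 p *\<^sub>R nabla E1 E3 p + ip X E2 p *\<^sub>R nabla E2 E3 p"
    by (simp only: nabla_frame_left[OF V vf(1,5) F p] X3[OF V(2)] scaleR_zero_left add_0_right)
  also have "Y p = ip Y E1 p *\<^sub>R E1 p + ip Y E2 p *\<^sub>R E2 p"
    using f(5)[OF p T(2)] Y3[OF V(2)] by simp
  also have "g p (a *\<^sub>R E1 p + b *\<^sub>R E2 p) (c *\<^sub>R nabla E1 E3 p + d *\<^sub>R nabla E2 E3 p)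
      = a * (c * g p (E1 p) (nabla E1 E3 p) + d * g p (E1 p) (nabla E2 E3 p))
      + b * (c * g p (E2 p) (nabla E1 E3 p) + d * g p (E2 p) (nabla E2 E3 p))" for a b c d
    using T N[OF vf(3,5)] N[OF vf(4,5)] by (simp add: g_bilinear) (simp add: distrib_left)
  finally show ?thesis
    by (simp add: E vf algebra_simps)
qed

text \<open>As for the sectional curvature, independence of \<open>X\<close>, \<open>Y\<close> comes
  from the squared determinant of the components. The unit normal is determined up to a sign, which
  drops out of a quadratic expression.\<close>

lemma extrinsic_curvature_frame:
  assumes p: "p \<in> W"
  shows "extrinsic_curvature A g \<xi> p = ip (nabla E1 E1) E3 p * ip (nabla E2 E2) E3 p
    - ((ip (nabla E1 E2) E3 p + ip (nabla E2 E1) E3 p) / 2)\<^sup>2"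
    (is "_ = ?k")
  unfolding extrinsic_curvature_def
proof (rule the_equality)
  note f = frame_onD[OF F]
  note W = f(1) p
  note T = f(2-4)[THEN vfield_tangent, OF p]
  note N = nabla_tangent[OF W]
  have sec: "section_on A \<xi> W E1" "section_on A \<xi> W E2"
    using f \<xi> by (auto simp: section_on_def intro: span_base)
  have normal: "unit_normal_on A g \<xi> W E3"
    using f(4) \<xi> frame_on_ip[OF F] frame_span(1)[OF F] by (auto simp: unit_normal_on_def)
  have sff: "second_fundamental_form A g E3 X Y p = (ip (nabla X Y) E3 p + ip (nabla Y X) E3 p) / 2"
    if "vfield W X" "vfield W Y" for X Y
    using that by (simp add: second_fundamental_form_def g_bilinear T N)
  show "\<exists>U S T n. open U \<and> p \<in> U \<and> section_on A \<xi> U S \<and> section_on A \<xi> U T \<and>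
    (\<forall>q\<in>U. lin_indep2 (S q) (T q)) \<and> unit_normal_on A g \<xi> U n \<and>
    ?k = (second_fundamental_form A g n S S p * second_fundamental_form A g n T T p
          - (second_fundamental_form A g n S T p)\<^sup>2) / (ip S S p * ip T T p - (ip S T p)\<^sup>2)"
    using W f(2,3) frame_span(2)[OF F] normal sec
    by (intro exI[of _ W] exI[of _ E1] exI[of _ E2] exI[of _ E3]) (simp add: frame_on_ip[OF F p] sff)
  fix k assume "\<exists>U S T n. open U \<and> p \<in> U \<and> section_on A \<xi> U S \<and> section_on A \<xi> U T \<and>
    (\<forall>q\<in>U. lin_indep2 (S q) (T q)) \<and> unit_normal_on A g \<xi> U n \<and>
    k = (second_fundamental_form A g n S S p * second_fundamental_form A g n T T p
          - (second_fundamental_form A g n S T p)\<^sup>2) / (ip S S p * ip T T p - (ip S T p)\<^sup>2)"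
  then obtain U X Y n where U: "open U" "p \<in> U" and X: "section_on A \<xi> U X" and Y: "section_on A \<xi> U Y"
    and l: "\<forall>q\<in>U. lin_indep2 (X q) (Y q)" and n: "unit_normal_on A g \<xi> U n"
    and k: "k = (second_fundamental_form A g n X X p * second_fundamental_form A g n Y Y p
          - (second_fundamental_form A g n X Y p)\<^sup>2) / (ip X X p * ip Y Y p - (ip X Y p)\<^sup>2)"
    by (elim exE conjE)
  have vX: "vfield U X" and vY: "vfield U Y" and vn: "vfield U n"
    using X Y n by (auto simp: section_on_def unit_normal_on_def)
  have Xs: "X p \<in> span {E1 p, E2 p}" and Ys: "Y p \<in> span {E1 p, E2 p}"
    using X Y U(2) \<xi>[OF p] by (auto simp: section_on_def)
  have nT: "n p \<in> tangent p" using vn U(2) by (rule vfield_tangent)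
  have "E1 p \<in> \<xi> p" "E2 p \<in> \<xi> p"
    using \<xi>[OF p] by (auto intro: span_base)
  then have n0: "g p (n p) (E1 p) = 0" "g p (n p) (E2 p) = 0" and n1: "ip n n p = 1"
    using n U(2) g_sym[OF nT] T by (auto simp: unit_normal_on_def)
  \<comment> \<open>The sign of \<open>n\<close> relative to \<open>E3\<close>; only its square
    enters the result.\<close>
  define e where "e = ip n E3 p"
  have e: "n p = e *\<^sub>R E3 p"
    using frame_onD(5)[OF F p nT] n0 by (simp add: e_def)
  have ee: "e\<^sup>2 = 1"
    using n1 unfolding e using T by (simp add: g_bilinear frame_on_ip[OF F p] power2_eq_square)
  have sff': "second_fundamental_form A g n S S' p
      = e * ((ip (nabla S S') E3 p + ip (nabla S' S) E3 p) / 2)"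
    if "vfield U S" "vfield U S'" for S S'
    using that T by (simp add: second_fundamental_form_def e g_bilinear nabla_tangent[OF U])
  note nn = nabla_normal[OF p U]
  let ?x1 = "ip X E1 p" and ?x2 = "ip X E2 p" and ?y1 = "ip Y E1 p" and ?y2 = "ip Y E2 p"
  have "second_fundamental_form A g n X X p * second_fundamental_form A g n Y Y p
      - (second_fundamental_form A g n X Y p)\<^sup>2 = e\<^sup>2 * (?x1 * ?y2 - ?x2 * ?y1)\<^sup>2 * ?k"
    unfolding sff'[OF vX vX] sff'[OF vY vY] sff'[OF vX vY] nn[OF X X] nn[OF X Y] nn[OF Y X] nn[OF Y Y]
    by (simp add: field_simps power2_eq_square)
  then show "k = ?k"
    using frame_gram(2)[OF F p Xs Ys l[rule_format, OF U(2)]]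
    unfolding k frame_gram(1)[OF F p Xs Ys] ee by simp
qed

text \<open>The sectional curvature contains \<open>- h11 * h22 + h12 * h21\<close>, where
  \<open>h\<close> is the normal part of \<open>nabla\<close> on the plane. It is not symmetric:
  \<open>h12 - h21\<close> equals c. Adding the extrinsic curvature leaves -c^2/4, and the
  derivative along the bracket contributes -c^2/2; this is the coefficient -3/4.\<close>

lemma gaussian_curvature_frame:
  assumes p: "p \<in> W"
  shows "gaussian_curvature A g \<xi> p =
    E1 p (ip (bracket E1 E2) E2) - E2 p (ip (bracket E1 E2) E1)
    - (ip (bracket E1 E2) E1 p)\<^sup>2 - (ip (bracket E1 E2) E2 p)\<^sup>2
    + ip (bracket E1 E2) E3 p * (ip (bracket E3 E1) E2 p - ip (bracket E3 E2) E1 p) / 2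
    - 3 / 4 * (ip (bracket E1 E2) E3 p)\<^sup>2"
proof -
  note f = frame_onD[OF F]
  note W = f(1) p
  note T = f(2-4)[THEN vfield_tangent]
  note n = vfield_nabla[OF f(1)] and b = vfield_bracket[OF f(1)]
  note N = nabla_tangent[OF f(1)]
  have const: "E q (ip X Y) = 0"
    if "q \<in> W" "vfield W E" "X \<in> {E1, E2, E3}" "Y \<in> {E1, E2, E3}" for q E X Y
  proof -
    have ET: "E q \<in> tangent q" using that(2,1) by (rule vfield_tangent)
    have "E q (ip X Y) = E q (\<lambda>_. ip X Y q)"
      by (rule tangent_cong[OF ET f(1) that(1)]) (use that frame_on_ip[OF F] in auto)
    then show ?thesis using tangent_const[OF ET] by simp
  qed
  have skew: "ip (nabla E X) Y q = - ip (nabla E Y) X q"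
    if "q \<in> W" "vfield W E" "X \<in> {E1, E2, E3}" "Y \<in> {E1, E2, E3}" for q E X Y
  proof -
    have XY: "vfield W X" "vfield W Y" using that(3,4) f by auto
    show ?thesis
      using nabla_metric[OF f(1) that(1,2) XY] const[OF that]
        g_sym[OF vfield_tangent[OF XY(1) that(1)] N[OF that(1,2) XY(2)]] by simp
  qed
  have self: "ip (nabla E X) X q = 0" if "q \<in> W" "vfield W E" "X \<in> {E1, E2, E3}" for q E X
    using skew[OF that that(3)] by simp
  \<comment> \<open>Inner products of frame fields are constant, so only the three bracket terms of
    the Koszul formula remain.\<close>
  have kz: "2 * ip (nabla X Y) Z q = ip (bracket X Y) Z q - ip (bracket X Z) Y q - ip (bracket Y Z) X q"
    if "q \<in> W" "X \<in> {E1, E2, E3}" "Y \<in> {E1, E2, E3}" "Z \<in> {E1, E2, E3}" for X Y Z q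
  proof -
    have XYZ: "vfield W X" "vfield W Y" "vfield W Z" using that(2-4) f by auto
    show ?thesis
      using koszul_formula[OF f(1) that(1) XYZ] const[OF that(1) XYZ(1) that(3,4)]
        const[OF that(1) XYZ(2) that(4,2)] const[OF that(1) XYZ(3) that(2,3)]
      by (simp add: koszul_def)
  qed
  have flip: "ip (bracket Y X) Z q = - ip (bracket X Y) Z q"
    if "q \<in> W" "vfield W X" "vfield W Y" "vfield W Z" for X Y Z q
    using that bracket_antisym[of Y X q]
    by (simp add: g_bilinear bracket_tangent[OF f(1)] vfield_tangent[OF that(4,1)])
  have self0: "ip (bracket X X) Z q = 0" if "q \<in> W" "vfield W Z" for X Z q
    by (simp add: bracket_self g_bilinear vfield_tangent[OF that(2,1)])
  let ?a = "ip (bracket E1 E2) E1" and ?b = "ip (bracket E1 E2) E2" and ?c = "ip (bracket E1 E2) E3"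
  let ?d = "ip (bracket E3 E1) E2 p - ip (bracket E3 E2) E1 p"
  have w1: "ip (nabla E1 E2) E1 q = ?a q" if q: "q \<in> W" for q
    using kz[OF q, of E1 E2 E1] flip[OF q f(2,3,2)] self0[OF q f(3)] by simp
  have w2: "ip (nabla E2 E2) E1 q = ?b q" if q: "q \<in> W" for q
    using kz[OF q, of E2 E2 E1] flip[OF q f(2,3,3)] self0[OF q f(2)] by simp
  have w3: "ip (nabla E3 E2) E1 p = (?c p - ?d) / 2"
    using kz[OF p, of E3 E2 E1] flip[OF p f(2,3,4)] by simp
  have N1: "nabla E1 E2 p \<in> tangent p" "nabla E2 E2 p \<in> tangent p" "nabla E1 E1 p \<in> tangent p"
    "nabla E2 E1 p \<in> tangent p" "nabla E3 E2 p \<in> tangent p"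
    using N[OF p] f by auto
  note T1 = T[OF p]
  let ?h11 = "ip (nabla E1 E1) E3 p" and ?h12 = "ip (nabla E1 E2) E3 p"
  let ?h21 = "ip (nabla E2 E1) E3 p" and ?h22 = "ip (nabla E2 E2) E3 p"
  have 1: "g p (nabla E1 (nabla E2 E2) p) (E1 p) = E1 p ?b - ?h11 * ?h22"
  proof -
    have "E1 p ?b = E1 p (ip (nabla E2 E2) E1)"
      by (rule tangent_cong[OF T1(1) W]) (simp add: w2)
    also have "\<dots> = g p (nabla E1 (nabla E2 E2) p) (E1 p) + g p (nabla E2 E2 p) (nabla E1 E1 p)"
      by (rule nabla_metric[OF W f(2) n[OF f(3,3)] f(2)])
    also have "g p (nabla E2 E2 p) (nabla E1 E1 p) = ?h11 * ?h22"
      using self[OF p f(2), of E1] self[OF p f(3), of E2]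
      by (simp add: g_frame[OF F p N1(2,3)])
    finally show ?thesis by simp
  qed
  have 2: "g p (nabla E2 (nabla E1 E2) p) (E1 p) = E2 p ?a - ?h12 * ?h21"
  proof -
    have "E2 p ?a = E2 p (ip (nabla E1 E2) E1)"
      by (rule tangent_cong[OF T1(2) W]) (simp add: w1)
    also have "\<dots> = g p (nabla E2 (nabla E1 E2) p) (E1 p) + g p (nabla E1 E2 p) (nabla E2 E1 p)"
      by (rule nabla_metric[OF W f(3) n[OF f(2,3)] f(2)])
    also have "g p (nabla E1 E2 p) (nabla E2 E1 p) = ?h12 * ?h21"
      using self[OF p f(3), of E1] self[OF p f(2), of E2]
      by (simp add: g_frame[OF F p N1(1,4)])
    finally show ?thesis by simp
  qed
  \<comment> \<open>The direction \<open>[E1, E2]\<close> is expanded in the frame, and each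
    coefficient meets the connection coefficient \<open>w1\<close>, \<open>w2\<close> or
    \<open>w3\<close>.\<close>
  have 3: "g p (nabla (bracket E1 E2) E2 p) (E1 p) = (?a p)\<^sup>2 + (?b p)\<^sup>2 + ?c p * (?c p - ?d) / 2"
    using T1 N1 unfolding nabla_frame_left[OF W b[OF f(2,3)] f(3) F p]
    by (simp add: g_bilinear w1[OF p] w2[OF p] w3 power2_eq_square)
  have K: "sectional_curvature A g p (\<xi> p) = E1 p ?b - ?h11 * ?h22 - (E2 p ?a - ?h12 * ?h21)
    - ((?a p)\<^sup>2 + (?b p)\<^sup>2 + ?c p * (?c p - ?d) / 2)"
    unfolding \<xi>[OF p] sectional_curvature_frame[OF F p] curv_apply 1[symmetric] 2[symmetric] 3[symmetric]
    using T1 N[OF p] n b f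
    by (simp add: g_bilinear nabla_tangent[OF W] vfield_tangent)
  have c: "?h12 - ?h21 = ?c p"
    using nabla_torsion[OF W f(2,3)] T1 N1 by (simp add: g_bilinear)
  have "?h12 * ?h21 - ((?h12 + ?h21) / 2)\<^sup>2 = - ((?h12 - ?h21)\<^sup>2 / 4)"
    by (simp add: field_simps power2_eq_square)
  then show ?thesis
    unfolding gaussian_curvature_def K extrinsic_curvature_frame[OF p] c
    by (simp add: field_simps power2_eq_square)
qed

end

end

section \<open>Orthonormalisation\<close>

context riemannian
begin

lemma normalize:
  assumes W: "open W" and X: "vfield W X" and nz: "\<And>q. q \<in> W \<Longrightarrow> X q \<noteq> 0"
  obtains E r where "vfield W E" and "\<And>q. q \<in> W \<Longrightarrow> ip E E q = 1"
    and "\<And>q. q \<in> W \<Longrightarrow> X q = r q *\<^sub>R E q" and "\<And>q. q \<in> W \<Longrightarrow> r q \<noteq> 0"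
proof
  let ?r = "\<lambda>q. sqrt (ip X X q)"
  have T: "X q \<in> tangent q" if "q \<in> W" for q using X that by (rule vfield_tangent)
  have pos: "0 < ip X X q" if "q \<in> W" for q using g_pos[OF T nz] that by blast
  have nz': "?r q \<noteq> 0" if "q \<in> W" for q using pos[OF that] by simp
  have sm: "smooth_fun W (\<lambda>q. 1 / ?r q)"
    by (intro smooth_fun_divide smooth_fun_const smooth_fun_sqrt ip_smooth W X pos nz')
  show "vfield W (\<lambda>q. (1 / ?r q) *\<^sub>R X q)"
    by (rule vfield_scaleR[OF sm X])
  show "g q ((1 / ?r q) *\<^sub>R X q) ((1 / ?r q) *\<^sub>R X q) = 1" if "q \<in> W" for q
    using T[OF that] pos[OF that] by (simp add: g_bilinear)
  show "X q = ?r q *\<^sub>R ((1 / ?r q) *\<^sub>R X q)" "?r q \<noteq> 0" if "q \<in> W" for q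
    using pos[OF that] by auto
qed

text \<open>The hypothesis \<open>sp\<close> says that \<open>V\<close> together with the plane
  spans the tangent space; it becomes the expansion clause of \<open>frame_on\<close>. The plane is
  preserved because \<open>V\<close> enters only in the third vector.\<close>

lemma gram_schmidt_frame:
  assumes U: "open U" and S: "vfield U S" and T: "vfield U T" and V: "vfield U V"
    and li: "\<And>q. q \<in> U \<Longrightarrow> lin_indep2 (S q) (T q)"
    and ni: "\<And>q. q \<in> U \<Longrightarrow> V q \<notin> span {S q, T q}"
    and sp: "\<And>q v. q \<in> U \<Longrightarrow> v \<in> tangent q \<Longrightarrow> \<exists>c. v - c *\<^sub>R V q \<in> span {S q, T q}"
  obtains E1 E2 E3 where "frame_on U E1 E2 E3" and "\<And>q. q \<in> U \<Longrightarrow> span {E1 q, E2 q} = span {S q, T q}"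
proof -
  have TT: "S q \<in> tangent q" "T q \<in> tangent q" "V q \<in> tangent q" if "q \<in> U" for q
    using that S T V by (auto intro: vfield_tangent)
  have li': "a = 0 \<and> b = 0" if "q \<in> U" "a *\<^sub>R S q + b *\<^sub>R T q = 0" for q a b
    using li[OF that(1)] that(2) by (simp add: lin_indep2_iff)
  have "S q \<noteq> 0" if "q \<in> U" for q
    using li'[OF that, of 1 0] by auto
  then obtain E1 r1 where E1: "vfield U E1" and E11: "\<And>q. q \<in> U \<Longrightarrow> ip E1 E1 q = 1"
    and S1: "\<And>q. q \<in> U \<Longrightarrow> S q = r1 q *\<^sub>R E1 q" and r1: "\<And>q. q \<in> U \<Longrightarrow> r1 q \<noteq> 0"
    using normalize[OF U S] by blast
  have T1: "E1 q \<in> tangent q" if "q \<in> U" for q using E1 that by (rule vfield_tangent)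
  let ?T = "\<lambda>q. T q - ip T E1 q *\<^sub>R E1 q"
  have vT: "vfield U ?T"
    by (intro vfield_diff vfield_scaleR ip_smooth U T E1)
  have "?T q \<noteq> 0" if q: "q \<in> U" for q
  proof
    assume "?T q = 0"
    then have "(- ip T E1 q / r1 q) *\<^sub>R S q + 1 *\<^sub>R T q = 0"
      using S1[OF q] r1[OF q] by simp
    from li'[OF q this] show False by simp
  qed
  then obtain E2 r2 where E2: "vfield U E2" and E22: "\<And>q. q \<in> U \<Longrightarrow> ip E2 E2 q = 1"
    and T2: "\<And>q. q \<in> U \<Longrightarrow> ?T q = r2 q *\<^sub>R E2 q" and r2: "\<And>q. q \<in> U \<Longrightarrow> r2 q \<noteq> 0"
    using normalize[OF U vT] by blast
  have TE2: "E2 q \<in> tangent q" if "q \<in> U" for q using E2 that by (rule vfield_tangent)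
  have E12: "ip E2 E1 q = 0" if q: "q \<in> U" for q
  proof -
    have "r2 q * ip E2 E1 q = g q (?T q) (E1 q)"
      using T2[OF q] TE2[OF q] T1[OF q] by (simp add: g_bilinear)
    also have "\<dots> = 0"
      using TT[OF q] T1[OF q] E11[OF q] by (simp add: g_bilinear)
    finally show ?thesis using r2[OF q] by simp
  qed
  have T_eq: "T q = ip T E1 q *\<^sub>R E1 q + r2 q *\<^sub>R E2 q" if "q \<in> U" for q
    using T2[OF that] by (simp add: algebra_simps)
  have span: "span {E1 q, E2 q} = span {S q, T q}" if q: "q \<in> U" for q
  proof -
    have e1: "E1 q = (1 / r1 q) *\<^sub>R S q"
      using S1[OF q] r1[OF q] by simp
    have e2: "E2 q = (1 / r2 q) *\<^sub>R (T q - ip T E1 q *\<^sub>R E1 q)"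
      using T2[OF q] r2[OF q] by simp
    have m: "S q \<in> span {S q, T q}" "T q \<in> span {S q, T q}"
      "E1 q \<in> span {E1 q, E2 q}" "E2 q \<in> span {E1 q, E2 q}"
      by (auto intro: span_base)
    have "E1 q \<in> span {S q, T q}"
      unfolding e1 by (intro span_scale m)
    moreover from this have "E2 q \<in> span {S q, T q}"
      unfolding e2 by (intro span_scale span_diff m)
    moreover have "S q \<in> span {E1 q, E2 q}"
      unfolding S1[OF q] by (intro span_scale m)
    moreover have "T q \<in> span {E1 q, E2 q}"
      by (subst T_eq[OF q]) (intro span_add span_scale m)
    ultimately show ?thesis
      by (simp add: span_eq)
  qed
  let ?V = "\<lambda>q. V q - ip V E1 q *\<^sub>R E1 q - ip V E2 q *\<^sub>R E2 q"
  have vV: "vfield U ?V"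
    by (intro vfield_diff vfield_scaleR ip_smooth U V E1 E2)
  have in_span: "a *\<^sub>R E1 q + b *\<^sub>R E2 q \<in> span {S q, T q}" if "q \<in> U" for a b q
    unfolding span[OF that, symmetric] by (auto simp: span_pair)
  have "?V q \<noteq> 0" if q: "q \<in> U" for q
  proof
    assume "?V q = 0"
    then have "V q = ip V E1 q *\<^sub>R E1 q + ip V E2 q *\<^sub>R E2 q"
      by (simp add: algebra_simps)
    with in_span[OF q] ni[OF q] show False by metis
  qed
  then obtain E3 r3 where E3: "vfield U E3" and E33: "\<And>q. q \<in> U \<Longrightarrow> ip E3 E3 q = 1"
    and V3: "\<And>q. q \<in> U \<Longrightarrow> ?V q = r3 q *\<^sub>R E3 q" and r3: "\<And>q. q \<in> U \<Longrightarrow> r3 q \<noteq> 0"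
    using normalize[OF U vV] by blast
  have TE3: "E3 q \<in> tangent q" if "q \<in> U" for q using E3 that by (rule vfield_tangent)
  have E13: "ip E1 E2 q = 0" "ip E3 E1 q = 0" "ip E3 E2 q = 0" "ip E1 E3 q = 0" "ip E2 E3 q = 0"
    if q: "q \<in> U" for q
  proof -
    note t = TT[OF q] T1[OF q] TE2[OF q] TE3[OF q]
    show 12: "ip E1 E2 q = 0" using E12[OF q] g_sym t by simp
    have "r3 q * ip E3 E1 q = g q (?V q) (E1 q)" "r3 q * ip E3 E2 q = g q (?V q) (E2 q)"
      unfolding V3[OF q] using t by (simp_all add: g_bilinear)
    moreover have "g q (?V q) (E1 q) = 0" "g q (?V q) (E2 q) = 0"
      using t E11[OF q] E12[OF q] E22[OF q] 12 by (simp_all add: g_bilinear)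
    ultimately show "ip E3 E1 q = 0" "ip E3 E2 q = 0" using r3[OF q] by simp_all
    then show "ip E1 E3 q = 0" "ip E2 E3 q = 0"
      using g_sym t by simp_all
  qed
  have exp: "v = g q v (E1 q) *\<^sub>R E1 q + g q v (E2 q) *\<^sub>R E2 q + g q v (E3 q) *\<^sub>R E3 q"
    if q: "q \<in> U" and v: "v \<in> tangent q" for q v
  proof -
    note t = T1[OF q] TE2[OF q] TE3[OF q]
    obtain c where "v - c *\<^sub>R V q \<in> span {E1 q, E2 q}"
      using sp[OF q v] unfolding span[OF q] by blast
    then obtain a b where ab: "v - c *\<^sub>R V q = a *\<^sub>R E1 q + b *\<^sub>R E2 q"
      unfolding span_pair by blast
    have Vq: "V q = ip V E1 q *\<^sub>R E1 q + ip V E2 q *\<^sub>R E2 q + r3 q *\<^sub>R E3 q"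
      using V3[OF q] by (simp add: algebra_simps)
    have "v = a *\<^sub>R E1 q + b *\<^sub>R E2 q + c *\<^sub>R V q"
      using ab by (metis diff_add_cancel)
    also have "\<dots> = (a + c * ip V E1 q) *\<^sub>R E1 q + (b + c * ip V E2 q) *\<^sub>R E2 q + (c * r3 q) *\<^sub>R E3 q"
      by (subst Vq) (simp add: scaleR_add_left scaleR_add_right)
    finally obtain x y z where xyz: "v = x *\<^sub>R E1 q + y *\<^sub>R E2 q + z *\<^sub>R E3 q"
      by blast
    have "g q v (E1 q) = x" "g q v (E2 q) = y" "g q v (E3 q) = z"
      unfolding xyz using t E11[OF q] E22[OF q] E33[OF q] E12[OF q] E13[OF q]
      by (simp_all add: g_bilinear)
    then show ?thesis using xyz by simp
  qed
  have "frame_on U E1 E2 E3"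
    unfolding frame_on_def using U E1 E2 E3 E11 E22 E33 E13 exp by blast
  then show ?thesis using that span by blast
qed

end

section \<open>Contact structures\<close>

locale contact_manifold = smooth_manifold +
  fixes \<xi> :: "'a \<Rightarrow> 'a tvec set" and \<alpha> :: "'a \<Rightarrow> 'a tvec \<Rightarrow> real"
  assumes contact: "contact_structure A \<xi>" and one_form: "one_form A \<alpha>"
    and kernel: "\<And>p. \<xi> p = {v \<in> tangent p. \<alpha> p v = 0}"
begin

lemma form_lincomb:
  "u \<in> tangent p \<Longrightarrow> v \<in> tangent p \<Longrightarrow> \<alpha> p (a *\<^sub>R u + b *\<^sub>R v) = a * \<alpha> p u + b * \<alpha> p v"
  using conjunct1[OF one_form[unfolded one_form_def]] by blast

lemma form_smooth: "open U \<Longrightarrow> vfield U X \<Longrightarrow> smooth_fun U (\<lambda>q. \<alpha> q (X q))"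
  using conjunct2[OF one_form[unfolded one_form_def]] by blast

lemma form_add: "u \<in> tangent p \<Longrightarrow> v \<in> tangent p \<Longrightarrow> \<alpha> p (u + v) = \<alpha> p u + \<alpha> p v"
  using form_lincomb[of u p v 1 1] by simp

lemma form_scaleR: "u \<in> tangent p \<Longrightarrow> \<alpha> p (a *\<^sub>R u) = a * \<alpha> p u"
  using form_lincomb[of u p u a 0] by simp

lemma contact_frame:
  obtains U S T where "open U" and "p \<in> U" and "vfield U S" and "vfield U T"
    and "\<forall>q\<in>U. lin_indep2 (S q) (T q) \<and> \<xi> q = span {S q, T q} \<and> bracket S T q \<notin> \<xi> q"
proof -
  have "distribution A \<xi>" using contact by (simp add: contact_structure_def)
  from this[unfolded distribution_def, THEN spec[of _ p]]
  obtain U S T where U: "open U" "p \<in> U" "vfield U S" "vfield U T"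
    and st: "\<forall>q\<in>U. lin_indep2 (S q) (T q) \<and> \<xi> q = span {S q, T q}"
    by (elim exE conjE)
  have sec: "section_on A \<xi> U S" "section_on A \<xi> U T"
    using U st by (auto simp: section_on_def intro: span_base)
  have "\<forall>q\<in>U. lin_indep2 (S q) (T q)" using st by blast
  with conjunct2[OF contact[unfolded contact_structure_def], rule_format, OF U(1) sec]
  have "\<And>q. q \<in> U \<Longrightarrow> bracket S T q \<notin> \<xi> q" by blast
  then show ?thesis using that[OF U] st by blast
qed

text \<open>A local function \<open>f\<close> is replaced by the two global ones \<open>\<rho>\<close> and \<open>\<rho> f\<close> with a bump function
  \<open>\<rho>\<close>: where \<open>\<rho> \<noteq> 0\<close>, a tangent vector that annihilates both also annihilates \<open>f\<close>.\<close>
lemma separating_functions: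
  obtains N \<F> where "open N" and "p \<in> N" and "finite \<F>" and "\<And>F. F \<in> \<F> \<Longrightarrow> smooth_fun UNIV F"
    and "\<And>q u. q \<in> N \<Longrightarrow> u \<in> \<xi> q \<Longrightarrow> (\<forall>F\<in>\<F>. u F = 0) \<Longrightarrow> u = 0"
proof -
  obtain U S T where U: "open U" "p \<in> U" and S: "vfield U S" and T: "vfield U T"
    and ST: "\<forall>q\<in>U. lin_indep2 (S q) (T q) \<and> \<xi> q = span {S q, T q} \<and> bracket S T q \<notin> \<xi> q"
    by (rule contact_frame)
  have li: "lin_indep2 (S q) (T q)" and \<xi>: "\<xi> q = span {S q, T q}" if "q \<in> U" for q
    using ST that by blast+
  note Tp = vfield_tangent[OF S U(2)] vfield_tangent[OF T U(2)]
  have "S p \<noteq> 0"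
    using li[OF U(2)] by (auto simp: lin_indep2_def dependent_zero)
  then obtain f1 where f1: "S p f1 \<noteq> 0" by (auto simp: fun_eq_iff)
  \<comment> \<open>\<open>T p\<close> corrected so that it annihilates \<open>f1\<close>. The
    determinant below then equals \<open>S p f1 * ?w f2\<close> at \<open>p\<close>, hence any
    \<open>f2\<close> detected by \<open>?w\<close> makes it nonzero.\<close>
  let ?w = "T p - (T p f1 / S p f1) *\<^sub>R S p"
  have "?w \<noteq> 0"
  proof
    assume "?w = 0"
    then have "(- (T p f1 / S p f1)) *\<^sub>R S p + 1 *\<^sub>R T p = 0"
      by simp
    then show False using li[OF U(2)] unfolding lin_indep2_iff by (metis zero_neq_one)
  qed
  then obtain f2 where f2: "?w f2 \<noteq> 0" by (auto simp: fun_eq_iff)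
  have "smooth_near A p f1" "smooth_near A p f2"
    using tangent_not_smooth[OF Tp(1)] tangent_not_smooth[OF Tp(2)] f1 f2 by fastforce+
  then obtain W0 where W0: "open W0" "p \<in> W0" "smooth_fun W0 f1" "smooth_fun W0 f2"
    by (rule smooth_near2)
  define W where "W = U \<inter> W0"
  have W: "open W" "p \<in> W" "W \<subseteq> U" "smooth_fun W f1" "smooth_fun W f2"
    using U W0 smooth_fun_subset[OF _ Int_lower2] by (auto simp: W_def)
  let ?det = "\<lambda>q. S q f1 * T q f2 - S q f2 * T q f1"
  have det: "smooth_fun W ?det"
    by (intro smooth_fun_diff smooth_fun_mult W vfield_smooth[OF S] vfield_smooth[OF T])
  have "?det p \<noteq> 0"
    using f1 f2 by (auto simp: field_simps)
  obtain \<rho> K where \<rho>: "smooth_fun UNIV \<rho>" "0 < \<rho> p" and K: "closed K" "K \<subseteq> W"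
    and zero: "\<And>q. q \<notin> K \<Longrightarrow> \<rho> q = 0"
    using bump_function[OF W(1,2)] by blast
  define N where "N = {q \<in> W. ?det q \<noteq> 0} \<inter> {q \<in> UNIV. \<rho> q \<noteq> 0}"
  let ?\<F> = "{\<rho>, \<lambda>q. \<rho> q * f1 q, \<lambda>q. \<rho> q * f2 q}"
  show ?thesis
  proof
    show "open N"
      unfolding N_def using smooth_fun_open_nonzero[OF W(1) det] smooth_fun_open_nonzero[OF open_UNIV \<rho>(1)]
      by (rule open_Int)
    show "p \<in> N" using W(2) \<open>?det p \<noteq> 0\<close> \<rho>(2) by (simp add: N_def)
    show "finite ?\<F>" by simp
    show "smooth_fun UNIV F" if "F \<in> ?\<F>" for F
      using that \<rho>(1) smooth_fun_extend_zero[OF W(1) \<rho>(1) K zero] W(4,5) by auto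
    fix q u assume q: "q \<in> N" and u: "u \<in> \<xi> q" and 0: "\<forall>F\<in>?\<F>. u F = 0"
    have qW: "q \<in> W" "q \<in> U" "?det q \<noteq> 0" "\<rho> q \<noteq> 0"
      using q W(3) by (auto simp: N_def)
    have uT: "u \<in> tangent q" using u kernel by auto
    have "u f = 0" if "f \<in> {f1, f2}" for f
    proof -
      have "u (\<lambda>q. \<rho> q * f q) = \<rho> q * u f + f q * u \<rho>"
        using that by (intro tangent_mult[OF uT] smooth_nearI[OF open_UNIV _ \<rho>(1)]
            smooth_nearI[OF W(1) qW(1)]) (use W in auto)
      then show ?thesis using that 0 qW(4) by auto
    qed
    moreover obtain x y where u_eq: "u = x *\<^sub>R S q + y *\<^sub>R T q"
      using u \<xi>[OF qW(2)] by (auto simp: span_pair)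
    ultimately have e: "x * S q f1 + y * T q f1 = 0" "x * S q f2 + y * T q f2 = 0"
      by auto
    \<comment> \<open>Cramer's rule for the two linear equations in \<open>x\<close> and
      \<open>y\<close>.\<close>
    have "x * ?det q = (x * S q f1 + y * T q f1) * T q f2 - (x * S q f2 + y * T q f2) * T q f1"
      "y * ?det q = (x * S q f2 + y * T q f2) * S q f1 - (x * S q f1 + y * T q f1) * S q f2"
      by (simp_all add: algebra_simps)
    then have "x = 0" "y = 0"
      using qW(3) unfolding e by auto
    then show "u = 0" using u_eq by simp
  qed
qed

text \<open>Compactness reduces the separating functions to one finite family. The sum of their
  squared differentials is definite on \<xi>, and the square of \<alpha> takes care of the vectors
  outside its kernel; no local metrics have to be glued.\<close>

lemma metric_exists:
  assumes "compact (UNIV :: 'a set)"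
  obtains g where "riemannian_metric A g"
proof -
  define good where "good N \<F> \<longleftrightarrow> open N \<and> finite \<F> \<and> (\<forall>F\<in>\<F>. smooth_fun UNIV F) \<and>
    (\<forall>q\<in>N. \<forall>u\<in>\<xi> q. (\<forall>F\<in>\<F>. u F = 0) \<longrightarrow> u = 0)" for N and \<F> :: "('a \<Rightarrow> real) set"
  have "\<exists>N \<F>. p \<in> N \<and> good N \<F>" for p
  proof (rule separating_functions[of p])
    fix N \<F> assume "open N" "p \<in> N" "finite \<F>" "\<And>F. F \<in> \<F> \<Longrightarrow> smooth_fun UNIV F"
      and "\<And>q u. q \<in> N \<Longrightarrow> u \<in> \<xi> q \<Longrightarrow> (\<forall>F\<in>\<F>. u F = 0) \<Longrightarrow> u = 0"
    then have "p \<in> N \<and> good N \<F>" unfolding good_def by blast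
    then show ?thesis by blast
  qed
  then obtain N \<F> where N: "\<And>p. p \<in> N p" and good: "\<And>p. good (N p) (\<F> p)"
    by metis
  have "UNIV \<subseteq> (\<Union>p\<in>UNIV. N p)" using N by auto
  then obtain C where C: "finite C" "UNIV \<subseteq> (\<Union>p\<in>C. N p)"
    using compactE_image[OF assms, of UNIV N] good by (auto simp: good_def)
  define \<G> where "\<G> = (\<Union>p\<in>C. \<F> p)"
  have fin: "finite \<G>" and sm: "\<And>F. F \<in> \<G> \<Longrightarrow> smooth_fun UNIV F"
    using C good by (auto simp: \<G>_def good_def)
  have sep: "u = 0" if "u \<in> \<xi> q" "\<forall>F\<in>\<G>. u F = 0" for q u
    using that C(2) good unfolding \<G>_def good_def by blast
  define g :: "'a metric" where "g p u v = \<alpha> p u * \<alpha> p v + (\<Sum>F\<in>\<G>. u F * v F)" for p u v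
  have lin: "g p (a *\<^sub>R u + b *\<^sub>R v) w = a * g p u w + b * g p v w"
    if "u \<in> tangent p" "v \<in> tangent p" for p u v w a b
    using that by (simp add: g_def form_lincomb distrib_left distrib_right sum.distrib
        sum_distrib_left mult.assoc)
  have pos: "0 < g p v v" if v: "v \<in> tangent p" and "v \<noteq> 0" for p v
  proof (rule ccontr)
    assume "\<not> 0 < g p v v"
    moreover have S: "0 \<le> (\<Sum>F\<in>\<G>. v F * v F)" by (simp add: sum_nonneg)
    ultimately have "\<alpha> p v * \<alpha> p v = 0" "(\<Sum>F\<in>\<G>. v F * v F) = 0"
      unfolding g_def by (smt (verit) zero_le_square)+
    then have "v \<in> \<xi> p" "\<forall>F\<in>\<G>. v F = 0"
      using v kernel fin by (auto simp: sum_nonneg_eq_0_iff)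
    then show False using sep that(2) by blast
  qed
  have smooth: "smooth_fun U (\<lambda>q. g q (X q) (Y q))"
    if U: "open U" and X: "vfield U X" and Y: "vfield U Y" for U X Y
  proof -
    have "smooth_fun U F" if "F \<in> \<G>" for F
      by (rule smooth_fun_subset[OF sm[OF that]]) simp
    then have "smooth_fun U (\<lambda>q. X q F)" "smooth_fun U (\<lambda>q. Y q F)" if "F \<in> \<G>" for F
      using that by (auto intro: vfield_smooth[OF X U] vfield_smooth[OF Y U])
    then show ?thesis
      unfolding g_def
      by (intro smooth_fun_add smooth_fun_mult smooth_fun_sum form_smooth U X Y)
  qed
  have "riemannian_metric A g"
    unfolding riemannian_metric_def using lin pos smooth by (simp add: g_def mult.commute)
  then show ?thesis by (rule that)
qed

end

lemma cancel_square: "0 < r \<Longrightarrow> x * r\<^sup>2 / (t * r) = x * r / (t :: real)"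
  by (simp add: power2_eq_square)

locale contact_metric = contact_manifold + riemannian
begin

lemma adapted_frame:
  obtains W E1 E2 E3 where "p \<in> W" and "frame_on W E1 E2 E3"
    and "\<forall>q\<in>W. \<xi> q = span {E1 q, E2 q}"
    and "\<forall>q\<in>W. bracket E1 E2 q \<notin> \<xi> q"
proof -
  obtain U S T where U: "open U" "p \<in> U" and S: "vfield U S" and T: "vfield U T"
    and ST: "\<forall>q\<in>U. lin_indep2 (S q) (T q) \<and> \<xi> q = span {S q, T q} \<and> bracket S T q \<notin> \<xi> q"
    by (rule contact_frame)
  let ?V = "bracket S T"
  have V: "vfield U ?V" by (rule vfield_bracket[OF U(1) S T])
  have trans: "\<exists>c. v - c *\<^sub>R ?V q \<in> span {S q, T q}" if q: "q \<in> U" and v: "v \<in> tangent q" for q v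
  proof -
    have VT: "?V q \<in> tangent q" using V q by (rule vfield_tangent)
    then have "\<alpha> q (?V q) \<noteq> 0" using ST q kernel by auto
    \<comment> \<open>The coefficient of the bracket is chosen such that \<alpha> vanishes, which
      puts the difference into \<xi>.\<close>
    then have "\<alpha> q (1 *\<^sub>R v + (- (\<alpha> q v / \<alpha> q (?V q))) *\<^sub>R ?V q) = 0"
      by (simp only: form_lincomb[OF v VT]) simp
    then have "v - (\<alpha> q v / \<alpha> q (?V q)) *\<^sub>R ?V q \<in> \<xi> q"
      using v VT by (simp add: kernel)
    then show ?thesis using ST q by blast
  qed
  obtain E1 E2 E3 where F: "frame_on U E1 E2 E3"
    and sp: "\<And>q. q \<in> U \<Longrightarrow> span {E1 q, E2 q} = span {S q, T q}"
    by (rule gram_schmidt_frame[OF U(1) S T V _ _ trans]) (use ST in auto)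
  have \<xi>: "\<forall>q\<in>U. \<xi> q = span {E1 q, E2 q}" using ST sp by simp
  note f = frame_onD[OF F]
  have sec: "section_on A \<xi> U E1" "section_on A \<xi> U E2"
    using f \<xi> by (auto simp: section_on_def intro: span_base)
  have "\<forall>q\<in>U. lin_indep2 (E1 q) (E2 q)" using frame_span(2)[OF F] by blast
  \<comment> \<open>The contact condition is used again for the orthonormal pair: it will mean that
    the \<open>E3\<close> component of its bracket is nonzero.\<close>
  with conjunct2[OF contact[unfolded contact_structure_def], rule_format, OF U(1) sec]
  have "\<forall>q\<in>U. bracket E1 E2 q \<notin> \<xi> q" by blast
  then show ?thesis using that[OF U(2) F \<xi>] by blast
qed

section \<open>Stretched metrics\<close>

definition stretched :: "real \<Rightarrow> ('a \<Rightarrow> real) \<Rightarrow> 'a metric"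
  where "stretched s f p u v = s\<^sup>2 * g p u v + f p * \<alpha> p u * \<alpha> p v"

context
  fixes s :: real and f :: "'a \<Rightarrow> real"
  assumes s: "0 < s" and f: "smooth_fun UNIV f" and f_nonneg: "\<And>p. 0 \<le> f p"
begin

lemma riemannian_stretched: "riemannian A (stretched s f)"
proof unfold_locales
  have pos: "0 < stretched s f p v v" if "v \<in> tangent p" "v \<noteq> 0" for p v
  proof -
    have "0 < s\<^sup>2 * g p v v" using g_pos[OF that] s by simp
    moreover have "0 \<le> f p * (\<alpha> p v * \<alpha> p v)" using f_nonneg by simp
    ultimately show ?thesis by (simp add: stretched_def mult.assoc)
  qed
  have lin: "stretched s f p (a *\<^sub>R u + b *\<^sub>R v) w = a * stretched s f p u w + b * stretched s f p v w"
    if "u \<in> tangent p" "v \<in> tangent p" "w \<in> tangent p" for p u v w a b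
    using that by (simp add: stretched_def form_lincomb g_lincomb) (simp add: algebra_simps)
  have sym: "stretched s f p u v = stretched s f p v u"
    if "u \<in> tangent p" "v \<in> tangent p" for p u v
    using g_sym[OF that] by (simp add: stretched_def)
  have smooth: "smooth_fun U (\<lambda>q. stretched s f q (X q) (Y q))"
    if "open U" "vfield U X" "vfield U Y" for U X Y
    unfolding stretched_def
    by (intro smooth_fun_add smooth_fun_mult smooth_fun_const ip_smooth form_smooth that
        smooth_fun_subset[OF f subset_UNIV])
  show "riemannian_metric A (stretched s f)"
    unfolding riemannian_metric_def
    by (intro conjI allI ballI impI lin sym pos smooth)
qed

context
  fixes W :: "'a set" and E1 E2 E3 :: "'a vfield"
  assumes F: "frame_on W E1 E2 E3" and plane: "\<forall>q\<in>W. \<xi> q = span {E1 q, E2 q}"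
begin

private lemmas \<xi> = plane[rule_format]

text \<open>The length of \<open>E3\<close> in the stretched metric.\<close>

abbreviation (input) normal_length :: "'a \<Rightarrow> real"
  where "normal_length q \<equiv> sqrt (s\<^sup>2 + f q * (\<alpha> q (E3 q))\<^sup>2)"

lemma normal_length_pos: "0 < normal_length q"
  using s f_nonneg[of q] by (intro real_sqrt_gt_zero add_pos_nonneg) auto

lemma normal_length_square: "(normal_length q)\<^sup>2 = s\<^sup>2 + f q * (\<alpha> q (E3 q))\<^sup>2"
  using s f_nonneg[of q] by simp

lemma smooth_normal_length: "smooth_fun W (\<lambda>q. 1 / normal_length q)"
proof (intro smooth_fun_divide smooth_fun_const smooth_fun_sqrt)
  show W: "open W" "open W" using frame_onD(1)[OF F] by auto
  show "smooth_fun W (\<lambda>q. s\<^sup>2 + f q * (\<alpha> q (E3 q))\<^sup>2)"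
    unfolding power2_eq_square
    by (intro smooth_fun_add smooth_fun_mult smooth_fun_const W form_smooth frame_onD(4)[OF F]
        smooth_fun_subset[OF f subset_UNIV])
  show "0 < s\<^sup>2 + f q * (\<alpha> q (E3 q))\<^sup>2" for q
    using normal_length_pos[of q] by simp
  show "normal_length q \<noteq> 0" for q
    using normal_length_pos[of q] by linarith
qed

text \<open>Up to the factor \<alpha>(E3), the form is dual to \<open>E3\<close>. This is why the
  stretched metric remains diagonal in the old frame.\<close>

lemma form_frame:
  assumes q: "q \<in> W"
  shows "\<alpha> q (E1 q) = 0" and "\<alpha> q (E2 q) = 0"
    and "v \<in> tangent q \<Longrightarrow> \<alpha> q v = g q v (E3 q) * \<alpha> q (E3 q)"
proof -
  note f = frame_onD[OF F]
  note T = f(2-4)[THEN vfield_tangent, OF q]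
  have "E1 q \<in> \<xi> q" "E2 q \<in> \<xi> q" using \<xi>[OF q] by (auto intro: span_base)
  then show 0: "\<alpha> q (E1 q) = 0" "\<alpha> q (E2 q) = 0" by (auto simp: kernel)
  assume v: "v \<in> tangent q"
  have "\<alpha> q v = \<alpha> q (g q v (E1 q) *\<^sub>R E1 q + g q v (E2 q) *\<^sub>R E2 q + g q v (E3 q) *\<^sub>R E3 q)"
    using f(5)[OF q v] by simp
  then show "\<alpha> q v = g q v (E3 q) * \<alpha> q (E3 q)"
    using T 0 by (simp add: form_add form_scaleR)
qed

lemma stretched_frame:
  "riemannian.frame_on A (stretched s f) W (\<lambda>q. (1 / s) *\<^sub>R E1 q) (\<lambda>q. (1 / s) *\<^sub>R E2 q)
    (\<lambda>q. (1 / normal_length q) *\<^sub>R E3 q)"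
proof -
  interpret G: riemannian A "stretched s f" by (rule riemannian_stretched)
  note F' = frame_onD[OF F]
  have T: "E1 q \<in> tangent q" "E2 q \<in> tangent q" "E3 q \<in> tangent q" if "q \<in> W" for q
    using that F'(2-4) by (auto intro: vfield_tangent)
  \<comment> \<open>Computing the pairings with an arbitrary \<open>v\<close> serves both the
    orthonormality relations and the expansion clause.\<close>
  have sE: "stretched s f q v ((1 / s) *\<^sub>R E1 q) = s * g q v (E1 q)"
    "stretched s f q v ((1 / s) *\<^sub>R E2 q) = s * g q v (E2 q)"
    "stretched s f q v ((1 / normal_length q) *\<^sub>R E3 q) = g q v (E3 q) * normal_length q"
    if q: "q \<in> W" and v: "v \<in> tangent q" for q v
  proof -
    show "stretched s f q v ((1 / s) *\<^sub>R E1 q) = s * g q v (E1 q)"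
      "stretched s f q v ((1 / s) *\<^sub>R E2 q) = s * g q v (E2 q)"
      using T[OF q] v s
      by (simp_all add: stretched_def g_bilinear form_scaleR form_frame(1,2)[OF q] power2_eq_square)
    have "stretched s f q v ((1 / normal_length q) *\<^sub>R E3 q)
        = g q v (E3 q) * (normal_length q)\<^sup>2 / normal_length q"
      using T[OF q] v unfolding normal_length_square
      by (simp add: stretched_def g_bilinear form_scaleR form_frame(3)[OF q v])
        (simp add: algebra_simps power2_eq_square add_divide_distrib)
    also have "\<dots> = g q v (E3 q) * normal_length q"
      by (rule cancel_square[of _ _ 1, simplified, OF normal_length_pos])
    finally show "stretched s f q v ((1 / normal_length q) *\<^sub>R E3 q) = g q v (E3 q) * normal_length q" .
  qed
  show ?thesis
    unfolding G.frame_on_def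
  proof (intro conjI ballI)
    show "open W" by (rule F'(1))
    show "vfield W (\<lambda>q. (1 / s) *\<^sub>R E1 q)" "vfield W (\<lambda>q. (1 / s) *\<^sub>R E2 q)"
      "vfield W (\<lambda>q. (1 / normal_length q) *\<^sub>R E3 q)"
      by (intro vfield_scaleR smooth_fun_const smooth_normal_length F'(2-4))+
    fix q assume q: "q \<in> W"
    note t = T[OF q] frame_on_ip[OF F q] sE[OF q]
    have nz: "normal_length q \<noteq> 0" using normal_length_pos[of q] by linarith
    show "stretched s f q ((1 / s) *\<^sub>R E1 q) ((1 / s) *\<^sub>R E1 q) = 1"
      "stretched s f q ((1 / s) *\<^sub>R E2 q) ((1 / s) *\<^sub>R E2 q) = 1"
      "stretched s f q ((1 / s) *\<^sub>R E1 q) ((1 / s) *\<^sub>R E2 q) = 0"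
      "stretched s f q ((1 / s) *\<^sub>R E1 q) ((1 / normal_length q) *\<^sub>R E3 q) = 0"
      "stretched s f q ((1 / s) *\<^sub>R E2 q) ((1 / normal_length q) *\<^sub>R E3 q) = 0"
      "stretched s f q ((1 / normal_length q) *\<^sub>R E3 q) ((1 / normal_length q) *\<^sub>R E3 q) = 1"
      using s nz by (simp_all only: t tangent_scaleR g_scaleR_left) simp_all
    fix v assume v: "v \<in> tangent q"
    show "v = stretched s f q v ((1 / s) *\<^sub>R E1 q) *\<^sub>R ((1 / s) *\<^sub>R E1 q)
      + stretched s f q v ((1 / s) *\<^sub>R E2 q) *\<^sub>R ((1 / s) *\<^sub>R E2 q)
      + stretched s f q v ((1 / normal_length q) *\<^sub>R E3 q) *\<^sub>R ((1 / normal_length q) *\<^sub>R E3 q)"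
      using F'(5)[OF q v] s nz by (simp only: sE[OF q v]) simp
  qed
qed

end

lemma framed_stretched: "framed A (stretched s f)"
proof (intro framed.intro framed_axioms.intro riemannian_stretched)
  fix p
  obtain W E1 E2 E3 where p: "p \<in> W" and F: "frame_on W E1 E2 E3"
    and \<xi>: "\<forall>q\<in>W. \<xi> q = span {E1 q, E2 q}" and "\<forall>q\<in>W. bracket E1 E2 q \<notin> \<xi> q"
    by (rule adapted_frame)
  from stretched_frame[OF F] \<xi> p
  show "\<exists>W E1 E2 E3. p \<in> W \<and> riemannian.frame_on A (stretched s f) W E1 E2 E3"
    by blast
qed

text \<open>Write m for the stretched length of \<open>E3\<close>. The bracket component along the
  normal gains the factor m/s^2, and the two mixed components gain 1/m, so m cancels in their
  product and only the squared term keeps m^2 = s^2 + f \<alpha>(E3)^2. No derivative of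
  \<open>f\<close> remains.\<close>

lemma gaussian_curvature_stretched:
  assumes F: "frame_on W E1 E2 E3" and \<xi>: "\<forall>q\<in>W. \<xi> q = span {E1 q, E2 q}" and p: "p \<in> W"
  shows "gaussian_curvature A (stretched s f) \<xi> p =
    (E1 p (ip (bracket E1 E2) E2) - E2 p (ip (bracket E1 E2) E1)
      - (ip (bracket E1 E2) E1 p)\<^sup>2 - (ip (bracket E1 E2) E2 p)\<^sup>2
      + ip (bracket E1 E2) E3 p * (ip (bracket E3 E1) E2 p - ip (bracket E3 E2) E1 p) / 2) / s\<^sup>2
    - 3 / 4 * (ip (bracket E1 E2) E3 p)\<^sup>2 * (s\<^sup>2 + f p * (\<alpha> p (E3 p))\<^sup>2) / s ^ 4"
proof -
  interpret G: framed A "stretched s f" by (rule framed_stretched)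
  let ?m = "\<lambda>q. sqrt (s\<^sup>2 + f q * (\<alpha> q (E3 q))\<^sup>2)"
  let ?G1 = "\<lambda>q. (1 / s) *\<^sub>R E1 q" and ?G2 = "\<lambda>q. (1 / s) *\<^sub>R E2 q"
    and ?G3 = "\<lambda>q. (1 / ?m q) *\<^sub>R E3 q"
  note f = frame_onD[OF F]
  note b = vfield_bracket[OF f(1)]
  have T: "E1 q \<in> tangent q" "E2 q \<in> tangent q" "E3 q \<in> tangent q" if "q \<in> W" for q
    using that f(2-4) by (auto intro: vfield_tangent)
  have BT: "bracket E1 E2 q \<in> tangent q" "bracket E3 E1 q \<in> tangent q" "bracket E3 E2 q \<in> tangent q"
    if "q \<in> W" for q
    using that f bracket_tangent by auto
  note ff = form_frame[OF F \<xi>]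
  have m: "0 < ?m q" for q by (rule normal_length_pos[OF F \<xi>])
  have m2: "(?m q)\<^sup>2 = s\<^sup>2 + f q * (\<alpha> q (E3 q))\<^sup>2" for q by (rule normal_length_square[OF F \<xi>])
  note sm = smooth_normal_length[OF F \<xi>]
  note vG = vfield_scaleR[OF smooth_fun_const f(2), of "1 / s"]
    vfield_scaleR[OF smooth_fun_const f(3), of "1 / s"]
  have GF: "G.frame_on W ?G1 ?G2 ?G3"
    by (rule stretched_frame[OF F \<xi>])
  have G\<xi>: "\<forall>q\<in>W. \<xi> q = span {?G1 q, ?G2 q}"
  proof
    fix q assume q: "q \<in> W"
    have "span {?G1 q, ?G2 q} = span {E1 q, E2 q}"
    proof -
      have e: "E1 q = s *\<^sub>R ?G1 q" "E2 q = s *\<^sub>R ?G2 q" using s by simp_all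
      have "?G1 q \<in> span {E1 q, E2 q}" "?G2 q \<in> span {E1 q, E2 q}"
        by (intro span_scale span_base; simp)+
      moreover have "E1 q \<in> span {?G1 q, ?G2 q}" "E2 q \<in> span {?G1 q, ?G2 q}"
        by (subst e, intro span_scale span_base; simp)+
      ultimately show ?thesis by (simp add: span_eq)
    qed
    then show "\<xi> q = span {?G1 q, ?G2 q}" using \<xi> q by simp
  qed
  have c0: "E q (\<lambda>_. 1 / s) = 0" if "vfield W E" "q \<in> W" for E q
    using tangent_const[OF vfield_tangent[OF that]] .
  have B12: "bracket ?G1 ?G2 q = (1 / s\<^sup>2) *\<^sub>R bracket E1 E2 q" if q: "q \<in> W" for q
    by (simp add: bracket_scaleR_left[OF f(1) q f(2) vG(2) smooth_fun_const]
        bracket_scaleR_right[OF f(1) q f(2,3) smooth_fun_const] c0[OF vG(2) q, simplified]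
        c0[OF f(2) q] power2_eq_square)
  \<comment> \<open>The derivative of the length contributes only a multiple of \<open>E3\<close>,
    which is orthogonal to the plane and disappears in \<open>d\<close>.\<close>
  have B3: "bracket ?G3 (\<lambda>q. (1 / s) *\<^sub>R E q) p = (1 / (s * ?m p)) *\<^sub>R bracket E3 E p
      - (((1 / s) *\<^sub>R E p) (\<lambda>q. 1 / ?m q)) *\<^sub>R E3 p" if E: "vfield W E" for E
    by (simp only: bracket_scaleR_left[OF f(1) p f(4) vfield_scaleR[OF smooth_fun_const E] sm]
        bracket_scaleR_right[OF f(1) p f(4) E smooth_fun_const] c0[OF f(4) p] scaleR_zero_left
        add_0_right scaleR_scaleR) (simp add: mult.commute)
  \<comment> \<open>These two components are differentiated in the curvature formula and are
    therefore needed on all of \<open>W\<close>; the components in \<open>c\<close> and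
    \<open>d\<close> are needed only at \<open>p\<close>.\<close>
  have a: "stretched s f q (bracket ?G1 ?G2 q) (?G1 q) = (1 / s) * ip (bracket E1 E2) E1 q"
    and b: "stretched s f q (bracket ?G1 ?G2 q) (?G2 q) = (1 / s) * ip (bracket E1 E2) E2 q"
    if q: "q \<in> W" for q
    using T[OF q] BT[OF q] s
    by (simp_all add: B12[OF q] stretched_def g_bilinear form_scaleR ff(1,2)[OF q] power2_eq_square)
  have c: "stretched s f p (bracket ?G1 ?G2 p) (?G3 p) = ip (bracket E1 E2) E3 p * ?m p / s\<^sup>2"
  proof -
    have "stretched s f p (bracket ?G1 ?G2 p) (?G3 p) = ip (bracket E1 E2) E3 p * (?m p)\<^sup>2 / (s\<^sup>2 * ?m p)"
      unfolding m2 using T[OF p] BT[OF p] s m[of p]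
      by (simp add: B12[OF p] stretched_def g_bilinear form_scaleR ff(3)[OF p BT(1)[OF p]])
        (simp add: field_simps power2_eq_square)
    then show ?thesis unfolding cancel_square[OF m] .
  qed
  have d: "stretched s f p (bracket ?G3 ?G1 p) (?G2 p) = ip (bracket E3 E1) E2 p / ?m p"
    "stretched s f p (bracket ?G3 ?G2 p) (?G1 p) = ip (bracket E3 E2) E1 p / ?m p"
    using T[OF p] BT[OF p] s
    by (simp_all only: B3[OF f(2)] B3[OF f(3)] stretched_def g_bilinear form_scaleR ff(1,2)[OF p]
        tangent_diff tangent_scaleR frame_on_ip[OF F p])
      (simp_all add: power2_eq_square)
  have der: "((1 / s) *\<^sub>R E p) (\<lambda>q. stretched s f q (bracket ?G1 ?G2 q) (X q)) = E p (ip (bracket E1 E2) Y) / s\<^sup>2"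
    if E: "vfield W E"
      and X: "\<And>q. q \<in> W \<Longrightarrow> stretched s f q (bracket ?G1 ?G2 q) (X q) = (1 / s) * ip (bracket E1 E2) Y q"
    for E X Y
  proof -
    have ET: "E p \<in> tangent p" using E p by (rule vfield_tangent)
    have "E p (\<lambda>q. stretched s f q (bracket ?G1 ?G2 q) (X q)) = E p (\<lambda>q. (1 / s) * ip (bracket E1 E2) Y q)"
      by (rule tangent_cong[OF ET f(1) p X])
    then show ?thesis
      by (simp only: tangent_cmult[OF ET] scaleR_fun_apply) (simp add: power2_eq_square)
  qed
  have sq: "(ip (bracket E1 E2) E3 p * ?m p / s\<^sup>2)\<^sup>2
      = (ip (bracket E1 E2) E3 p)\<^sup>2 * (s\<^sup>2 + f p * (\<alpha> p (E3 p))\<^sup>2) / s ^ 4"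
    unfolding power_divide power_mult_distrib m2 by simp
  have alg: "y / s\<^sup>2 - x / s\<^sup>2 - (1 / s * u)\<^sup>2 - (1 / s * v)\<^sup>2 + (w * r / s\<^sup>2) * (d / r - e / r) / 2
      - 3 / 4 * (w\<^sup>2 * z / s ^ 4)
    = (y - x - u\<^sup>2 - v\<^sup>2 + w * (d - e) / 2) / s\<^sup>2 - 3 / 4 * w\<^sup>2 * z / s ^ 4"
    if "0 < r" for u v w x y z d e r :: real
    using that s by (simp add: field_simps power2_eq_square)
  have der_b: "?G1 p (\<lambda>q. stretched s f q (bracket ?G1 ?G2 q) (?G2 q)) = E1 p (ip (bracket E1 E2) E2) / s\<^sup>2"
    by (rule der[OF f(2)], rule b)
  have der_a: "?G2 p (\<lambda>q. stretched s f q (bracket ?G1 ?G2 q) (?G1 q)) = E2 p (ip (bracket E1 E2) E1) / s\<^sup>2"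
    by (rule der[OF f(3)], rule a)
  show ?thesis
    unfolding G.gaussian_curvature_frame[OF GF G\<xi> p] der_a der_b a[OF p] b[OF p] c d sq
    by (rule alg[OF m])
qed

end

section \<open>Prescribing the curvature\<close>

theorem constant_gaussian_curvature:
  assumes "compact (UNIV :: 'a set)"
  obtains s f where "riemannian A (stretched s f)"
    and "\<forall>p. gaussian_curvature A (stretched s f) \<xi> p = - 1"
proof -
  let ?z = "\<lambda>_::'a. 0 :: real" and ?o = "\<lambda>_::'a. 1 :: real"
  \<comment> \<open>With parameters 1 and 0 the stretched metric has the values of \<open>g\<close>;
    in this form the formula for stretched metrics applies to it as well.\<close>
  define K where "K = gaussian_curvature A (stretched 1 ?z) \<xi>"
  define \<Delta> where "\<Delta> p = K p - gaussian_curvature A (stretched 1 ?o) \<xi> p" for p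
  \<comment> \<open>Frames exist only locally. Stated for the globally defined \<open>K\<close> and
    \<open>\<Delta>\<close>, the outcome of the local computation no longer mentions them, so
    smoothness can be glued.\<close>
  have loc: "\<exists>W. open W \<and> p \<in> W \<and> smooth_fun W K \<and> smooth_fun W \<Delta> \<and> 0 < \<Delta> p \<and>
    (\<forall>s f. 0 < s \<longrightarrow> smooth_fun UNIV f \<longrightarrow> (\<forall>q. 0 \<le> f q) \<longrightarrow>
      gaussian_curvature A (stretched s f) \<xi> p = K p / s\<^sup>2 - f p * \<Delta> p / s ^ 4)" for p
  proof -
    obtain W E1 E2 E3 where p: "p \<in> W" and F: "frame_on W E1 E2 E3"
      and \<xi>: "\<forall>q\<in>W. \<xi> q = span {E1 q, E2 q}" and ni: "\<forall>q\<in>W. bracket E1 E2 q \<notin> \<xi> q"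
      by (rule adapted_frame)
    note f = frame_onD[OF F]
    note v = f(2-4) vfield_bracket[OF f(1)]
    define P where "P q = E1 q (ip (bracket E1 E2) E2) - E2 q (ip (bracket E1 E2) E1)
      - ip (bracket E1 E2) E1 q * ip (bracket E1 E2) E1 q - ip (bracket E1 E2) E2 q * ip (bracket E1 E2) E2 q
      + ip (bracket E1 E2) E3 q * (ip (bracket E3 E1) E2 q - ip (bracket E3 E2) E1 q) / 2" for q
    define Q where "Q q = 3 / 4 * (ip (bracket E1 E2) E3 q * ip (bracket E1 E2) E3 q)" for q
    define R where "R q = \<alpha> q (E3 q) * \<alpha> q (E3 q)" for q
    have form: "gaussian_curvature A (stretched s f) \<xi> q = P q / s\<^sup>2 - Q q * (s\<^sup>2 + f q * R q) / s ^ 4"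
      if "0 < s" "smooth_fun UNIV f" "\<forall>q. 0 \<le> f q" "q \<in> W" for s f q
      using gaussian_curvature_stretched[OF that(1,2) _ F \<xi> that(4)] that(3)
      by (simp add: P_def Q_def R_def power2_eq_square)
    \<comment> \<open>The parameters 0 and 1 for \<open>f\<close> give \<open>P - Q\<close> and
      \<open>P - Q * (1 + R)\<close>, which differ by \<open>Q * R\<close>.\<close>
    have KW: "K q = P q - Q q" and DW: "\<Delta> q = Q q * R q" if "q \<in> W" for q
      using form[of 1 ?z q] form[of 1 ?o q] that smooth_fun_const
      by (simp_all add: K_def \<Delta>_def algebra_simps)
    have sP: "smooth_fun W P"
      unfolding P_def
      by (intro smooth_fun_add smooth_fun_diff smooth_fun_mult smooth_fun_divide smooth_fun_const
          ip_smooth v f(1) vfield_smooth[OF f(2)] vfield_smooth[OF f(3)] order.refl) simp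
    have sQ: "smooth_fun W Q" and sR: "smooth_fun W R"
      unfolding Q_def R_def
      by (intro smooth_fun_mult smooth_fun_const ip_smooth form_smooth v f(1))+
    have "smooth_fun W K"
      by (rule smooth_fun_cong[OF f(1) _ smooth_fun_diff[OF f(1) sP sQ]]) (simp add: KW)
    moreover have "smooth_fun W \<Delta>"
      by (rule smooth_fun_cong[OF f(1) _ smooth_fun_mult[OF f(1) sQ sR]]) (simp add: DW)
    moreover have "0 < \<Delta> p"
    proof -
      have BT: "bracket E1 E2 p \<in> tangent p" by (rule bracket_tangent[OF f(1) p f(2,3)])
      have ET: "E3 p \<in> tangent p" using f(4) p by (rule vfield_tangent)
      have "ip (bracket E1 E2) E3 p \<noteq> 0"
        using ni \<xi> p frame_span(1)[OF F p] BT by auto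
      moreover have "E3 p \<notin> \<xi> p"
        using \<xi> p frame_span(1)[OF F p] frame_on_ip[OF F p] by auto
      then have "\<alpha> p (E3 p) \<noteq> 0" using kernel ET by auto
      ultimately show ?thesis
        by (simp add: DW[OF p] Q_def R_def zero_less_mult_iff) (metis linorder_neqE_linordered_idom)
    qed
    moreover have "gaussian_curvature A (stretched s f) \<xi> p = K p / s\<^sup>2 - f p * \<Delta> p / s ^ 4"
      if "0 < s" "smooth_fun UNIV f" "\<forall>q. 0 \<le> f q" for s f
      unfolding form[OF that p] KW[OF p] DW[OF p] using that(1)
      by (simp add: field_simps power2_eq_square power4_eq_xxxx)
    ultimately show ?thesis using f(1) p by blast
  qed
  have sK: "smooth_fun UNIV K"
  proof (rule smooth_fun_local)
    show "\<exists>W. open W \<and> p \<in> W \<and> smooth_fun (UNIV \<inter> W) K" for p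
      unfolding Int_UNIV_left using loc[of p] by (elim exE conjE) (rule exI, intro conjI)
  qed
  have s\<Delta>: "smooth_fun UNIV \<Delta>"
  proof (rule smooth_fun_local)
    show "\<exists>W. open W \<and> p \<in> W \<and> smooth_fun (UNIV \<inter> W) \<Delta>" for p
      unfolding Int_UNIV_left using loc[of p] by (elim exE conjE) (rule exI, intro conjI)
  qed
  have "bounded (range K)"
    by (intro compact_imp_bounded compact_continuous_image smooth_fun_continuous_on sK assms open_UNIV)
  then obtain B where B: "\<And>p. \<bar>K p\<bar> \<le> B" by (auto simp: bounded_iff)
  \<comment> \<open>Adding 1 to the bound keeps \<open>s\<close> positive even if \<open>K\<close>
    vanishes identically, and makes \<open>K + s^2\<close> positive.\<close>
  define s where "s = sqrt (B + 1)"
  have B0: "0 \<le> B" using B[of undefined] by linarith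
  then have s: "0 < s" "s\<^sup>2 = B + 1" by (simp_all add: s_def)
  \<comment> \<open>The solution of \<open>K p / s^2 - f p * \<Delta> p / s^4 = - 1\<close>; it is
    smooth because \<open>\<Delta>\<close> is smooth and has no zeros.\<close>
  define f where "f p = s\<^sup>2 * (K p + s\<^sup>2) / \<Delta> p" for p
  have pos: "0 < \<Delta> p" for p using loc[of p] by (elim exE conjE)
  have f: "smooth_fun UNIV f"
    unfolding f_def
    by (intro smooth_fun_divide smooth_fun_mult smooth_fun_add smooth_fun_const sK s\<Delta> open_UNIV)
      (use pos less_irrefl in metis)
  have f0: "0 \<le> f p" for p
    using B[of p] B0 pos[of p] by (simp add: f_def s(2))
  have "gaussian_curvature A (stretched s f) \<xi> p = - 1" for p
  proof -
    have "gaussian_curvature A (stretched s f) \<xi> p = K p / s\<^sup>2 - f p * \<Delta> p / s ^ 4"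
      using loc[of p] by (elim exE conjE) (simp only: s(1) f f0 simp_thms)
    also have "f p * \<Delta> p = s\<^sup>2 * (K p + s\<^sup>2)"
      using pos[of p] by (simp add: f_def)
    finally show ?thesis
      using s(1) by (simp add: field_simps power2_eq_square power4_eq_xxxx)
  qed
  then show ?thesis using that[of s f] riemannian_stretched[OF s(1) f f0] by blast
qed

end

theorem corollary6p2:
  fixes A :: "'a::t2_space chart set"
    and \<xi> :: "'a \<Rightarrow> 'a tvec set"
  assumes "compact (UNIV :: 'a set)"
    and "smooth_atlas A"
    and "orientable A"
    and "contact_structure A \<xi>"
    and "transversally_orientable A \<xi>"
  shows "\<exists>g. riemannian_metric A g \<and> (\<forall>p. gaussian_curvature A g \<xi> p = -1)"
proof -
  obtain \<alpha> where \<alpha>: "one_form A \<alpha>" "\<forall>p. \<xi> p = {v \<in> tangent_space A p. \<alpha> p v = 0}"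
    using assms(5) by (auto simp: transversally_orientable_def)
  interpret contact_manifold A \<xi> \<alpha>
    using assms(2,4) \<alpha> by unfold_locales auto
  obtain g where "riemannian_metric A g"
    using metric_exists[OF assms(1)] .
  then interpret contact_metric A \<xi> \<alpha> g
    by unfold_locales
  obtain s f where r: "riemannian A (stretched s f)"
    and k: "\<forall>p. gaussian_curvature A (stretched s f) \<xi> p = - 1"
    using constant_gaussian_curvature[OF assms(1)] .
  show ?thesis
    using riemannian.metric[OF r] k by blast
qed

end
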